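(* Let $M$ be any $n$-dimensional Frobenius manifold. Consider the flows on the even variables $v^\alpha$ and the odd variables $\sigma_{\alpha,k}$ ($\alpha=1,\dots,n$; $k\ge 0$) given by \[\frac{\partial v^\alpha}{\partial t^{\beta,p}}=\eta^{\alpha\gamma}(\partial_\lambda\partial_\gamma h_{\beta,p+1})\,v^{\lambda,1},\qquad \frac{\partial \sigma_{\alpha,k}}{\partial t^{\beta,p}}=\eta^{\gamma\epsilon}(\partial_\alpha\partial_\epsilon h_{\beta,p+1})\,\sigma_{\gamma,k}^1,\] \[\frac{\partial v^\alpha}{\partial\tau_m}=\eta^{\alpha\beta}\sigma_{\beta,m}^1,\qquad \frac{\partial\sigma_{\alpha,k}}{\partial\tau_m}=-\frac{\partial\sigma_{\alpha,m}}{\partial\tau_k}=\Gamma_\alpha^{\gamma\beta}\sum_{i=0}^{m-k-1}\sigma_{\beta,k+i}\,\sigma_{\gamma,m-i-1}^1\quad(0\le k\le m),\] where $\alpha,\beta=1,\dots,n$ and $m,p\ge 0$. Then all these flows mutually commute (in the graded sense: $[\partial_{t^{\alpha,p}},\partial_{t^{\beta,q}}]=0$, $[\partial_{t^{\alpha,p}},\partial_{\tau_m}]=0$, and $\partial_{\tau_m}\partial_{\tau_k}+\partial_{\tau_k}\partial_{\tau_m}=0$).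
   Context: Summation over repeated upper and lower Greek indices is assumed. Frobenius manifold data. $M$ is an $n$-dimensional (complex) Frobenius manifold with flat metric $\eta$, multiplication $\cdot$ on $TM$, Euler vector field $E$ and charge $d$; $v^1,\dots,v^n$ are flat coordinates of $\eta$, $\partial_\alpha=\partial/\partial v^\alpha$, and $\partial_1$ is the unit vector field. With $F$ the potential, $\eta_{\alpha\beta}=\partial_1\partial_\alpha\partial_\beta F$ (constant, nondegenerate), $(\eta^{\alpha\beta})=(\eta_{\alpha\beta})^{-1}$, $c_{\alpha\beta}^\gamma=\eta^{\gamma\zeta}\partial_\zeta\partial_\alpha\partial_\beta F$ are the structure constants, and $c^{\alpha\beta}_\gamma=\eta^{\alpha\zeta}c_{\zeta\gamma}^\beta$. The Euler field is $E=E^\alpha\partial_\alpha=\sum_\alpha\big((1-\tfrac d2-\mu_\alpha)v^\alpha+r_\alpha\big)\partial_\alpha$, with $\mu=\mathrm{diag}(\mu_1,\dots,\mu_n)$, $\mu_1=-d/2$, $(\mu_\alpha+\mu_\beta)\eta_{\alpha\beta}=0$, $\mathcal L_E\eta_{\alpha\beta}=(2-d)\eta_{\alpha\beta}$, $\mathcal L_Ec^\gamma_{\alpha\beta}=c^\gamma_{\alpha\beta}$. The intersection form is $g^{\alpha\beta}=E^\epsilon c^{\alpha\beta}_\epsilon$, and its contravariant Christoffel symbols are $\Gamma^{\alpha\beta}_\gamma=(\tfrac12-\mu_\beta)c^{\alpha\beta}_\gamma$ (no sum over $\beta$). The functions $h_{\alpha,p}(v)$, $p\ge0$, are the coefficients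 of $h_\alpha(v,z)=\sum_{p\ge 0}h_{\alpha,p}(v)z^p$, where $(h_1,\dots,h_n)z^\mu z^R$ is a system of flat coordinates of the deformed flat connection of $M$; they satisfy $\partial_\alpha\partial_\beta h_{\gamma,p+1}=c^\lambda_{\alpha\beta}\partial_\lambda h_{\gamma,p}$, $h_{\alpha,0}=\eta_{\alpha\gamma}v^\gamma$, $\partial_1h_{\alpha,p+1}=h_{\alpha,p}$, $E(\partial_\beta h_{\alpha,p})=(p+\mu_\alpha+\mu_\beta)\partial_\beta h_{\alpha,p}+\sum_{k=1}^p(R_k)^\gamma_\alpha\partial_\beta h_{\gamma,p-k}$, and $\langle\nabla h_\alpha(v,z),\nabla h_\beta(v,-z)\rangle=\eta_{\alpha\beta}$. Here $R=R_1+\dots+R_m$ is the constant matrix of isomonodromy data at $z=0$, with $[\mu,R_k]=kR_k$. Differential ring. Let $\hat{\mathcal A}(M)$ be the supercommutative ring locally generated over functions of $v^1,\dots,v^n$ by even variables $v^{\alpha,s}$ ($s\ge1$, $v^{\alpha,0}=v^\alpha$) and odd variables $\sigma_{\alpha,k}^s$ ($k,s\ge 0$; $\sigma_{\alpha,k}^0=\sigma_{\alpha,k}$; $\deg\sigma_{\alpha,k}^s=1$), with even derivation $\partial=\partial_x$, $\partial v^{\alpha,s}=v^{\alpha,s+1}$, $\partial\sigma_{\alpha,k}^s=\sigma_{\alpha,k}^{s+1}$, subject to the relations (and all their $\partial$-derivatives) \[\eta^{\alpha\beta}\sigma_{\beta,k+1}^1=g^{\alpha\beta}\sigma_{\beta,k}^1+\Gamma_\gamma^{\alpha\beta}v^{\gamma,1}\sigma_{\beta,k},\qquad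 k\ge0,\] with the convention that there are no nonzero odd constants: an element of positive super degree annihilated by $\partial$ is zero. Flows: $\partial/\partial t^{\beta,p}$ are even derivations and $\partial/\partial\tau_m$ are odd derivations (signed Leibniz rule), all commuting with $\partial$, so they are determined by their values on $v^\alpha$ and $\sigma_{\alpha,k}$. An empty sum is $0$. *)

theory Defs
  imports "HOL-Analysis.Analysis" "HOL-Library.Poly_Mapping"
begin

section \<open>Holomorphic functions of several variables\<close>

definition cholo :: "(complex^'n) set \<Rightarrow> (complex^'n \<Rightarrow> complex) \<Rightarrow> bool" where
  "cholo U f \<longleftrightarrow>
     (\<forall>x\<in>U. \<exists>a. (f has_derivative (\<lambda>y. \<Sum>\<alpha>\<in>UNIV. a $ \<alpha> * y $ \<alpha>)) (at x))"

definition pd :: "'n \<Rightarrow> (complex^'n \<Rightarrow> complex) \<Rightarrow> complex^'n \<Rightarrow> complex" where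
  "pd \<alpha> f x = deriv (\<lambda>t. f (x + axis \<alpha> t)) 0"


section \<open>Frobenius manifolds in flat coordinates\<close>

text \<open>
  The data live on an open set \<open>chart\<close> of complex \<open>n\<close>-space with the flat coordinates \<open>v\<^sup>\<alpha> = x $ \<alpha>\<close>, the index
  type \<open>'n\<close> playing the role of \<open>{1,\<dots>,n}\<close> and \<open>unt\<close> that of the index \<open>1\<close>.
  \<open>eta\<close> is the matrix with lower indices; \<open>Rmat k $ \<gamma> $ \<alpha>\<close> is \<open>(R\<^sub>k)\<close> with upper index \<open>\<gamma>\<close> and lower
  index \<open>\<alpha>\<close>; \<open>ham \<alpha> p\<close> is the function \<open>h\<^bsub>\<alpha>,p\<^esub>\<close>.
\<close>

record ('n::finite) frob =
  chart :: "(complex^'n) set"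
  pot :: "complex^'n \<Rightarrow> complex"
  unt :: 'n
  eta :: "complex^'n^'n"
  chg :: complex
  mu :: "'n \<Rightarrow> complex"
  shift :: "'n \<Rightarrow> complex"
  Rmat :: "nat \<Rightarrow> complex^'n^'n"
  ham :: "'n \<Rightarrow> nat \<Rightarrow> complex^'n \<Rightarrow> complex"

definition etainv :: "('n::finite) frob \<Rightarrow> complex^'n^'n" where
  "etainv M = matrix_inv (eta M)"

text \<open>\<open>cmul M \<alpha> \<beta> \<gamma>\<close> has lower indices \<open>\<alpha>, \<beta>\<close> and upper index \<open>\<gamma>\<close>;
  \<open>cup M \<alpha> \<beta> \<gamma>\<close> and \<open>Gam M \<alpha> \<beta> \<gamma>\<close> have upper indices \<open>\<alpha>, \<beta>\<close> and lower index \<open>\<gamma>\<close>.\<close>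

definition cmul :: "('n::finite) frob \<Rightarrow> 'n \<Rightarrow> 'n \<Rightarrow> 'n \<Rightarrow> complex^'n \<Rightarrow> complex" where
  "cmul M \<alpha> \<beta> \<gamma> x = (\<Sum>\<zeta>\<in>UNIV. etainv M $ \<gamma> $ \<zeta> * pd \<zeta> (pd \<alpha> (pd \<beta> (pot M))) x)"

definition cup :: "('n::finite) frob \<Rightarrow> 'n \<Rightarrow> 'n \<Rightarrow> 'n \<Rightarrow> complex^'n \<Rightarrow> complex" where
  "cup M \<alpha> \<beta> \<gamma> x = (\<Sum>\<zeta>\<in>UNIV. etainv M $ \<alpha> $ \<zeta> * cmul M \<zeta> \<gamma> \<beta> x)"

definition euler :: "('n::finite) frob \<Rightarrow> 'n \<Rightarrow> complex^'n \<Rightarrow> complex" where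
  "euler M \<alpha> x = (1 - chg M / 2 - mu M \<alpha>) * x $ \<alpha> + shift M \<alpha>"

definition gmet :: "('n::finite) frob \<Rightarrow> 'n \<Rightarrow> 'n \<Rightarrow> complex^'n \<Rightarrow> complex" where
  "gmet M \<alpha> \<beta> x = (\<Sum>\<epsilon>\<in>UNIV. euler M \<epsilon> x * cup M \<alpha> \<beta> \<epsilon> x)"

definition Gam :: "('n::finite) frob \<Rightarrow> 'n \<Rightarrow> 'n \<Rightarrow> 'n \<Rightarrow> complex^'n \<Rightarrow> complex" where
  "Gam M \<alpha> \<beta> \<gamma> x = (1/2 - mu M \<beta>) * cup M \<alpha> \<beta> \<gamma> x"

definition along_euler ::
  "('n::finite) frob \<Rightarrow> (complex^'n \<Rightarrow> complex) \<Rightarrow> complex^'n \<Rightarrow> complex" where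
  "along_euler M f x = (\<Sum>\<epsilon>\<in>UNIV. euler M \<epsilon> x * pd \<epsilon> f x)"

text \<open>Coordinate expressions of the Lie derivative along the Euler field of a tensor with two lower
  indices, and of a tensor \<open>T \<alpha> \<beta> \<gamma>\<close> with lower indices \<open>\<alpha>, \<beta>\<close> and upper index \<open>\<gamma>\<close>.\<close>

definition lie02 :: "('n::finite) frob \<Rightarrow> ('n \<Rightarrow> 'n \<Rightarrow> complex^'n \<Rightarrow> complex) \<Rightarrow>
    'n \<Rightarrow> 'n \<Rightarrow> complex^'n \<Rightarrow> complex" where
  "lie02 M T \<alpha> \<beta> x = along_euler M (T \<alpha> \<beta>) x
     + (\<Sum>\<epsilon>\<in>UNIV. T \<epsilon> \<beta> x * pd \<alpha> (euler M \<epsilon>) x)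
     + (\<Sum>\<epsilon>\<in>UNIV. T \<alpha> \<epsilon> x * pd \<beta> (euler M \<epsilon>) x)"

definition lie12 :: "('n::finite) frob \<Rightarrow> ('n \<Rightarrow> 'n \<Rightarrow> 'n \<Rightarrow> complex^'n \<Rightarrow> complex) \<Rightarrow>
    'n \<Rightarrow> 'n \<Rightarrow> 'n \<Rightarrow> complex^'n \<Rightarrow> complex" where
  "lie12 M T \<alpha> \<beta> \<gamma> x = along_euler M (T \<alpha> \<beta> \<gamma>) x
     - (\<Sum>\<epsilon>\<in>UNIV. T \<alpha> \<beta> \<epsilon> x * pd \<epsilon> (euler M \<gamma>) x)
     + (\<Sum>\<epsilon>\<in>UNIV. T \<epsilon> \<beta> \<gamma> x * pd \<alpha> (euler M \<epsilon>) x)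
     + (\<Sum>\<epsilon>\<in>UNIV. T \<alpha> \<epsilon> \<gamma> x * pd \<beta> (euler M \<epsilon>) x)"

definition frobenius_manifold :: "('n::finite) frob \<Rightarrow> bool" where
  "frobenius_manifold M \<longleftrightarrow>
     open (chart M) \<and> cholo (chart M) (pot M) \<and>
     (\<forall>x\<in>chart M. \<forall>\<alpha> \<beta>. pd (unt M) (pd \<alpha> (pd \<beta> (pot M))) x = eta M $ \<alpha> $ \<beta>) \<and>
     invertible (eta M) \<and>
     (\<forall>x\<in>chart M. \<forall>\<alpha> \<beta> \<gamma> \<delta>. (\<Sum>\<epsilon>\<in>UNIV. cmul M \<alpha> \<beta> \<epsilon> x * cmul M \<epsilon> \<gamma> \<delta> x)
                          = (\<Sum>\<epsilon>\<in>UNIV. cmul M \<beta> \<gamma> \<epsilon> x * cmul M \<alpha> \<epsilon> \<delta> x)) \<and>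
     mu M (unt M) = - chg M / 2 \<and>
     (\<forall>\<alpha> \<beta>. (mu M \<alpha> + mu M \<beta>) * eta M $ \<alpha> $ \<beta> = 0) \<and>
     (\<forall>x\<in>chart M. \<forall>\<alpha> \<beta>. lie02 M (\<lambda>\<alpha> \<beta> _. eta M $ \<alpha> $ \<beta>) \<alpha> \<beta> x = (2 - chg M) * eta M $ \<alpha> $ \<beta>) \<and>
     (\<forall>x\<in>chart M. \<forall>\<alpha> \<beta> \<gamma>. lie12 M (cmul M) \<alpha> \<beta> \<gamma> x = cmul M \<alpha> \<beta> \<gamma> x)"

text \<open>The last clause is \<open>\<langle>\<nabla>h\<^sub>\<alpha>(v,z), \<nabla>h\<^sub>\<beta>(v,-z)\<rangle> = \<eta>\<^bsub>\<alpha>\<beta>\<^esub>\<close>, coefficient by coefficient in \<open>z\<close>.\<close>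

definition calibration :: "('n::finite) frob \<Rightarrow> bool" where
  "calibration M \<longleftrightarrow>
     (\<exists>m. \<forall>k>m. Rmat M k = 0) \<and>
     (\<forall>k\<ge>1. \<forall>\<alpha> \<beta>. (mu M \<alpha> - mu M \<beta>) * Rmat M k $ \<alpha> $ \<beta> = of_nat k * Rmat M k $ \<alpha> $ \<beta>) \<and>
     (\<forall>\<alpha> p. cholo (chart M) (ham M \<alpha> p)) \<and>
     (\<forall>x\<in>chart M. \<forall>\<alpha>. ham M \<alpha> 0 x = (\<Sum>\<gamma>\<in>UNIV. eta M $ \<alpha> $ \<gamma> * x $ \<gamma>)) \<and>
     (\<forall>x\<in>chart M. \<forall>\<alpha> \<beta> \<gamma> p. pd \<alpha> (pd \<beta> (ham M \<gamma> (Suc p))) x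
                          = (\<Sum>\<kappa>\<in>UNIV. cmul M \<alpha> \<beta> \<kappa> x * pd \<kappa> (ham M \<gamma> p) x)) \<and>
     (\<forall>x\<in>chart M. \<forall>\<alpha> p. pd (unt M) (ham M \<alpha> (Suc p)) x = ham M \<alpha> p x) \<and>
     (\<forall>x\<in>chart M. \<forall>\<alpha> \<beta> p. along_euler M (pd \<beta> (ham M \<alpha> p)) x
         = (of_nat p + mu M \<alpha> + mu M \<beta>) * pd \<beta> (ham M \<alpha> p) x
           + (\<Sum>k=1..p. \<Sum>\<gamma>\<in>UNIV. Rmat M k $ \<gamma> $ \<alpha> * pd \<beta> (ham M \<gamma> (p - k)) x)) \<and>
     (\<forall>x\<in>chart M. \<forall>\<alpha> \<beta> N.
         (\<Sum>p\<le>N. (-1) ^ (N - p) * (\<Sum>\<kappa>\<in>UNIV. \<Sum>\<nu>\<in>UNIV.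
             etainv M $ \<kappa> $ \<nu> * pd \<kappa> (ham M \<alpha> p) x * pd \<nu> (ham M \<beta> (N - p)) x))
         = (if N = 0 then eta M $ \<alpha> $ \<beta> else 0))"


section \<open>The free algebra on the generators\<close>

text \<open>
  \<open>Fn f\<close> is a symbol for a function \<open>f(v)\<close>, \<open>V \<alpha> s\<close> stands for \<open>v\<^bsup>\<alpha>,s+1\<^esup>\<close> (so that the
  indeterminates start with the first derivative), and \<open>S \<alpha> k s\<close> for the odd variable \<open>\<sigma>\<^bsub>\<alpha>,k\<^esub>\<^sup>s\<close>.
  Words in the generators form the free monoid, written additively so that the convolution product
  of \<^type>\<open>poly_mapping\<close> makes the type \<open>'n alg\<close> the free associative complex algebra.
\<close>

datatype ('n::finite) gen = Fn "complex^'n \<Rightarrow> complex" | V 'n nat | S 'n nat nat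

datatype 'g word = Word (letters: "'g list")

instantiation word :: (type) monoid_add
begin

definition zero_word :: "'g word" where
  "zero_word = Word []"

definition plus_word :: "'g word \<Rightarrow> 'g word \<Rightarrow> 'g word" where
  "plus_word u w = Word (letters u @ letters w)"

instance
  by standard (simp_all add: zero_word_def plus_word_def)

end

type_synonym 'n alg = "'n gen word \<Rightarrow>\<^sub>0 complex"

definition cst :: "complex \<Rightarrow> ('n::finite) alg" where
  "cst a = Poly_Mapping.single 0 a"

definition mon :: "('n::finite) gen list \<Rightarrow> 'n alg" where
  "mon w = Poly_Mapping.single (Word w) 1"

definition gn :: "('n::finite) gen \<Rightarrow> 'n alg" where
  "gn g = mon [g]"

definition fn :: "(complex^'n \<Rightarrow> complex) \<Rightarrow> ('n::finite) alg" where
  "fn f = gn (Fn f)"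

definition vv :: "'n \<Rightarrow> nat \<Rightarrow> ('n::finite) alg" where
  "vv \<alpha> s = (case s of 0 \<Rightarrow> fn (\<lambda>x. x $ \<alpha>) | Suc r \<Rightarrow> gn (V \<alpha> r))"

definition sg :: "'n \<Rightarrow> nat \<Rightarrow> nat \<Rightarrow> ('n::finite) alg" where
  "sg \<alpha> k s = gn (S \<alpha> k s)"

fun odd_gen :: "('n::finite) gen \<Rightarrow> bool" where
  "odd_gen (S \<alpha> k s) = True"
| "odd_gen g = False"

definition homog :: "nat \<Rightarrow> ('n::finite) alg \<Rightarrow> bool" where
  "homog p x \<longleftrightarrow> (\<forall>w\<in>Poly_Mapping.keys x. length (filter odd_gen (letters w)) = p)"

text \<open>
  \<open>derivation od d\<close> is the complex linear derivation of the free algebra with value \<open>d g\<close> on each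
  generator \<open>g\<close>; it is odd, that is \<open>D (x * y) = D x * y + (-1)\<^bsup>deg x\<^esup> * x * D y\<close>, if \<open>od\<close> is true.
\<close>

primrec der_word :: "bool \<Rightarrow> (('n::finite) gen \<Rightarrow> 'n alg) \<Rightarrow> 'n gen list \<Rightarrow> 'n alg" where
  "der_word od d [] = 0"
| "der_word od d (g # w) = d g * mon w
     + (if od \<and> odd_gen g then - (gn g * der_word od d w) else gn g * der_word od d w)"

definition derivation :: "bool \<Rightarrow> (('n::finite) gen \<Rightarrow> 'n alg) \<Rightarrow> 'n alg \<Rightarrow> 'n alg" where
  "derivation od d x =
     (\<Sum>w\<in>Poly_Mapping.keys x. cst (Poly_Mapping.lookup x w) * der_word od d (letters w))"

text \<open>The chain rule. Symbols of functions that are not holomorphic on the chart are set to zero in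
  the differential ring (rule \<open>junk\<close> below), hence the second branch.\<close>

definition chain :: "('n::finite) frob \<Rightarrow> ('n \<Rightarrow> 'n alg) \<Rightarrow> (complex^'n \<Rightarrow> complex) \<Rightarrow> 'n alg" where
  "chain M a f = (if cholo (chart M) f then \<Sum>\<alpha>\<in>UNIV. fn (pd \<alpha> f) * a \<alpha> else 0)"

primrec dx_gen :: "('n::finite) frob \<Rightarrow> 'n gen \<Rightarrow> 'n alg" where
  "dx_gen M (Fn f) = chain M (\<lambda>\<alpha>. vv \<alpha> 1) f"
| "dx_gen M (V \<alpha> s) = gn (V \<alpha> (Suc s))"
| "dx_gen M (S \<alpha> k s) = gn (S \<alpha> k (Suc s))"

definition dx :: "('n::finite) frob \<Rightarrow> 'n alg \<Rightarrow> 'n alg" where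
  "dx M = derivation False (dx_gen M)"


section \<open>The differential ring\<close>

definition recursion_rel :: "('n::finite) frob \<Rightarrow> 'n \<Rightarrow> nat \<Rightarrow> 'n alg" where
  "recursion_rel M \<alpha> k =
     (\<Sum>\<beta>\<in>UNIV. cst (etainv M $ \<alpha> $ \<beta>) * sg \<beta> (Suc k) 1)
     - ((\<Sum>\<beta>\<in>UNIV. fn (gmet M \<alpha> \<beta>) * sg \<beta> k 1)
        + (\<Sum>\<beta>\<in>UNIV. \<Sum>\<gamma>\<in>UNIV. fn (Gam M \<alpha> \<beta> \<gamma>) * vv \<gamma> 1 * sg \<beta> k 0))"

text \<open>
  The two-sided ideal of all relations of the differential ring, which is the quotient of the free
  algebra by it. Rule \<open>no_odd_constants\<close> is the convention that an element of positive super degree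
  annihilated by the derivation \<open>dx\<close> is zero.
\<close>

inductive_set relations :: "('n::finite) frob \<Rightarrow> 'n alg set" for M :: "'n frob" where
  zero: "0 \<in> relations M"
| add: "x \<in> relations M \<Longrightarrow> y \<in> relations M \<Longrightarrow> x + y \<in> relations M"
| mult: "x \<in> relations M \<Longrightarrow> a * x * b \<in> relations M"
| fn_const: "fn (\<lambda>_. a) - cst a \<in> relations M"
| fn_add: "cholo (chart M) f \<Longrightarrow> cholo (chart M) g \<Longrightarrow>
    fn (\<lambda>x. f x + g x) - (fn f + fn g) \<in> relations M"
| fn_mult: "cholo (chart M) f \<Longrightarrow> cholo (chart M) g \<Longrightarrow>
    fn (\<lambda>x. f x * g x) - fn f * fn g \<in> relations M"
| fn_eq: "(\<And>x. x \<in> chart M \<Longrightarrow> f x = g x) \<Longrightarrow> fn f - fn g \<in> relations M"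
| junk: "\<not> cholo (chart M) f \<Longrightarrow> fn f \<in> relations M"
| even_commute: "\<not> odd_gen a \<Longrightarrow> gn a * gn b - gn b * gn a \<in> relations M"
| odd_anticommute: "odd_gen a \<Longrightarrow> odd_gen b \<Longrightarrow> gn a * gn b + gn b * gn a \<in> relations M"
| recursion: "recursion_rel M \<alpha> k \<in> relations M"
| diff: "x \<in> relations M \<Longrightarrow> dx M x \<in> relations M"
| no_odd_constants: "0 < p \<Longrightarrow> homog p x \<Longrightarrow> dx M x \<in> relations M \<Longrightarrow> x \<in> relations M"

definition ring_eq :: "('n::finite) frob \<Rightarrow> 'n alg \<Rightarrow> 'n alg \<Rightarrow> bool" where
  "ring_eq M x y \<longleftrightarrow> x - y \<in> relations M"

definition descends :: "('n::finite) frob \<Rightarrow> ('n alg \<Rightarrow> 'n alg) \<Rightarrow> bool" where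
  "descends M D \<longleftrightarrow> (\<forall>x y. ring_eq M x y \<longrightarrow> ring_eq M (D x) (D y))"


section \<open>The flows\<close>

text \<open>The flow with \<open>v\<^sup>\<alpha> \<mapsto> a \<alpha>\<close> and \<open>\<sigma>\<^bsub>\<alpha>,k\<^esub> \<mapsto> b \<alpha> k\<close>, extended to the other generators by the chain
  rule and by commutation with \<open>dx\<close>.\<close>

primrec flow_gen :: "('n::finite) frob \<Rightarrow> ('n \<Rightarrow> 'n alg) \<Rightarrow> ('n \<Rightarrow> nat \<Rightarrow> 'n alg) \<Rightarrow> 'n gen \<Rightarrow> 'n alg"
where
  "flow_gen M a b (Fn f) = chain M a f"
| "flow_gen M a b (V \<alpha> s) = (dx M ^^ Suc s) (a \<alpha>)"
| "flow_gen M a b (S \<alpha> k s) = (dx M ^^ s) (b \<alpha> k)"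

definition flow :: "('n::finite) frob \<Rightarrow> bool \<Rightarrow> ('n \<Rightarrow> 'n alg) \<Rightarrow> ('n \<Rightarrow> nat \<Rightarrow> 'n alg) \<Rightarrow>
    'n alg \<Rightarrow> 'n alg" where
  "flow M od a b = derivation od (flow_gen M a b)"

definition flow_t :: "('n::finite) frob \<Rightarrow> 'n \<Rightarrow> nat \<Rightarrow> 'n alg \<Rightarrow> 'n alg" where
  "flow_t M \<beta> p = flow M False
     (\<lambda>\<alpha>. \<Sum>\<gamma>\<in>UNIV. \<Sum>\<kappa>\<in>UNIV.
        cst (etainv M $ \<alpha> $ \<gamma>) * fn (pd \<kappa> (pd \<gamma> (ham M \<beta> (Suc p)))) * vv \<kappa> 1)
     (\<lambda>\<alpha> k. \<Sum>\<gamma>\<in>UNIV. \<Sum>\<epsilon>\<in>UNIV.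
        cst (etainv M $ \<gamma> $ \<epsilon>) * fn (pd \<alpha> (pd \<epsilon> (ham M \<beta> (Suc p)))) * sg \<gamma> k 1)"

text \<open>\<open>tau_sum M \<alpha> k m\<close> is the value of the \<open>\<tau>\<^sub>m\<close>-flow on \<open>\<sigma>\<^bsub>\<alpha>,k\<^esub>\<close> for \<open>k \<le> m\<close>.\<close>

definition tau_sum :: "('n::finite) frob \<Rightarrow> 'n \<Rightarrow> nat \<Rightarrow> nat \<Rightarrow> 'n alg" where
  "tau_sum M \<alpha> k m = (\<Sum>\<gamma>\<in>UNIV. \<Sum>\<beta>\<in>UNIV.
     fn (Gam M \<gamma> \<beta> \<alpha>) * (\<Sum>i<m - k. sg \<beta> (k + i) 0 * sg \<gamma> (m - i - 1) 1))"

definition flow_tau :: "('n::finite) frob \<Rightarrow> nat \<Rightarrow> 'n alg \<Rightarrow> 'n alg" where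
  "flow_tau M m = flow M True
     (\<lambda>\<alpha>. \<Sum>\<beta>\<in>UNIV. cst (etainv M $ \<alpha> $ \<beta>) * sg \<beta> m 1)
     (\<lambda>\<alpha> k. if k \<le> m then tau_sum M \<alpha> k m else - tau_sum M \<alpha> m k)"

end

theory Submission
  imports Defs "HOL-Complex_Analysis.Cauchy_Integral_Formula"
begin

text \<open>
  Write \<open>s\<^sub>k\<close> for the vector \<open>\<eta>\<^bsup>\<alpha>\<beta>\<^esup>\<sigma>\<^bsub>\<beta>,k\<^esub>\<close>, \<open>u = v'\<close>, \<open>\<cdot>\<close> for the Frobenius product, \<open>U\<close> for the product with the
  Euler field and \<open>A = 1/2 + \<mu>\<close>. The relations of the ring read \<open>s'\<^bsub>k+1\<^esub> = U s'\<^sub>k + u \<cdot> A s\<^sub>k\<close>, and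
  quasi-homogeneity gives \<open>\<partial>\<^sub>a U = a \<cdot> A + (1/2 - \<mu>) (a \<cdot>)\<close>. Hence a flow with \<open>v \<mapsto> a\<close> and \<open>s\<^sub>k \<mapsto> b\<^sub>k\<close> that
  commutes with \<open>\<partial>\<close> respects the relations as soon as
  \<open>b\<^bsub>k+1\<^esub> = U b\<^sub>k + a \<cdot> A s\<^sub>k\<close> and \<open>u \<cdot> b\<^sub>k = a \<cdot> s'\<^sub>k\<close>.
  For the even flows \<open>a = H u\<close> and \<open>b\<^sub>k = H s'\<^sub>k\<close>, where the Hessian \<open>H\<close> of \<open>h\<^bsub>\<beta>,p+1\<^esub>\<close> is the product with the
  gradient of \<open>h\<^bsub>\<beta>,p\<^esub>\<close>; for the odd ones \<open>a = s'\<^sub>m\<close>, and both conditions follow from the skew symmetry of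
  products of odd elements.

  The graded commutator of two flows is a derivation that kills the functions of \<open>v\<close>, so its values \<open>Z\<^sub>k\<close> on
  \<open>s\<^sub>k\<close> satisfy \<open>Z'\<^bsub>k+1\<^esub> = U Z'\<^sub>k + u \<cdot> A Z\<^sub>k\<close>; as there are no odd constants, \<open>Z\<^sub>k = 0\<close> propagates to all larger
  \<open>k\<close>. Since the \<open>\<tau>\<^sub>m\<close>-flow of \<open>s\<^sub>k\<close> is skew in \<open>k\<close> and \<open>m\<close>, so is \<open>Z\<^sub>k\<close> for an even and an odd flow, and for two
  odd flows a cyclic sum of such values vanishes; this provides the starting values and the remaining
  indices. For two even flows \<open>Z\<^sub>k\<close> is computed directly.
\<close>

section \<open>Partial derivatives of holomorphic functions\<close>

text \<open>The ideal of relations is an inductive closure, and the rule on odd constants leaves no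
  explicit description of it. All computations therefore take place in an abstract quotient, of
  which only the projection and its kernel are known. A flow is defined on the free algebra and has
  to be shown to descend; this is where the two conditions on a and b_k come from. Differentiate the
  first one in x and subtract the flow of the recursion relation: the terms with A cancel, but the
  derivatives of U leave 1/2 - \<mu> applied to u.b_k - a.s'_k, which the second condition removes.
  A direct computation for two odd flows would be cubic in the odd variables, with a number of terms
  that grows with the indices. The recursion for Z_k avoids it, but it only runs upwards and needs a
  starting value. The odd flows have one because the index of an odd flow can be exchanged with that
  of the odd variable: skew symmetry forces zero where the two agree, and values below that point
  are reached by the exchange. An even flow has no index of this kind, hence the separate
  computation for two of them.\<close>

lemma bounded_linear_axis: "bounded_linear (axis \<alpha> :: complex \<Rightarrow> complex^'n)"
proof -
  have "linear (axis \<alpha> :: complex \<Rightarrow> complex^'n)"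
    by (rule linearI) (auto simp: vec_eq_iff axis_def)
  then show ?thesis
    by (simp add: linear_conv_bounded_linear)
qed

lemma axis_zero_complex [simp]: "axis \<alpha> (0::complex) = (0 :: complex^'n)"
  by (simp add: axis_def vec_eq_iff)

lemma has_derivative_along_axis:
  fixes f :: "complex^'n \<Rightarrow> complex"
  assumes "(f has_derivative (\<lambda>y. \<Sum>\<beta>\<in>UNIV. a \<beta> * y $ \<beta>)) (at (x + axis \<alpha> t))"
  shows "((\<lambda>s. f (x + axis \<alpha> s)) has_field_derivative a \<alpha>) (at t)"
proof -
  have "((\<lambda>s. x + axis \<alpha> s) has_derivative axis \<alpha>) (at t)"
    using bounded_linear_axis[of \<alpha>] bounded_linear_imp_has_derivative
    by (auto intro!: derivative_eq_intros)
  then have "((\<lambda>s. f (x + axis \<alpha> s)) has_derivative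
      (\<lambda>s. \<Sum>\<beta>\<in>UNIV. a \<beta> * axis \<alpha> s $ \<beta>)) (at t)"
    using has_derivative_compose assms by blast
  moreover have "(\<lambda>s. \<Sum>\<beta>\<in>UNIV. a \<beta> * axis \<alpha> s $ \<beta>) = (*) (a \<alpha>)"
    by (auto simp: axis_def if_distrib cong: if_cong)
  ultimately show ?thesis
    by (simp add: has_field_derivative_def)
qed

lemma pd_eqI:
  fixes f :: "complex^'n \<Rightarrow> complex"
  assumes "(f has_derivative (\<lambda>y. \<Sum>\<beta>\<in>UNIV. a \<beta> * y $ \<beta>)) (at x)"
  shows "pd \<alpha> f x = a \<alpha>"
  unfolding pd_def using has_derivative_along_axis[of f a x \<alpha> 0] assms
  by (intro DERIV_imp_deriv) simp

lemma cholo_has_derivative: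
  assumes "cholo U f" "x \<in> U"
  shows "(f has_derivative (\<lambda>y. \<Sum>\<beta>\<in>UNIV. pd \<beta> f x * y $ \<beta>)) (at x)"
proof -
  obtain a where "(f has_derivative (\<lambda>y. \<Sum>\<beta>\<in>UNIV. a $ \<beta> * y $ \<beta>)) (at x)"
    using assms unfolding cholo_def by blast
  with pd_eqI[OF this] show ?thesis by simp
qed

lemma choloI:
  assumes "\<And>x. x \<in> U \<Longrightarrow> (f has_derivative (\<lambda>y. \<Sum>\<beta>\<in>UNIV. a x \<beta> * y $ \<beta>)) (at x)"
  shows "cholo U f"
  unfolding cholo_def
proof
  fix x assume "x \<in> U"
  then show "\<exists>b. (f has_derivative (\<lambda>y. \<Sum>\<beta>\<in>UNIV. b $ \<beta> * y $ \<beta>)) (at x)"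
    using assms[of x] by (intro exI[of _ "\<chi> \<beta>. a x \<beta>"]) simp
qed

lemma cholo_continuous_on: "cholo U f \<Longrightarrow> continuous_on U f"
  by (meson cholo_has_derivative continuous_at_imp_continuous_on has_derivative_continuous)

lemma gradient_const: "((\<lambda>_::complex^'n. c) has_derivative (\<lambda>y. \<Sum>\<beta>\<in>UNIV. 0 * y $ \<beta>)) (at x)"
  for c :: complex by simp

lemma gradient_coord:
  "((\<lambda>x::complex^'n. x $ \<alpha>) has_derivative (\<lambda>y. \<Sum>\<beta>\<in>UNIV. (if \<beta> = \<alpha> then 1 else 0) * y $ \<beta>)) (at x)"
proof -
  have "((\<lambda>x::complex^'n. x $ \<alpha>) has_derivative (\<lambda>y. y $ \<alpha>)) (at x)"
    by (simp add: bounded_linear_imp_has_derivative bounded_linear_vec_nth)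
  then show ?thesis by (simp add: if_distrib[of "\<lambda>c. c * _"] cong: if_cong)
qed

lemma gradient_add:
  assumes "cholo U f" "cholo U g" "x \<in> U"
  shows "((\<lambda>x. f x + g x) has_derivative (\<lambda>y. \<Sum>\<beta>\<in>UNIV. (pd \<beta> f x + pd \<beta> g x) * y $ \<beta>)) (at x)"
  using has_derivative_add[OF cholo_has_derivative[OF assms(1,3)] cholo_has_derivative[OF assms(2,3)]]
  by (simp add: sum.distrib algebra_simps)

lemma gradient_mult:
  assumes "cholo U f" "cholo U g" "x \<in> U"
  shows "((\<lambda>x. f x * g x) has_derivative (\<lambda>y. \<Sum>\<beta>\<in>UNIV. (pd \<beta> f x * g x + f x * pd \<beta> g x) * y $ \<beta>)) (at x)"
proof -
  have "f x * (\<Sum>\<beta>\<in>UNIV. pd \<beta> g x * y $ \<beta>) + (\<Sum>\<beta>\<in>UNIV. pd \<beta> f x * y $ \<beta>) * g x =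
      (\<Sum>\<beta>\<in>UNIV. (pd \<beta> f x * g x + f x * pd \<beta> g x) * y $ \<beta>)" for y
    unfolding sum_distrib_left sum_distrib_right sum.distrib[symmetric]
    by (intro sum.cong refl) (simp add: algebra_simps)
  then show ?thesis
    using has_derivative_mult[OF cholo_has_derivative[OF assms(1,3)] cholo_has_derivative[OF assms(2,3)]]
    by simp
qed

lemma cholo_const [simp, intro]: "cholo U (\<lambda>_. c)"
  by (rule choloI, rule gradient_const)

lemma cholo_coord [simp, intro]: "cholo U (\<lambda>x. x $ \<alpha>)"
  by (rule choloI, rule gradient_coord)

lemma cholo_add [simp, intro]: "cholo U f \<Longrightarrow> cholo U g \<Longrightarrow> cholo U (\<lambda>x. f x + g x)"
  by (rule choloI, rule gradient_add)

lemma cholo_mult [simp, intro]: "cholo U f \<Longrightarrow> cholo U g \<Longrightarrow> cholo U (\<lambda>x. f x * g x)"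
  by (rule choloI, rule gradient_mult)

lemma cholo_sum [simp, intro]: "(\<And>i. i \<in> I \<Longrightarrow> cholo U (f i)) \<Longrightarrow> cholo U (\<lambda>x. \<Sum>i\<in>I. f i x)"
  by (induction I rule: infinite_finite_induct) auto

lemma pd_const [simp]: "pd \<alpha> (\<lambda>_. c) x = 0"
  by (rule pd_eqI, rule gradient_const)

lemma pd_coord [simp]: "pd \<alpha> (\<lambda>x. x $ \<beta>) x = (if \<alpha> = \<beta> then 1 else 0)"
  using pd_eqI[OF gradient_coord] .

lemma pd_add: "cholo U f \<Longrightarrow> cholo U g \<Longrightarrow> x \<in> U \<Longrightarrow> pd \<alpha> (\<lambda>x. f x + g x) x = pd \<alpha> f x + pd \<alpha> g x"
  using pd_eqI[OF gradient_add] .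

lemma pd_mult: "cholo U f \<Longrightarrow> cholo U g \<Longrightarrow> x \<in> U \<Longrightarrow>
   pd \<alpha> (\<lambda>x. f x * g x) x = pd \<alpha> f x * g x + f x * pd \<alpha> g x"
  using pd_eqI[OF gradient_mult] .

lemma pd_cmult: "cholo U f \<Longrightarrow> x \<in> U \<Longrightarrow> pd \<alpha> (\<lambda>x. c * f x) x = c * pd \<alpha> f x"
  using pd_mult[of U "\<lambda>_. c" f x \<alpha>] by simp

lemma pd_sum: "(\<And>i. i \<in> I \<Longrightarrow> cholo U (f i)) \<Longrightarrow> x \<in> U \<Longrightarrow>
   pd \<alpha> (\<lambda>x. \<Sum>i\<in>I. f i x) x = (\<Sum>i\<in>I. pd \<alpha> (f i) x)"
proof (induction I rule: infinite_finite_induct)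
  case (insert i I)
  then show ?case
    using pd_add[of U "f i" "\<lambda>x. \<Sum>i\<in>I. f i x" x \<alpha>] by simp
qed auto

section \<open>Locality of holomorphy and of partial derivatives\<close>

lemma has_derivative_cong_open:
  assumes "open U" "x \<in> U" "\<And>y. y \<in> U \<Longrightarrow> f y = g y" "(f has_derivative d) (at x)"
  shows "(g has_derivative d) (at x)"
  using has_derivative_transform_within_open[OF assms(4,1,2)] assms(3) by blast

lemma cholo_cong:
  assumes "open U" "\<And>x. x \<in> U \<Longrightarrow> f x = g x"
  shows "cholo U f \<longleftrightarrow> cholo U g"
proof -
  have "(f has_derivative d) (at x) \<longleftrightarrow> (g has_derivative d) (at x)" if "x \<in> U" for x d
    using has_derivative_cong_open[of U x f g d] has_derivative_cong_open[of U x g f d] assms that by auto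
  then show ?thesis
    unfolding cholo_def by auto
qed

lemma pd_cong:
  assumes "open U" "x \<in> U" "\<And>y. y \<in> U \<Longrightarrow> f y = g y"
  shows "pd \<alpha> f x = pd \<alpha> g x"
proof -
  have "\<forall>\<^sub>F t in nhds 0. x + axis \<alpha> t \<in> U"
  proof -
    have "isCont (\<lambda>t. x + axis \<alpha> t) (0::complex)"
      by (intro continuous_intros bounded_linear.isCont[OF bounded_linear_axis])
    then have "((\<lambda>t. x + axis \<alpha> t) \<longlongrightarrow> x) (nhds (0::complex))"
      using tendsto_at_iff_tendsto_nhds[of "\<lambda>t. x + axis \<alpha> t" "0::complex"]
      by (simp add: isCont_def)
    then show ?thesis
      using assms(1,2) by (simp add: topological_tendstoD)
  qed
  then have "\<forall>\<^sub>F t in nhds 0. f (x + axis \<alpha> t) = g (x + axis \<alpha> t)"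
    by eventually_elim (use assms(3) in blast)
  then show ?thesis
    unfolding pd_def by (intro deriv_cong_ev) auto
qed

text \<open>Differentiating this formula under the integral shows that partial derivatives are holomorphic and commute.\<close>

lemma pd_integral:
  fixes f :: "complex^'n \<Rightarrow> complex"
  assumes f: "cholo U f" and r: "0 < r" and U: "\<And>t. cmod t \<le> r \<Longrightarrow> x + axis \<alpha> t \<in> U"
  shows "pd \<alpha> f x = integral (cbox 0 1)
    (\<lambda>\<theta>. f (x + axis \<alpha> (circlepath 0 r \<theta>)) * inverse (circlepath 0 r \<theta>))"
proof -
  let ?g = "\<lambda>t. f (x + axis \<alpha> t)"
  have d: "(?g has_field_derivative pd \<alpha> f (x + axis \<alpha> t)) (at t)" if "cmod t \<le> r" for t
    using U[OF that] f by (intro has_derivative_along_axis cholo_has_derivative)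
  then have c: "continuous_on (cball 0 r) ?g"
    by (intro continuous_at_imp_continuous_on) (metis DERIV_isCont mem_cball_0)
  have h: "?g holomorphic_on ball 0 r"
    unfolding holomorphic_on_def
  proof
    fix t :: complex
    assume "t \<in> ball 0 r"
    then have "cmod t \<le> r" by simp
    from d[OF this] show "?g field_differentiable at t within ball 0 r"
      using field_differentiable_def has_field_derivative_at_within by blast
  qed
  \<comment> \<open>On the circle the velocity is 2 pi i times the position. This cancels the
    prefactor of Cauchy's formula and one of the two powers in the denominator.\<close>
  have v: "vector_derivative (circlepath 0 r) (at \<theta>) = 2 * of_real pi * \<i> * circlepath 0 r \<theta>" for \<theta>
    by (simp add: vector_derivative_circlepath) (simp add: circlepath)
  have nz: "circlepath 0 r \<theta> \<noteq> 0" for \<theta>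
    using r by (simp add: circlepath)
  have "pd \<alpha> f x = 1 / (2 * of_real pi * \<i>) * contour_integral (circlepath 0 r) (\<lambda>u. ?g u / (u - 0)\<^sup>2)"
    unfolding pd_def using r by (intro DERIV_imp_deriv Cauchy_derivative_integral_circlepath(2) c h) simp
  also have "\<dots> = 1 / (2 * of_real pi * \<i>) * integral (cbox 0 1) (\<lambda>\<theta>. 2 * of_real pi * \<i> *
      (f (x + axis \<alpha> (circlepath 0 r \<theta>)) * inverse (circlepath 0 r \<theta>)))"
    unfolding contour_integral_integral v
    using nz by (simp add: power2_eq_square field_simps)
  finally show ?thesis by simp
qed

text \<open>The Leibniz rule for integrals with a parameter wants derivatives as points of the
  normed space of bounded linear maps, so the coordinate functionals are packaged there.\<close>

definition proj_blinfun :: "'n \<Rightarrow> (complex^'n) \<Rightarrow>\<^sub>L complex" where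
  "proj_blinfun \<beta> = Blinfun (\<lambda>y. y $ \<beta>)"

lemma proj_blinfun [simp]: "blinfun_apply (proj_blinfun \<beta>) y = y $ \<beta>"
  unfolding proj_blinfun_def by (simp add: bounded_linear_Blinfun_apply bounded_linear_vec_nth)

lemma has_derivative_parametric_integral:
  fixes f :: "complex^'n \<Rightarrow> real \<Rightarrow> complex"
  assumes f: "\<And>x t. x \<in> B \<Longrightarrow> t \<in> cbox a b \<Longrightarrow>
      ((\<lambda>x. f x t) has_derivative (\<lambda>y. \<Sum>\<beta>\<in>UNIV. k \<beta> x t * y $ \<beta>)) (at x)"
    and k: "\<And>\<beta>. continuous_on (B \<times> cbox a b) (\<lambda>(x, t). k \<beta> x t)"
    and c: "\<And>x. x \<in> B \<Longrightarrow> continuous_on (cbox a b) (f x)"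
    and B: "open B" "convex B" and x: "x \<in> B"
  shows "((\<lambda>x. integral (cbox a b) (f x)) has_derivative
      (\<lambda>y. \<Sum>\<beta>\<in>UNIV. integral (cbox a b) (k \<beta> x) * y $ \<beta>)) (at x)"
proof -
  let ?L = "\<lambda>\<beta> c. blinfun_mult_right c o\<^sub>L proj_blinfun \<beta>"
  let ?D = "\<lambda>x t. \<Sum>\<beta>\<in>UNIV. ?L \<beta> (k \<beta> x t)"
  have bl: "bounded_linear (?L \<beta>)" for \<beta> :: 'n
    using bounded_linear_compose[OF bounded_bilinear.bounded_linear_left[OF
      bounded_bilinear_blinfun_compose, of "proj_blinfun \<beta>"]
      bounded_linear_blinfun_mult_right]
    by (simp add: o_def)
  have ki: "k \<beta> x integrable_on cbox a b" for \<beta>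
  proof (rule integrable_continuous)
    have "continuous_on (cbox a b) ((\<lambda>(x, t). k \<beta> x t) \<circ> (\<lambda>t. (x, t)))"
      using x by (intro continuous_on_compose continuous_intros continuous_on_subset[OF k]) auto
    then show "continuous_on (cbox a b) (k \<beta> x)" by (simp add: o_def)
  qed
  have 1: "((\<lambda>x. integral (cbox a b) (f x)) has_derivative integral (cbox a b) (?D x)) (at x within B)"
  proof (rule leibniz_rule[OF _ _ _ x B(2)])
    show "((\<lambda>x. f x t) has_derivative ?D x t) (at x within B)" if "x \<in> B" "t \<in> cbox a b" for x t
    proof -
      have "blinfun_apply (?D x t) = (\<lambda>y. \<Sum>\<beta>\<in>UNIV. k \<beta> x t * y $ \<beta>)"
        by (auto simp: blinfun.sum_left)
      then show ?thesis
        using f[OF that] by (simp add: has_derivative_at_withinI)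
    qed
    show "f x integrable_on cbox a b" if "x \<in> B" for x
      using c[OF that] by (rule integrable_continuous)
    show "continuous_on (B \<times> cbox a b) (\<lambda>(x, t). ?D x t)"
      using bounded_linear.continuous_on[OF bl k] by (auto simp: case_prod_unfold intro!: continuous_on_sum)
  qed
  have 2: "integral (cbox a b) (?D x) = (\<Sum>\<beta>\<in>UNIV. ?L \<beta> (integral (cbox a b) (k \<beta> x)))"
  proof -
    have "integral (cbox a b) (?D x) = (\<Sum>\<beta>\<in>UNIV. integral (cbox a b) (?L \<beta> \<circ> k \<beta> x))"
      unfolding o_def
      by (rule integral_sum) (use integrable_linear[OF ki bl] in \<open>auto simp: o_def\<close>)
    then show ?thesis
      using integral_linear[OF ki bl] by simp
  qed
  have 3: "blinfun_apply (\<Sum>\<beta>\<in>UNIV. ?L \<beta> (integral (cbox a b) (k \<beta> x))) =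
      (\<lambda>y. \<Sum>\<beta>\<in>UNIV. integral (cbox a b) (k \<beta> x) * y $ \<beta>)"
    by (auto simp: blinfun.sum_left)
  show ?thesis
    using 1 unfolding 2 3 at_within_open[OF x B(1)] .
qed

lemma norm_axis_complex [simp]: "norm (axis \<alpha> (t::complex) :: complex^'n) = cmod t"
  by (simp add: norm_vec_def L2_set_def axis_def if_distrib[of norm] if_distrib[of "\<lambda>x. x^2"] cong: if_cong)

text \<open>One radius has to serve all centres near x, because the contour in
  \<open>pd_integral\<close> must stay fixed while the centre moves. Half the radius of a ball
  inside U will do.\<close>

lemma polydisc_nbhd:
  fixes x :: "complex^'n"
  assumes "open U" "x \<in> U"
  shows "\<exists>r>0. ball x r \<subseteq> U \<and> (\<forall>y\<in>ball x r. \<forall>t \<alpha>. cmod t \<le> r \<longrightarrow> y + axis \<alpha> t \<in> U)"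
proof -
  obtain e where e: "e > 0" "ball x e \<subseteq> U"
    using assms open_contains_ball by blast
  have "y + axis \<alpha> t \<in> U" if "y \<in> ball x (e/2)" "cmod t \<le> e/2" for y t \<alpha>
  proof -
    have "dist x (y + axis \<alpha> t) \<le> dist x y + cmod t"
      using norm_triangle_ineq4[of "x - y" "axis \<alpha> t"] by (simp add: dist_norm diff_diff_eq)
    then show ?thesis using that e by (auto simp: subset_eq)
  qed
  then show ?thesis using e by (intro exI[of _ "e/2"]) (auto simp: subset_eq)
qed

lemma continuous_on_shifted:
  fixes f :: "complex^'n \<Rightarrow> complex"
  assumes "continuous_on U f" "\<And>y t. y \<in> B \<Longrightarrow> cmod t \<le> r \<Longrightarrow> y + axis \<alpha> t \<in> U" "0 < r"
  shows "continuous_on (B \<times> cbox 0 1)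
    (\<lambda>(y, \<theta>). f (y + axis \<alpha> (circlepath 0 r \<theta>)) * inverse (circlepath 0 r \<theta>))"
proof -
  have p: "continuous_on (B \<times> cbox 0 1) (\<lambda>z. circlepath 0 r (snd z))"
    unfolding circlepath by (intro continuous_intros)
  have "continuous_on (B \<times> cbox 0 1) (\<lambda>z. f (fst z + axis \<alpha> (circlepath 0 r (snd z))))"
    using assms(3) by (intro continuous_on_compose2[OF assms(1)] continuous_intros
        bounded_linear.continuous_on[OF bounded_linear_axis] p)
      (auto intro!: assms(2) simp: circlepath norm_mult)
  then have "continuous_on (B \<times> cbox 0 1)
      (\<lambda>z. f (fst z + axis \<alpha> (circlepath 0 r (snd z))) * inverse (circlepath 0 r (snd z)))"
    using assms(3) by (intro continuous_intros p) (auto simp: circlepath)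
  then show ?thesis by (simp add: case_prod_unfold)
qed

text \<open>\<open>cholo\<close> asks for a derivative at each point and says nothing about its
  dependence on the point. Cauchy's integral contains only values of f, whose continuity passes
  through the integral.\<close>

lemma continuous_on_pd:
  fixes f :: "complex^'n \<Rightarrow> complex"
  assumes "open U" "cholo U f"
  shows "continuous_on U (pd \<alpha> f)"
proof -
  have "isCont (pd \<alpha> f) x" if "x \<in> U" for x
  proof -
    obtain r where r: "r > 0" "ball x r \<subseteq> U"
      "\<And>y t \<alpha>. y \<in> ball x r \<Longrightarrow> cmod t \<le> r \<Longrightarrow> y + axis \<alpha> t \<in> U"
      using polydisc_nbhd[OF assms(1) \<open>x \<in> U\<close>] by blast
    have "continuous_on (ball x r) (\<lambda>y. integral (cbox 0 1)
        (\<lambda>\<theta>. f (y + axis \<alpha> (circlepath 0 r \<theta>)) * inverse (circlepath 0 r \<theta>)))"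
      by (intro integral_continuous_on_param
          continuous_on_shifted[OF cholo_continuous_on[OF assms(2)]] r)
    then have "continuous_on (ball x r) (pd \<alpha> f)"
      by (rule continuous_on_eq) (rule pd_integral[OF assms(2) r(1,3), symmetric])
    then show ?thesis
      using r(1) by (simp add: continuous_on_eq_continuous_at)
  qed
  then show ?thesis by (simp add: continuous_at_imp_continuous_on)
qed

text \<open>The coefficient \<open>b \<beta>\<close> is the Cauchy integral of
  \<open>pd \<beta> f\<close>. To recognise it as a second partial derivative,
  \<open>pd \<beta> f\<close> must be holomorphic, which is itself a consequence of the first
  conjunct; hence the implication in the second. Together they yield \<open>cholo_pd\<close> and
  then \<open>pd_commute\<close>.\<close>

lemma has_derivative_pd:
  fixes f :: "complex^'n \<Rightarrow> complex"
  assumes U: "open U" and f: "cholo U f" and x: "x \<in> U"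
  shows "\<exists>b. (pd \<alpha> f has_derivative (\<lambda>y. \<Sum>\<beta>\<in>UNIV. b \<beta> * y $ \<beta>)) (at x) \<and>
    (\<forall>\<beta>. cholo U (pd \<beta> f) \<longrightarrow> b \<beta> = pd \<alpha> (pd \<beta> f) x)"
proof -
  obtain r where r: "r > 0" "ball x r \<subseteq> U"
    "\<And>y t \<alpha>. y \<in> ball x r \<Longrightarrow> cmod t \<le> r \<Longrightarrow> y + axis \<alpha> t \<in> U"
    using polydisc_nbhd[OF U x] by blast
  have d: "((\<lambda>x. f (x + axis \<alpha> s) * w) has_derivative
      (\<lambda>y. \<Sum>\<beta>\<in>UNIV. pd \<beta> f (x + axis \<alpha> s) * w * y $ \<beta>)) (at x)"
    if "x + axis \<alpha> s \<in> U" for x s w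
  proof -
    have "((\<lambda>x. x + axis \<alpha> s) has_derivative (\<lambda>y. y)) (at x)"
      by (auto intro!: derivative_eq_intros)
    then have "((\<lambda>x. f (x + axis \<alpha> s)) has_derivative
        (\<lambda>y. \<Sum>\<beta>\<in>UNIV. pd \<beta> f (x + axis \<alpha> s) * y $ \<beta>)) (at x)"
      using has_derivative_compose cholo_has_derivative[OF f that] by blast
    from has_derivative_mult_left[OF this, of w] show ?thesis
      by (simp add: sum_distrib_left sum_distrib_right algebra_simps)
  qed
  have c: "continuous_on (ball x r \<times> cbox 0 1)
      (\<lambda>(y, \<theta>). g (y + axis \<alpha> (circlepath 0 r \<theta>)) * inverse (circlepath 0 r \<theta>))"
    if "continuous_on U g" for g
    by (rule continuous_on_shifted[OF that]) (use r in auto)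
  have c': "continuous_on (cbox 0 1)
      (\<lambda>\<theta>. f (y + axis \<alpha> (circlepath 0 r \<theta>)) * inverse (circlepath 0 r \<theta>))" if "y \<in> ball x r" for y
  proof -
    have "continuous_on (cbox 0 1) ((\<lambda>(y, \<theta>). f (y + axis \<alpha> (circlepath 0 r \<theta>)) *
        inverse (circlepath 0 r \<theta>)) \<circ> (\<lambda>t. (y, t)))"
      using that by (intro continuous_on_compose continuous_intros
          continuous_on_subset[OF c[OF cholo_continuous_on[OF f]]]) auto
    then show ?thesis by (simp add: o_def)
  qed
  have "((\<lambda>x. integral (cbox 0 1) (\<lambda>\<theta>. f (x + axis \<alpha> (circlepath 0 r \<theta>)) * inverse (circlepath 0 r \<theta>)))
      has_derivative (\<lambda>y. \<Sum>\<beta>\<in>UNIV. integral (cbox 0 1)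
      (\<lambda>\<theta>. pd \<beta> f (x + axis \<alpha> (circlepath 0 r \<theta>)) * inverse (circlepath 0 r \<theta>)) * y $ \<beta>)) (at x)"
    using r(1) by (intro has_derivative_parametric_integral[of "ball x r"] d c c' continuous_on_pd U f r(3))
      (auto simp: circlepath norm_mult)
  then have "(pd \<alpha> f has_derivative (\<lambda>y. \<Sum>\<beta>\<in>UNIV. integral (cbox 0 1)
      (\<lambda>\<theta>. pd \<beta> f (x + axis \<alpha> (circlepath 0 r \<theta>)) * inverse (circlepath 0 r \<theta>)) * y $ \<beta>)) (at x)"
    by (rule has_derivative_cong_open[of "ball x r", rotated 3])
      (use r f pd_integral[OF f r(1), of _ \<alpha>] in auto)
  then show ?thesis
    using pd_integral[of U _ r x \<alpha>] r(1,3) x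
    by (intro exI[of _ "\<lambda>\<beta>. integral (cbox 0 1)
      (\<lambda>\<theta>. pd \<beta> f (x + axis \<alpha> (circlepath 0 r \<theta>)) * inverse (circlepath 0 r \<theta>))"]) simp
qed

lemma cholo_pd [simp, intro]:
  assumes "open U" "cholo U f"
  shows "cholo U (pd \<alpha> f)"
  unfolding cholo_def
proof
  fix x assume "x \<in> U"
  from has_derivative_pd[OF assms this, of \<alpha>] obtain b where
    "(pd \<alpha> f has_derivative (\<lambda>y. \<Sum>\<beta>\<in>UNIV. b \<beta> * y $ \<beta>)) (at x) \<and>
      (\<forall>\<beta>. cholo U (pd \<beta> f) \<longrightarrow> b \<beta> = pd \<alpha> (pd \<beta> f) x)" ..
  then show "\<exists>a. (pd \<alpha> f has_derivative (\<lambda>y. \<Sum>\<beta>\<in>UNIV. a $ \<beta> * y $ \<beta>)) (at x)"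
    by (intro exI[of _ "\<chi> \<beta>. b \<beta>"]) simp
qed

lemma pd_commute:
  assumes "open U" "cholo U f" "x \<in> U"
  shows "pd \<beta> (pd \<alpha> f) x = pd \<alpha> (pd \<beta> f) x"
proof -
  from has_derivative_pd[OF assms, of \<alpha>] obtain b where
    b: "(pd \<alpha> f has_derivative (\<lambda>y. \<Sum>\<beta>\<in>UNIV. b \<beta> * y $ \<beta>)) (at x) \<and>
      (\<forall>\<beta>. cholo U (pd \<beta> f) \<longrightarrow> b \<beta> = pd \<alpha> (pd \<beta> f) x)" ..
  then show ?thesis
    using pd_eqI[OF conjunct1[OF b]] cholo_pd[OF assms(1,2)] by simp
qed

section \<open>Graded derivations of the free algebra\<close>

lemma letters_zero [simp]: "letters 0 = []"
  and letters_plus [simp]: "letters (u + w) = letters u @ letters w"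
  by (simp_all add: zero_word_def plus_word_def)

lemma mon_Nil [simp]: "mon [] = 1"
  by (simp add: mon_def flip: zero_word_def)

lemma mon_append: "mon (u @ w) = mon u * mon w"
  by (simp add: mon_def mult_single plus_word_def)

lemma mon_Cons: "mon (g # w) = gn g * mon w"
  using mon_append[of "[g]" w] by (simp add: gn_def)

lemma mon_single [simp]: "mon [g] = gn g"
  by (simp add: gn_def)

lemma cst_0 [simp]: "cst 0 = 0"
  and cst_1 [simp]: "cst 1 = 1"
  and cst_add: "cst (a + b) = cst a + cst b"
  and cst_mult: "cst (a * b) = cst a * cst b"
  and cst_minus: "cst (- a) = - cst a"
  by (simp_all add: cst_def single_add mult_single single_uminus)

lemma cst_mon: "cst a * mon w = Poly_Mapping.single (Word w) a"
  by (simp add: cst_def mon_def mult_single)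

lemma sum_monomials: "(\<Sum>w\<in>Poly_Mapping.keys x. Poly_Mapping.single w (Poly_Mapping.lookup x w)) = x"
proof (rule poly_mapping_eqI)
  fix v
  show "Poly_Mapping.lookup (\<Sum>w\<in>Poly_Mapping.keys x. Poly_Mapping.single w (Poly_Mapping.lookup x w)) v
      = Poly_Mapping.lookup x v"
    by (cases "v \<in> Poly_Mapping.keys x")
      (simp_all add: lookup_sum lookup_single when_def sum.delta in_keys_iff)
qed

lemma alg_induct [case_names zero add mon]:
  assumes "P 0" "\<And>x y. P x \<Longrightarrow> P y \<Longrightarrow> P (x + y)" "\<And>a w. P (cst a * mon w)"
  shows "P (x :: ('n::finite) alg)"
proof -
  have "P (\<Sum>w\<in>A. Poly_Mapping.single w (Poly_Mapping.lookup x w))" if "finite A" for A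
    using that
  proof (induction A rule: finite_induct)
    case (insert w A)
    then show ?case
      using assms(2) assms(3)[of "Poly_Mapping.lookup x w" "letters w"] by (simp add: cst_mon)
  qed (simp add: assms(1))
  from this[of "Poly_Mapping.keys x"] show ?thesis
    using sum_monomials[of x] by simp
qed

lemma cst_commute: "cst a * x = x * cst a"
proof (induction x rule: alg_induct)
  case (mon b w)
  show ?case by (simp add: cst_mon) (simp add: cst_def mult_single mult.commute)
qed (auto simp: algebra_simps)

text \<open>The common form of \<open>derivation\<close> and \<open>par\<close>, so that linearity
  is proved once for both.\<close>

definition lext :: "(('n::finite) gen list \<Rightarrow> 'n alg) \<Rightarrow> 'n alg \<Rightarrow> 'n alg" where
  "lext \<phi> x = (\<Sum>w\<in>Poly_Mapping.keys x. cst (Poly_Mapping.lookup x w) * \<phi> (letters w))"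

lemma lext_superset:
  assumes "finite A" "Poly_Mapping.keys x \<subseteq> A"
  shows "lext \<phi> x = (\<Sum>w\<in>A. cst (Poly_Mapping.lookup x w) * \<phi> (letters w))"
  unfolding lext_def using assms by (intro sum.mono_neutral_left) (auto simp: in_keys_iff)

lemma lext_0 [simp]: "lext \<phi> 0 = 0"
  by (simp add: lext_def)

lemma lext_add: "lext \<phi> (x + y) = lext \<phi> x + lext \<phi> y"
proof -
  let ?A = "Poly_Mapping.keys x \<union> Poly_Mapping.keys y"
  have "lext \<phi> z = (\<Sum>w\<in>?A. cst (Poly_Mapping.lookup z w) * \<phi> (letters w))"
    if "z \<in> {x, y, x + y}" for z
    using that keys_add[of x y] by (intro lext_superset) auto
  then show ?thesis
    by (simp add: lookup_add cst_add distrib_right sum.distrib)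
qed

lemma lext_cst_mon: "lext \<phi> (cst a * mon w) = cst a * \<phi> w"
  by (cases "a = 0") (simp_all add: lext_def cst_mon)

lemma lext_mon: "lext \<phi> (mon w) = \<phi> w"
  using lext_cst_mon[of \<phi> 1 w] by simp

lemma lext_cst: "lext \<phi> (cst a * x) = cst a * lext \<phi> x"
proof (induction x rule: alg_induct)
  case (mon b w)
  show ?case
    using lext_cst_mon[of \<phi> "a * b" w] lext_cst_mon[of \<phi> b w] by (simp add: cst_mult mult.assoc)
qed (auto simp: lext_add distrib_left)

section \<open>Degree and parity\<close>

lemma homog_0 [simp, intro]: "homog p 0"
  by (simp add: homog_def)

lemma homog_add [intro]: "homog p x \<Longrightarrow> homog p y \<Longrightarrow> homog p (x + y)"
  unfolding homog_def using keys_add[of x y] by blast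

lemma homog_sum [intro]: "(\<And>i. i \<in> I \<Longrightarrow> homog p (f i)) \<Longrightarrow> homog p (\<Sum>i\<in>I. f i)"
  by (induction I rule: infinite_finite_induct) auto

lemma homog_uminus [intro]: "homog p x \<Longrightarrow> homog p (- x)"
  by (simp add: homog_def)

lemma homog_diff [intro]: "homog p x \<Longrightarrow> homog p y \<Longrightarrow> homog p (x - y)"
  using homog_add[of p x "- y"] by auto

lemma homog_mult: "homog p x \<Longrightarrow> homog q y \<Longrightarrow> homog (p + q) (x * y)"
  unfolding homog_def using keys_mult[of x y] by fastforce

lemma homog_cst [simp, intro]: "homog 0 (cst a)"
  by (simp add: homog_def cst_def)

lemma homog_mult0: "homog 0 x \<Longrightarrow> homog p y \<Longrightarrow> homog p (x * y)"
  using homog_mult[of 0 x p y] by simp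

definition gdeg :: "('n::finite) gen \<Rightarrow> nat" where
  "gdeg g = (if odd_gen g then 1 else 0)"

lemma homog_gn: "homog (gdeg g) (gn g)"
  by (simp add: homog_def gn_def mon_def gdeg_def)

lemma homog_mon: "homog (length (filter odd_gen w)) (mon w)"
  by (simp add: homog_def mon_def)

lemma homog_fn [simp, intro]: "homog 0 (fn f)"
  using homog_gn[of "Fn f"] by (simp add: gdeg_def fn_def)

lemma homog_vv [simp, intro]: "homog 0 (vv \<alpha> s)"
  using homog_gn[of "V \<alpha> (s - 1)"] by (cases s) (simp_all add: gdeg_def vv_def)

lemma homog_sg [simp, intro]: "homog 1 (sg \<alpha> k s)" "homog (Suc 0) (sg \<alpha> k s)"
  using homog_gn[of "S \<alpha> k s"] by (simp_all add: gdeg_def sg_def)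

text \<open>The grading automorphism. It carries the sign of the odd Leibniz rule and thereby allows
  that rule to be stated for elements that are not homogeneous.\<close>

definition par :: "('n::finite) alg \<Rightarrow> 'n alg" where
  "par = lext (\<lambda>w. if odd (length (filter odd_gen w)) then - mon w else mon w)"

lemma par_0 [simp]: "par 0 = 0"
  and par_add: "par (x + y) = par x + par y"
  and par_cst_mult: "par (cst a * x) = cst a * par x"
  and par_mon: "par (mon w) = (if odd (length (filter odd_gen w)) then - mon w else mon w)"
  by (simp_all add: par_def lext_add lext_cst lext_mon)

lemma par_uminus: "par (- x) = - par x"
  using par_cst_mult[of "-1" x] by (simp add: cst_minus)

lemma par_diff: "par (x - y) = par x - par y"
  using par_add[of x "- y"] by (simp add: par_uminus)

lemma par_1 [simp]: "par 1 = 1"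
  using par_mon[of "[]"] by simp

lemma par_mult: "par (x * y) = par x * par y"
proof (induction x rule: alg_induct)
  case (mon a u)
  show ?case
  proof (induction y rule: alg_induct)
    case (mon b w)
    have *: "cst a * x * (cst b * y) = cst a * (cst b * (x * y))" for x y :: "'a alg"
      by (metis cst_commute mult.assoc)
    show ?case
      unfolding par_cst_mult * by (simp add: par_mon flip: mon_append)
  qed (auto simp: par_add distrib_left)
qed (auto simp: par_add distrib_right)

lemma par_homog:
  assumes "homog p x"
  shows "par x = (if odd p then - x else x)"
proof -
  have "par x = (\<Sum>w\<in>Poly_Mapping.keys x.
      cst (Poly_Mapping.lookup x w) * (if odd p then - mon (letters w) else mon (letters w)))"
    unfolding par_def lext_def using assms by (intro sum.cong) (auto simp: homog_def)
  moreover have "(\<Sum>w\<in>Poly_Mapping.keys x. cst (Poly_Mapping.lookup x w) * mon (letters w)) = x"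
    using sum_monomials[of x] by (simp add: cst_mon)
  ultimately show ?thesis
    by (simp add: sum_negf)
qed

lemma par_gn: "par (gn g) = (if odd_gen g then - gn g else gn g)"
  using par_homog[OF homog_gn[of g]] by (simp add: gdeg_def)

definition twist :: "bool \<Rightarrow> ('n::finite) alg \<Rightarrow> 'n alg" where
  "twist od x = (if od then par x else x)"

lemma twist_simps [simp]: "twist od 0 = 0" "twist od 1 = 1" "twist False x = x"
  by (simp_all add: twist_def)

lemma twist_add: "twist od (x + y) = twist od x + twist od y"
  and twist_mult: "twist od (x * y) = twist od x * twist od y"
  and twist_cst: "twist od (cst a * x) = cst a * twist od x"
  and twist_even: "homog 0 x \<Longrightarrow> twist od x = x"
  and twist_gn: "twist od (gn g) = (if od \<and> odd_gen g then - gn g else gn g)"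
  using par_cst_mult[of a x] by (simp_all add: twist_def par_add par_mult par_homog par_gn)

section \<open>Derivations and graded commutators\<close>

lemma derivation_lext: "derivation od d = lext (der_word od d)"
  by (simp add: fun_eq_iff derivation_def lext_def)

lemma derivation_0 [simp]: "derivation od d 0 = 0"
  and derivation_add: "derivation od d (x + y) = derivation od d x + derivation od d y"
  and derivation_cst_mult: "derivation od d (cst a * x) = cst a * derivation od d x"
  and derivation_mon: "derivation od d (mon w) = der_word od d w"
  and derivation_gn [simp]: "derivation od d (gn g) = d g"
  using lext_mon[of "der_word od d" "[g]"]
  by (simp_all add: derivation_lext lext_add lext_cst lext_mon)

lemma derivation_uminus: "derivation od d (- x) = - derivation od d x"
  using derivation_cst_mult[of od d "-1" x] by (simp add: cst_minus)

lemma derivation_diff: "derivation od d (x - y) = derivation od d x - derivation od d y"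
  using derivation_add[of od d x "- y"] by (simp add: derivation_uminus)

lemma derivation_sum: "derivation od d (\<Sum>i\<in>I. f i) = (\<Sum>i\<in>I. derivation od d (f i))"
  by (induction I rule: infinite_finite_induct) (auto simp: derivation_add)

lemma der_word_append:
  "der_word od d (u @ w) = der_word od d u * mon w + twist od (mon u) * der_word od d w"
  by (cases od; induction u) (simp_all add: mon_Cons mon_append twist_mult twist_gn algebra_simps)

lemma derivation_mult:
  "derivation od d (x * y) = derivation od d x * y + twist od x * derivation od d y"
proof (induction x rule: alg_induct)
  case (mon a u)
  show ?case
  proof (induction y rule: alg_induct)
    case (mon b w)
    have *: "cst a * x * (cst b * y) = cst a * (cst b * (x * y))" for x y :: "'a alg"
      by (metis cst_commute mult.assoc)
    show ?case
      unfolding * twist_cst derivation_cst_mult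
      by (simp add: derivation_mon der_word_append distrib_left flip: mon_append)
  qed (auto simp: derivation_add algebra_simps)
qed (auto simp: derivation_add twist_add algebra_simps)

lemma derivation_even_mult:
  "homog 0 x \<Longrightarrow> derivation od d (x * y) = derivation od d x * y + x * derivation od d y"
  by (simp add: derivation_mult twist_even)

lemma derivation_1 [simp]: "derivation od d 1 = 0"
  using derivation_mon[of od d "[]"] by simp

lemma derivation_cst [simp]: "derivation od d (cst a) = 0"
  using derivation_cst_mult[of od d a 1] by simp

lemma derivation_unique:
  assumes "\<And>x y. D (x + y) = D x + D y" "\<And>a x. D (cst a * x) = cst a * D x"
    and D: "\<And>x y. D (x * y) = D x * y + twist od x * D y"
  shows "D x = derivation od (\<lambda>g. D (gn g)) x"
proof (induction x rule: alg_induct)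
  case zero
  show ?case using assms(2)[of 0 0] by simp
next
  case (mon a w)
  have "D (mon w) = der_word od (\<lambda>g. D (gn g)) w"
  proof (induction w)
    case Nil
    show ?case using D[of 1 1] by simp
  qed (simp add: mon_Cons D twist_gn)
  then show ?case
    by (simp add: assms(2) derivation_cst_mult derivation_mon)
qed (simp add: assms(1) derivation_add)

lemma homog_derivation:
  assumes "\<And>g. homog (gdeg g + e) (d g)" "homog p x"
  shows "homog (p + e) (derivation od d x)"
proof -
  have "homog (length (filter odd_gen w) + e) (der_word od d w)" for w
  proof (induction w)
    case (Cons g w)
    have l: "length (filter odd_gen (g # w)) = gdeg g + length (filter odd_gen w)"
      by (simp add: gdeg_def)
    have "homog (gdeg g + length (filter odd_gen w) + e) (d g * mon w)"
      using homog_mult[OF assms(1)[of g] homog_mon[of w]] by (simp add: algebra_simps)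
    moreover have "homog (gdeg g + length (filter odd_gen w) + e) (gn g * der_word od d w)"
      using homog_mult[OF homog_gn[of g] Cons] by (simp add: algebra_simps)
    ultimately show ?case
      unfolding l by auto
  qed simp
  then have "homog (p + e) (der_word od d (letters w))" if "w \<in> Poly_Mapping.keys x" for w
    using assms(2) that unfolding homog_def[of p] by metis
  then show ?thesis
    unfolding derivation_def by (intro homog_sum homog_mult0 homog_cst)
qed

definition graded :: "bool \<Rightarrow> (('n::finite) gen \<Rightarrow> 'n alg) \<Rightarrow> bool" where
  "graded od d \<longleftrightarrow> (\<forall>g. par (d g) = (if odd_gen g = od then d g else - d g))"

lemma gradedI:
  assumes "\<And>g. homog (gdeg g + e) (d g)" "od = odd e"
  shows "graded od d"
  unfolding graded_def
proof
  fix g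
  show "par (d g) = (if odd_gen g = od then d g else - d g)"
    using par_homog[OF assms(1)[of g]] assms(2) by (auto simp: gdeg_def)
qed

lemma par_derivation:
  assumes "graded od d"
  shows "par (derivation od d x) = (if od then - derivation od d (par x) else derivation od d (par x))"
proof (induction x rule: alg_induct)
  case (mon a w)
  let ?e = "\<lambda>x. if od then - x else x :: 'a alg"
  have "par (der_word od d w) = ?e (derivation od d (par (mon w)))"
  proof (induction w)
    case (Cons g w)
    then show ?case
      using assms
      by (cases od; cases "odd_gen g")
        (auto simp: mon_Cons par_add par_diff par_mult par_gn par_uminus derivation_mult derivation_uminus
          graded_def twist_def split: if_splits)
  qed simp
  then show ?case
    by (simp add: par_cst_mult derivation_cst_mult derivation_mon)
qed (auto simp: par_add derivation_add)

definition scomm :: "bool \<Rightarrow> (('n::finite) gen \<Rightarrow> 'n alg) \<Rightarrow> bool \<Rightarrow> ('n gen \<Rightarrow> 'n alg) \<Rightarrow> 'n alg \<Rightarrow> 'n alg" where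
  "scomm o1 d1 o2 d2 x = derivation o1 d1 (derivation o2 d2 x)
     - (if o1 \<and> o2 then - derivation o2 d2 (derivation o1 d1 x) else derivation o2 d2 (derivation o1 d1 x))"

text \<open>The mixed terms in the two Leibniz expansions cancel because graded derivations commute
  with \<open>par\<close> up to sign. By \<open>derivation_unique\<close> the commutator is then
  governed by its values on generators, already in the free algebra.\<close>

lemma scomm_derivation:
  assumes "graded o1 d1" "graded o2 d2"
  shows "scomm o1 d1 o2 d2 x = derivation (o1 \<noteq> o2) (\<lambda>g. scomm o1 d1 o2 d2 (gn g)) x"
proof (rule derivation_unique)
  show "scomm o1 d1 o2 d2 (x + y) = scomm o1 d1 o2 d2 x + scomm o1 d1 o2 d2 y" for x y
    by (simp add: scomm_def derivation_add)
  show "scomm o1 d1 o2 d2 (cst a * x) = cst a * scomm o1 d1 o2 d2 x" for a x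
    by (simp add: scomm_def derivation_cst_mult right_diff_distrib distrib_left)
  have pp: "par (par x) = x" for x :: "'a alg"
    by (induction x rule: alg_induct) (auto simp: par_add par_cst_mult par_mon par_uminus)
  show "scomm o1 d1 o2 d2 (x * y) = scomm o1 d1 o2 d2 x * y + twist (o1 \<noteq> o2) x * scomm o1 d1 o2 d2 y" for x y
    using par_derivation[OF assms(1)] par_derivation[OF assms(2)]
    by (cases o1; cases o2)
      (simp_all add: scomm_def derivation_mult derivation_add twist_def pp algebra_simps)
qed

section \<open>The differential ring\<close>

text \<open>The sort is not \<open>ring_1\<close>, which includes \<open>0 \<noteq> 1\<close>: the ring is trivial if the chart is empty.\<close>

locale quotient_ring =
  fixes M :: "('n::finite) frob" and \<pi> :: "'n alg \<Rightarrow> 'r::{ring,monoid_mult}"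
  assumes open_chart: "open (chart M)"
    and \<pi>_add: "\<pi> (x + y) = \<pi> x + \<pi> y"
    and \<pi>_mult: "\<pi> (x * y) = \<pi> x * \<pi> y"
    and \<pi>_1 [simp]: "\<pi> 1 = 1"
    and \<pi>_surj: "\<exists>x. \<pi> x = z"
    and \<pi>_eq_0_iff: "\<pi> x = 0 \<longleftrightarrow> x \<in> relations M"
begin

abbreviation "hol \<equiv> cholo (chart M)"

lemma \<pi>_0 [simp]: "\<pi> 0 = 0"
  using relations.zero \<pi>_eq_0_iff by blast

lemma \<pi>_minus: "\<pi> (- x) = - \<pi> x"
  using \<pi>_add[of x "- x"] by (simp add: eq_neg_iff_add_eq_0 add.commute)

lemma \<pi>_diff: "\<pi> (x - y) = \<pi> x - \<pi> y"
  using \<pi>_add[of x "- y"] by (simp add: \<pi>_minus)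

lemma \<pi>_sum: "\<pi> (\<Sum>i\<in>I. f i) = (\<Sum>i\<in>I. \<pi> (f i))"
  by (induction I rule: infinite_finite_induct) (auto simp: \<pi>_add)

lemmas \<pi>_simps = \<pi>_add \<pi>_mult \<pi>_minus \<pi>_diff \<pi>_sum

lemma \<pi>_eq_iff: "\<pi> x = \<pi> y \<longleftrightarrow> ring_eq M x y"
  using \<pi>_eq_0_iff[of "x - y"] by (simp add: ring_eq_def \<pi>_diff)

lemma \<pi>_eqI: "x - y \<in> relations M \<Longrightarrow> \<pi> x = \<pi> y"
  by (simp add: \<pi>_eq_iff ring_eq_def)

section \<open>Scalars and functions in the quotient\<close>

definition sc :: "complex \<Rightarrow> 'r" where "sc c = \<pi> (cst c)"

definition F :: "(complex^'n \<Rightarrow> complex) \<Rightarrow> 'r" where "F f = \<pi> (fn f)"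

lemma sc_0 [simp]: "sc 0 = 0"
  and sc_1 [simp]: "sc 1 = 1"
  and sc_add: "sc (a + b) = sc a + sc b"
  and sc_mult: "sc (a * b) = sc a * sc b"
  and sc_minus: "sc (- a) = - sc a"
  by (simp_all add: sc_def cst_add cst_mult cst_minus \<pi>_simps)

lemma sc_commute: "z * sc c = sc c * z"
proof -
  obtain x where "z = \<pi> x" using \<pi>_surj by metis
  then show ?thesis
    unfolding sc_def by (simp flip: \<pi>_mult cst_commute)
qed

lemma sc_left_commute: "z * (sc c * w) = sc c * (z * w)"
  by (simp add: sc_commute flip: mult.assoc)

lemma sc_mult_sc: "(sc a * z) * (sc b * w) = sc (a * b) * (z * w)"
  by (simp add: sc_mult mult.assoc sc_left_commute[of z])

text \<open>The type of the ring is no vector space; division by 2 is multiplication by the image of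
  a complex constant. This is how skew symmetry becomes vanishing on the diagonal.\<close>

lemma double_eq_0: "z + z = 0 \<Longrightarrow> z = (0::'r)"
proof -
  assume "z + z = 0"
  then have "sc (1/2) * z + sc (1/2) * z = 0" by (simp flip: distrib_left)
  moreover have "sc (1/2) * z + sc (1/2) * z = z" by (simp flip: distrib_right sc_add)
  ultimately show "z = 0" by simp
qed

lemma triple_eq_0: "z + z + z = 0 \<Longrightarrow> z = (0::'r)"
proof -
  assume "z + z + z = 0"
  then have "sc (1/3) * z + sc (1/3) * z + sc (1/3) * z = 0" by (simp flip: distrib_left)
  moreover have "sc (1/3) * z + sc (1/3) * z + sc (1/3) * z = z" by (simp flip: distrib_right sc_add)
  ultimately show "z = 0" by simp
qed

lemma F_const: "F (\<lambda>_. c) = sc c"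
  unfolding F_def sc_def by (intro \<pi>_eqI relations.fn_const)

lemma F_add: "hol f \<Longrightarrow> hol g \<Longrightarrow> F (\<lambda>x. f x + g x) = F f + F g"
  unfolding F_def \<pi>_add[symmetric] by (intro \<pi>_eqI relations.fn_add)

lemma F_mult: "hol f \<Longrightarrow> hol g \<Longrightarrow> F (\<lambda>x. f x * g x) = F f * F g"
  unfolding F_def \<pi>_mult[symmetric] by (intro \<pi>_eqI relations.fn_mult)

lemma F_cong: "(\<And>x. x \<in> chart M \<Longrightarrow> f x = g x) \<Longrightarrow> F f = F g"
  unfolding F_def by (intro \<pi>_eqI relations.fn_eq)

lemma F_not_hol: "\<not> hol f \<Longrightarrow> F f = 0"
  unfolding F_def \<pi>_eq_0_iff by (rule relations.junk)

lemma F_0 [simp]: "F (\<lambda>_. 0) = 0"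
  by (simp add: F_const)

lemma F_sum: "(\<And>i. i \<in> I \<Longrightarrow> hol (f i)) \<Longrightarrow> F (\<lambda>x. \<Sum>i\<in>I. f i x) = (\<Sum>i\<in>I. F (f i))"
  by (induction I rule: infinite_finite_induct) (auto simp: F_add)

lemma F_cmult: "hol f \<Longrightarrow> F (\<lambda>x. c * f x) = sc c * F f"
  using F_mult[of "\<lambda>_. c" f] by (simp add: F_const)

text \<open>The relations exchange generators only. Moving one generator past a word, then a word
  past a word, and expanding in words extends the sign rule to all homogeneous elements in
  \<open>supercommute\<close>.\<close>

lemma supercommute_gn_mon:
  "\<pi> (gn g) * \<pi> (mon w) = (if odd_gen g \<and> odd (length (filter odd_gen w)) then - 1 else 1) * (\<pi> (mon w) * \<pi> (gn g))"
proof (induction w)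
  case (Cons h w)
  have gh: "\<pi> (gn g) * \<pi> (gn h) = (if odd_gen g \<and> odd_gen h then - 1 else 1) * (\<pi> (gn h) * \<pi> (gn g))"
  proof -
    have "\<pi> (gn a) * \<pi> (gn b) = \<pi> (gn b) * \<pi> (gn a)" if "\<not> odd_gen a" for a b
      using \<pi>_eqI[OF relations.even_commute[OF that, of b M]] by (simp add: \<pi>_mult)
    moreover have "\<pi> (gn g) * \<pi> (gn h) = - (\<pi> (gn h) * \<pi> (gn g))" if "odd_gen g" "odd_gen h"
      using relations.odd_anticommute[OF that, of M] \<pi>_eq_0_iff[of "gn g * gn h + gn h * gn g"]
      by (simp add: \<pi>_simps eq_neg_iff_add_eq_0)
    ultimately show ?thesis by auto
  qed
  have "\<pi> (gn g) * \<pi> (mon (h # w)) = (\<pi> (gn g) * \<pi> (gn h)) * \<pi> (mon w)"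
    by (simp add: mon_Cons \<pi>_mult mult.assoc)
  also have "\<dots> = (if odd_gen g \<and> odd_gen h then - 1 else 1) * (\<pi> (gn h) * (\<pi> (gn g) * \<pi> (mon w)))"
    unfolding gh by (simp add: mult.assoc)
  also have "\<dots> = (if odd_gen g \<and> odd (length (filter odd_gen (h # w))) then - 1 else 1) *
      (\<pi> (mon (h # w)) * \<pi> (gn g))"
    unfolding Cons by (auto simp: mon_Cons \<pi>_mult mult.assoc)
  finally show ?case .
qed simp

lemma supercommute_mon:
  "\<pi> (mon u) * \<pi> (mon w) =
    (if odd (length (filter odd_gen u)) \<and> odd (length (filter odd_gen w)) then - 1 else 1) * (\<pi> (mon w) * \<pi> (mon u))"
proof (induction u)
  case (Cons h u)
  have "\<pi> (mon (h # u)) * \<pi> (mon w) = \<pi> (gn h) * (\<pi> (mon u) * \<pi> (mon w))"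
    by (simp add: mon_Cons \<pi>_mult mult.assoc)
  also have "\<dots> = (if odd (length (filter odd_gen u)) \<and> odd (length (filter odd_gen w)) then - 1 else 1) *
      ((\<pi> (gn h) * \<pi> (mon w)) * \<pi> (mon u))"
    unfolding Cons by (auto simp: mult.assoc)
  also have "\<dots> = (if odd (length (filter odd_gen (h # u))) \<and> odd (length (filter odd_gen w)) then - 1 else 1) *
      (\<pi> (mon w) * \<pi> (mon (h # u)))"
    unfolding supercommute_gn_mon by (auto simp: mon_Cons \<pi>_mult mult.assoc)
  finally show ?case .
qed simp

lemma \<pi>_expansion: "\<pi> x = (\<Sum>w\<in>Poly_Mapping.keys x. sc (Poly_Mapping.lookup x w) * \<pi> (mon (letters w)))"
  unfolding sc_def \<pi>_mult[symmetric] \<pi>_sum[symmetric] by (simp add: cst_mon sum_monomials)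

lemma supercommute:
  assumes "homog p x" "homog q y"
  shows "\<pi> x * \<pi> y = (if odd p \<and> odd q then - (\<pi> y * \<pi> x) else \<pi> y * \<pi> x)"
proof -
  let ?e = "if odd p \<and> odd q then - 1 else 1 :: 'r"
  let ?a = "\<lambda>w. sc (Poly_Mapping.lookup x w) * \<pi> (mon (letters w))"
  let ?b = "\<lambda>w. sc (Poly_Mapping.lookup y w) * \<pi> (mon (letters w))"
  have "?a v * ?b w = ?e * (?b w * ?a v)" if "v \<in> Poly_Mapping.keys x" "w \<in> Poly_Mapping.keys y" for v w
  proof -
    have "\<pi> (mon (letters v)) * \<pi> (mon (letters w)) = ?e * (\<pi> (mon (letters w)) * \<pi> (mon (letters v)))"
      using supercommute_mon[of "letters v" "letters w"] assms that by (simp add: homog_def)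
    then show ?thesis
      unfolding sc_mult_sc by (simp add: mult.commute)
  qed
  then have "\<pi> x * \<pi> y = (\<Sum>v\<in>Poly_Mapping.keys x. \<Sum>w\<in>Poly_Mapping.keys y. ?e * (?b w * ?a v))"
    unfolding \<pi>_expansion[of x] \<pi>_expansion[of y] sum_product by (intro sum.cong refl)
  also have "\<dots> = ?e * (\<pi> y * \<pi> x)"
    unfolding \<pi>_expansion[of x] \<pi>_expansion[of y] sum_product
    by (subst sum.swap) (simp add: sum_distrib_left)
  finally show ?thesis by simp
qed

lemma central_gn: "\<not> odd_gen g \<Longrightarrow> z * \<pi> (gn g) = \<pi> (gn g) * z"
proof -
  assume g: "\<not> odd_gen g"
  obtain x where z: "z = \<pi> x" using \<pi>_surj by metis
  have "\<pi> (gn g) * \<pi> (mon w) = \<pi> (mon w) * \<pi> (gn g)" for w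
    using supercommute_gn_mon[of g w] g by simp
  then show ?thesis
    unfolding z \<pi>_expansion[of x] sum_distrib_left sum_distrib_right
    by (intro sum.cong refl) (simp add: mult.assoc sc_left_commute[of "\<pi> (gn g)"])
qed

lemma F_commute: "z * F f = F f * z"
  unfolding F_def fn_def by (rule central_gn) simp

lemma F_left_commute: "z * (F f * w) = F f * (z * w)"
  by (simp add: F_commute flip: mult.assoc)

section \<open>Derivations that descend\<close>

definition preserves :: "bool \<Rightarrow> ('n gen \<Rightarrow> 'n alg) \<Rightarrow> bool" where
  "preserves od d \<longleftrightarrow> (\<forall>x. \<pi> x = 0 \<longrightarrow> \<pi> (derivation od d x) = 0)"

text \<open>Independent of the chosen representative only under \<open>preserves od d\<close>.\<close>

definition push :: "bool \<Rightarrow> ('n gen \<Rightarrow> 'n alg) \<Rightarrow> 'r \<Rightarrow> 'r" where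
  "push od d z = \<pi> (derivation od d (SOME x. \<pi> x = z))"

lemma preserves_cong: "preserves od d \<Longrightarrow> \<pi> x = \<pi> y \<Longrightarrow> \<pi> (derivation od d x) = \<pi> (derivation od d y)"
  unfolding preserves_def using \<pi>_diff[of x y] by (metis \<pi>_diff derivation_diff right_minus_eq)

lemma push_\<pi>: "preserves od d \<Longrightarrow> push od d (\<pi> x) = \<pi> (derivation od d x)"
  unfolding push_def by (rule preserves_cong) (auto intro: someI)

lemma preserves_descends: "preserves od d \<Longrightarrow> descends M (derivation od d)"
  unfolding descends_def \<pi>_eq_iff[symmetric] using preserves_cong by blast

context
  fixes od d
  assumes p: "preserves od d"
begin

lemma push_add: "push od d (z + w) = push od d z + push od d w"
proof -
  obtain x y where "z = \<pi> x" "w = \<pi> y" using \<pi>_surj by metis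
  then show ?thesis by (simp add: push_\<pi>[OF p] derivation_add flip: \<pi>_add)
qed

lemma push_0 [simp]: "push od d 0 = 0"
  using push_\<pi>[OF p, of 0] by simp

lemma push_minus: "push od d (- z) = - push od d z"
  using push_add[of z "- z"] by (simp add: eq_neg_iff_add_eq_0 add.commute)

lemma push_sum: "push od d (\<Sum>i\<in>I. f i) = (\<Sum>i\<in>I. push od d (f i))"
  by (induction I rule: infinite_finite_induct) (auto simp: push_add)

lemma push_sc: "push od d (sc c * z) = sc c * push od d z"
proof -
  obtain x where "z = \<pi> x" using \<pi>_surj by metis
  then show ?thesis by (simp add: push_\<pi>[OF p] derivation_cst_mult sc_def flip: \<pi>_mult)
qed

text \<open>A function is even, so this instance of the Leibniz rule has no sign, and no grading
  automorphism of the quotient is called for.\<close>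

lemma push_F: "push od d (F f * z) = \<pi> (d (Fn f)) * z + F f * push od d z"
proof -
  obtain x where "z = \<pi> x" using \<pi>_surj by metis
  then show ?thesis
    by (simp add: push_\<pi>[OF p] derivation_even_mult F_def \<pi>_add flip: \<pi>_mult)
      (simp add: fn_def \<pi>_mult)
qed

end

section \<open>The x-derivative in the quotient\<close>

lemma preserves_dx: "preserves False (dx_gen M)"
  unfolding preserves_def \<pi>_eq_0_iff dx_def[symmetric] using relations.diff by blast

definition D :: "'r \<Rightarrow> 'r" where "D = push False (dx_gen M)"

lemma D_\<pi>: "D (\<pi> x) = \<pi> (dx M x)"
  by (simp add: D_def dx_def push_\<pi>[OF preserves_dx])

lemma D_add: "D (z + w) = D z + D w"
  and D_0 [simp]: "D 0 = 0"
  and D_minus: "D (- z) = - D z"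
  and D_sum: "D (\<Sum>i\<in>I. h i) = (\<Sum>i\<in>I. D (h i))"
  and D_sc: "D (sc c * z) = sc c * D z"
  unfolding D_def
  by (rule push_add push_0 push_minus push_sum push_sc, rule preserves_dx)+

lemma D_mult: "D (z * w) = D z * w + z * D w"
proof -
  obtain x y where "z = \<pi> x" "w = \<pi> y" using \<pi>_surj by metis
  then show ?thesis by (simp add: D_\<pi> dx_def derivation_mult flip: \<pi>_add \<pi>_mult)
qed

lemma D_F: "hol f \<Longrightarrow> D (F f) = (\<Sum>\<alpha>\<in>UNIV. F (pd \<alpha> f) * \<pi> (vv \<alpha> 1))"
  unfolding F_def D_\<pi> by (simp add: dx_def fn_def chain_def \<pi>_simps)

lemma no_odd_constants_\<pi>: "0 < p \<Longrightarrow> homog p x \<Longrightarrow> D (\<pi> x) = 0 \<Longrightarrow> \<pi> x = 0"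
  unfolding D_\<pi> \<pi>_eq_0_iff by (rule relations.no_odd_constants)

text \<open>Every term of the Leibniz expansion of a word contains a factor \<open>d g\<close>. The
  derivation may be one that is not yet known to respect the relations.\<close>

lemma \<pi>_derivation_eq_0:
  assumes "\<And>g. \<pi> (d g) = 0"
  shows "\<pi> (derivation od d x) = 0"
proof (induction x rule: alg_induct)
  case (mon a w)
  have "\<pi> (der_word od d w) = 0"
    by (induction w) (auto simp: \<pi>_simps assms)
  then show ?case
    by (simp add: derivation_cst_mult derivation_mon \<pi>_mult)
qed (auto simp: derivation_add \<pi>_add)

lemma homog_dx: "homog p x \<Longrightarrow> homog p (dx M x)"
proof -
  have "homog (gdeg g + 0) (dx_gen M g)" for g
  proof (cases g)
    case (Fn f)
    then show ?thesis by (auto simp: gdeg_def chain_def intro!: homog_mult0)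
  next
    case (V \<alpha> s)
    then show ?thesis using homog_gn[of "V \<alpha> (Suc s)"] by (simp add: gdeg_def)
  next
    case (S \<alpha> k s)
    then show ?thesis using homog_gn[of "S \<alpha> k (Suc s)"] by (simp add: gdeg_def)
  qed
  then show "homog p x \<Longrightarrow> homog p (dx M x)"
    using homog_derivation[of 0 "dx_gen M" p x False] by (simp add: dx_def)
qed

lemma homog_dx_power: "homog p x \<Longrightarrow> homog p ((dx M ^^ s) x)"
  by (induction s) (auto intro: homog_dx)

lemma graded_dx: "graded False (dx_gen M)"
proof (rule gradedI[of 0])
  show "homog (gdeg g + 0) (dx_gen M g)" for g
    using homog_dx[OF homog_gn[of g]] by (simp add: dx_def)
qed simp

lemma recursion_homog: "homog 1 (recursion_rel M \<alpha> k)"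
  unfolding recursion_rel_def
  by (intro homog_diff homog_add homog_sum homog_mult0 homog_mult0[OF homog_mult0]) auto

text \<open>Each listed relation is homogeneous and the x-derivative is even, so the grading
  automorphism maps the ideal to itself. Without this an odd derivation could not be followed
  through the products \<open>a * x * b\<close>.\<close>

lemma par_relations: "x \<in> relations M \<Longrightarrow> par x \<in> relations M"
proof (induction rule: relations.induct)
  case (mult x a b)
  then show ?case by (simp add: par_mult relations.mult)
next
  case (fn_const a)
  have "homog 0 (fn (\<lambda>_. a) - cst a :: 'n alg)" by auto
  from par_homog[OF this] show ?case by (simp add: relations.fn_const)
next
  case (fn_add f g)
  have "homog 0 (fn (\<lambda>x. f x + g x) - (fn f + fn g) :: 'n alg)" by auto
  from par_homog[OF this] show ?case by (simp add: relations.fn_add fn_add)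
next
  case (fn_mult f g)
  have "homog 0 (fn (\<lambda>x. f x * g x) - fn f * fn g :: 'n alg)" by (auto intro: homog_mult0)
  from par_homog[OF this] show ?case by (simp add: relations.fn_mult fn_mult)
next
  case (fn_eq f g)
  have "homog 0 (fn f - fn g :: 'n alg)" by auto
  from par_homog[OF this] show ?case by (simp add: relations.fn_eq fn_eq)
next
  case (junk f)
  then show ?case by (simp add: par_homog[OF homog_fn] relations.junk)
next
  case (even_commute a b)
  have "homog (gdeg a + gdeg b) (gn a * gn b - gn b * gn a)"
    using homog_mult[OF homog_gn[of a] homog_gn[of b]] homog_mult[OF homog_gn[of b] homog_gn[of a]]
    by (auto simp: add.commute)
  from par_homog[OF this] show ?case
    using relations.even_commute[OF even_commute, of b M]
      relations.mult[OF relations.even_commute[OF even_commute, of b M], of "-1" 1] by simp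
next
  case (odd_anticommute a b)
  have "homog (gdeg a + gdeg b) (gn a * gn b + gn b * gn a)"
    using homog_mult[OF homog_gn[of a] homog_gn[of b]] homog_mult[OF homog_gn[of b] homog_gn[of a]]
    by (auto simp: add.commute)
  from par_homog[OF this] show ?case
    using odd_anticommute relations.odd_anticommute[OF odd_anticommute, of M] by (simp add: gdeg_def)
next
  case (recursion \<alpha> k)
  then show ?case
    using par_homog[OF recursion_homog, of \<alpha> k]
      relations.mult[OF relations.recursion[of M \<alpha> k], of "-1" 1] by simp
next
  case (diff x)
  then show ?case
    using relations.diff[of "par x" M] par_derivation[OF graded_dx, of x] by (simp add: dx_def)
next
  case (no_odd_constants p x)
  then have "x \<in> relations M" by (auto intro: relations.no_odd_constants)
  then show ?case
    using par_homog[OF no_odd_constants(2)] relations.mult[of x M "-1" 1] by simp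
qed (auto simp: par_add intro: relations.intros)

end

context quotient_ring
begin

section \<open>Descent of flows\<close>

lemma F_pd_add: "hol f \<Longrightarrow> hol g \<Longrightarrow> F (pd \<alpha> (\<lambda>x. f x + g x)) = F (pd \<alpha> f) + F (pd \<alpha> g)"
  using open_chart pd_add[of "chart M" f g] by (subst F_add[symmetric]) (auto intro!: F_cong)

lemma F_pd_mult: "hol f \<Longrightarrow> hol g \<Longrightarrow> F (pd \<alpha> (\<lambda>x. f x * g x)) = F (pd \<alpha> f) * F g + F f * F (pd \<alpha> g)"
  using open_chart pd_mult[of "chart M" f g]
  by (subst F_mult[symmetric] F_add[symmetric]; simp)+ (auto intro!: F_cong)

lemma F_pd_commute: "hol f \<Longrightarrow> F (pd \<alpha> (pd \<beta> f)) = F (pd \<beta> (pd \<alpha> f))"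
  using open_chart by (intro F_cong pd_commute)

lemma central_vv: "z * \<pi> (vv \<alpha> s) = \<pi> (vv \<alpha> s) * z"
  by (cases s) (simp_all add: vv_def fn_def central_gn)

text \<open>Rule induction over the ideal. The chain rule takes care of the function symbols,
  homogeneity of the values of the commutation rules, and commutation with \<open>dx\<close> of the
  rules \<open>diff\<close> and \<open>no_odd_constants\<close>. What is special to a flow remains
  in the hypothesis on the recursion relation.\<close>

lemma preservesI:
  fixes w :: "'n \<Rightarrow> 'r"
  assumes homog: "\<And>g. homog (gdeg g + e) (d g)" and od: "od = odd e"
    and fn: "\<And>f. hol f \<Longrightarrow> \<pi> (d (Fn f)) = (\<Sum>\<alpha>\<in>UNIV. F (pd \<alpha> f) * w \<alpha>)"
    and fn0: "\<And>f. \<not> hol f \<Longrightarrow> \<pi> (d (Fn f)) = 0"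
    and dx: "\<And>x. \<pi> (derivation od d (dx M x)) = \<pi> (dx M (derivation od d x))"
    and rec: "\<And>\<alpha> k. \<pi> (derivation od d (recursion_rel M \<alpha> k)) = 0"
  shows "preserves od d"
proof -
  have dfn: "\<pi> (derivation od d (fn f)) = (\<Sum>\<alpha>\<in>UNIV. F (pd \<alpha> f) * w \<alpha>)" if "hol f" for f
    using fn[OF that] by (simp add: fn_def)
  have sc: "\<pi> (gn a) * \<pi> (d b) = (if odd_gen a \<and> odd (gdeg b + e) then - (\<pi> (d b) * \<pi> (gn a)) else \<pi> (d b) * \<pi> (gn a))" for a b
    using supercommute[OF homog_gn[of a] homog[of b]] by (simp add: gdeg_def)
  have "\<pi> (derivation od d x) = 0" if "x \<in> relations M" for x
    using that
  proof (induction rule: relations.induct)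
    case (mult x a b)
    \<comment> \<open>In one term of the Leibniz expansion the relation x is replaced by its twist,
      which is again a relation.\<close>
    have "\<pi> (twist od x) = 0" if "\<pi> x = 0" for x
      using that par_relations by (simp add: twist_def \<pi>_eq_0_iff)
    with mult show ?case
      by (simp add: derivation_mult twist_mult \<pi>_simps flip: \<pi>_eq_0_iff)
  next
    case (fn_const a)
    have "pd \<alpha> (\<lambda>_::complex^'n. a) = (\<lambda>_. 0)" for \<alpha> by (rule ext) simp
    then show ?case using dfn[of "\<lambda>_. a"] by (simp add: derivation_diff \<pi>_diff)
  next
    case (fn_add f g)
    then show ?case
      by (simp add: derivation_diff derivation_add \<pi>_simps dfn F_pd_add distrib_right sum.distrib)
  next
    case (fn_mult f g)
    have "\<pi> (derivation od d (fn f * fn g)) =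
        (\<Sum>\<alpha>\<in>UNIV. F (pd \<alpha> f) * w \<alpha>) * F g + F f * (\<Sum>\<alpha>\<in>UNIV. F (pd \<alpha> g) * w \<alpha>)"
      using fn_mult by (simp add: derivation_even_mult \<pi>_simps dfn F_def)
    also have "\<dots> = (\<Sum>\<alpha>\<in>UNIV. F (pd \<alpha> (\<lambda>x. f x * g x)) * w \<alpha>)"
      using fn_mult
      by (simp add: F_pd_mult sum_distrib_left sum_distrib_right distrib_right sum.distrib mult.assoc F_commute[of "w _"])
    finally show ?case
      using fn_mult by (simp add: derivation_diff \<pi>_diff dfn)
  next
    case (fn_eq f g)
    have "hol f \<longleftrightarrow> hol g" using cholo_cong[OF open_chart] fn_eq by blast
    moreover have "F (pd \<alpha> f) = F (pd \<alpha> g)" for \<alpha>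
      using fn_eq by (intro F_cong pd_cong[OF open_chart])
    ultimately show ?case
      using fn0[of f] fn0[of g] by (cases "hol f") (simp_all add: derivation_diff \<pi>_diff dfn, simp add: fn_def)
  next
    case (junk f)
    then show ?case using fn0 by (simp add: fn_def)
  next
    case (even_commute a b)
    then show ?case
      using sc[of a b] sc[of b a]
      by (cases od; cases "odd_gen b")
        (simp_all add: derivation_diff derivation_mult twist_gn \<pi>_simps od gdeg_def)
  next
    case (odd_anticommute a b)
    then show ?case
      using sc[of a b] sc[of b a]
      by (cases od) (simp_all add: derivation_add derivation_mult twist_gn \<pi>_simps od gdeg_def)
  next
    case (recursion \<alpha> k)
    then show ?case by (rule rec)
  next
    case (diff x)
    then show ?case using dx[of x] by (simp flip: D_\<pi>)
  next
    case (no_odd_constants p x)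
    \<comment> \<open>The induction hypothesis concerns \<open>dx M x\<close>. Exchanging the two
      derivations makes the image of x a constant, of positive degree p + e.\<close>
    have "D (\<pi> (derivation od d x)) = 0"
      using no_odd_constants dx[of x] by (simp add: D_\<pi>)
    then show ?case
      using no_odd_constants(1) homog_derivation[of e d, OF homog no_odd_constants(2)]
      by (intro no_odd_constants_\<pi>[of "p + e"]) auto
  qed (auto simp: derivation_add \<pi>_add)
  then show ?thesis
    by (simp add: preserves_def \<pi>_eq_0_iff)
qed

lemma flow_gen_homog:
  assumes "\<And>\<alpha>. homog e (a \<alpha>)" "\<And>\<alpha> k. homog (1 + e) (b \<alpha> k)"
  shows "homog (gdeg g + e) (flow_gen M a b g)"
proof (cases g)
  case (Fn f)
  then show ?thesis using assms by (auto simp: gdeg_def chain_def intro!: homog_mult0)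
next
  case (V \<alpha> s)
  then show ?thesis using homog_dx_power[OF assms(1), of "Suc s"] by (simp add: gdeg_def)
next
  case (S \<alpha> k s)
  then show ?thesis using homog_dx_power[OF assms(2), of s] by (simp add: gdeg_def)
qed

lemma flow_gen_fn:
  "\<pi> (flow_gen M a b (Fn f)) = (if hol f then \<Sum>\<alpha>\<in>UNIV. F (pd \<alpha> f) * \<pi> (a \<alpha>) else 0)"
  by (simp add: chain_def \<pi>_simps F_def)

text \<open>On the jets of v and on the odd variables this is built into \<open>flow_gen\<close>.
  Function symbols need the symmetry of second partial derivatives, so the identity holds only
  modulo the relations. The argument runs through the commutator in the free algebra and so is
  available before the flow is known to descend.\<close>

lemma flow_commutes_dx:
  assumes "\<And>g. homog (gdeg g + e) (flow_gen M a b g)" "od = odd e"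
  shows "\<pi> (derivation od (flow_gen M a b) (dx M x)) = \<pi> (dx M (derivation od (flow_gen M a b) x))"
proof -
  let ?d = "flow_gen M a b"
  have "\<pi> (scomm od ?d False (dx_gen M) (gn g)) = 0" for g
  proof (cases g)
    case (Fn f)
    have dv: "derivation od ?d (vv \<alpha> (Suc 0)) = dx M (a \<alpha>)" for \<alpha>
      by (simp add: vv_def dx_def)
    show ?thesis
    proof (cases "hol f")
      case True
      have h: "hol (pd \<alpha> f)" for \<alpha> using True open_chart by simp
      have "\<pi> (derivation od ?d (dx_gen M (Fn f))) = (\<Sum>\<alpha>\<in>UNIV.
          (\<Sum>\<beta>\<in>UNIV. F (pd \<beta> (pd \<alpha> f)) * \<pi> (a \<beta>)) * \<pi> (vv \<alpha> 1) + F (pd \<alpha> f) * \<pi> (dx M (a \<alpha>)))"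
        using True h
        by (simp add: chain_def derivation_sum derivation_even_mult dv \<pi>_simps F_def)
          (simp add: fn_def chain_def \<pi>_simps F_def)
      also have "\<dots> = (\<Sum>\<alpha>\<in>UNIV.
          (\<Sum>\<beta>\<in>UNIV. F (pd \<beta> (pd \<alpha> f)) * \<pi> (vv \<beta> 1)) * \<pi> (a \<alpha>) + F (pd \<alpha> f) * \<pi> (dx M (a \<alpha>)))"
      proof -
        have "(\<Sum>\<alpha>\<in>UNIV. (\<Sum>\<beta>\<in>UNIV. F (pd \<beta> (pd \<alpha> f)) * \<pi> (a \<beta>)) * \<pi> (vv \<alpha> 1)) =
            (\<Sum>\<alpha>\<in>UNIV. \<Sum>\<beta>\<in>UNIV. F (pd \<alpha> (pd \<beta> f)) * \<pi> (a \<beta>) * \<pi> (vv \<alpha> 1))"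
          by (simp add: sum_distrib_right F_pd_commute[OF True])
        also have "\<dots> = (\<Sum>\<beta>\<in>UNIV. \<Sum>\<alpha>\<in>UNIV. F (pd \<alpha> (pd \<beta> f)) * \<pi> (a \<beta>) * \<pi> (vv \<alpha> 1))"
          by (rule sum.swap)
        also have "\<dots> = (\<Sum>\<beta>\<in>UNIV. (\<Sum>\<alpha>\<in>UNIV. F (pd \<alpha> (pd \<beta> f)) * \<pi> (vv \<alpha> 1)) * \<pi> (a \<beta>))"
          by (simp add: sum_distrib_right mult.assoc central_vv[of "\<pi> (a _)"])
        finally show ?thesis by (simp add: sum.distrib)
      qed
      also have "\<dots> = \<pi> (dx M (?d (Fn f)))"
        using True h
        by (simp add: dx_def chain_def derivation_sum derivation_even_mult \<pi>_simps F_def)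
          (simp add: fn_def chain_def \<pi>_simps F_def)
      finally show ?thesis
        unfolding scomm_def derivation_gn Fn by (simp add: \<pi>_diff dx_def)
    qed (simp add: scomm_def Fn chain_def)
  qed (simp_all add: scomm_def dx_def)
  then have "\<pi> (derivation (od \<noteq> False) (\<lambda>g. scomm od ?d False (dx_gen M) (gn g)) x) = 0"
    by (rule \<pi>_derivation_eq_0)
  then have "\<pi> (scomm od ?d False (dx_gen M) x) = 0"
    using scomm_derivation[OF gradedI[OF assms] graded_dx, of x] by simp
  then show ?thesis
    by (simp add: scomm_def dx_def \<pi>_diff)
qed

end

section \<open>Frobenius manifolds\<close>

locale frobenius =
  fixes M :: "('n::finite) frob"
  assumes fm: "frobenius_manifold M"
begin

abbreviation "et \<alpha> \<beta> \<equiv> etainv M $ \<alpha> $ \<beta>"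

section \<open>Structure constants, metric and \<mu>\<close>

definition c3 :: "'n \<Rightarrow> 'n \<Rightarrow> 'n \<Rightarrow> complex^'n \<Rightarrow> complex" where
  "c3 \<alpha> \<beta> \<gamma> = pd \<alpha> (pd \<beta> (pd \<gamma> (pot M)))"

text \<open>The upper index comes first, so that for fixed \<beta> these are the matrix entries,
  with row \<alpha> and column \<gamma>, of the product with the \<beta>-th coordinate
  field.\<close>

definition C :: "'n \<Rightarrow> 'n \<Rightarrow> 'n \<Rightarrow> complex^'n \<Rightarrow> complex" where
  "C \<alpha> \<beta> \<gamma> x = (\<Sum>\<zeta>\<in>UNIV. et \<alpha> \<zeta> * c3 \<zeta> \<beta> \<gamma> x)"

lemma cmul_C: "cmul M \<beta> \<gamma> \<alpha> = C \<alpha> \<beta> \<gamma>"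
  by (simp add: fun_eq_iff cmul_def C_def c3_def)

lemma open_M: "open (chart M)"
  and pot: "cholo (chart M) (pot M)"
  and unit_c3: "x \<in> chart M \<Longrightarrow> c3 (unt M) \<alpha> \<beta> x = eta M $ \<alpha> $ \<beta>"
  and inv_eta: "invertible (eta M)"
  and mu_eta: "(mu M \<alpha> + mu M \<beta>) * eta M $ \<alpha> $ \<beta> = 0"
  using fm by (auto simp: frobenius_manifold_def c3_def)

lemma C_assoc: "x \<in> chart M \<Longrightarrow>
    (\<Sum>\<epsilon>\<in>UNIV. C \<epsilon> \<alpha> \<beta> x * C \<delta> \<epsilon> \<gamma> x) = (\<Sum>\<epsilon>\<in>UNIV. C \<epsilon> \<beta> \<gamma> x * C \<delta> \<alpha> \<epsilon> x)"
  using fm by (simp add: frobenius_manifold_def cmul_C)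

lemma hol_c3 [simp, intro]: "cholo (chart M) (c3 \<alpha> \<beta> \<gamma>)"
  unfolding c3_def using open_M pot by auto

lemma hol_C [simp, intro]: "cholo (chart M) (C \<alpha> \<beta> \<gamma>)"
  unfolding C_def by auto

lemma c3_sym12: "x \<in> chart M \<Longrightarrow> c3 \<alpha> \<beta> \<gamma> x = c3 \<beta> \<alpha> \<gamma> x"
  unfolding c3_def using open_M pot by (intro pd_commute[of "chart M"]) auto

lemma c3_sym23: "x \<in> chart M \<Longrightarrow> c3 \<alpha> \<beta> \<gamma> x = c3 \<alpha> \<gamma> \<beta> x"
  unfolding c3_def using open_M pot pd_commute[OF open_M pot] by (intro pd_cong[of "chart M"]) auto

lemma C_sym: "x \<in> chart M \<Longrightarrow> C \<alpha> \<beta> \<gamma> x = C \<alpha> \<gamma> \<beta> x"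
  unfolding C_def by (simp add: c3_sym23[of x _ \<beta> \<gamma>])

lemma pd_c3: "x \<in> chart M \<Longrightarrow> pd \<delta> (c3 \<alpha> \<beta> \<gamma>) x = pd \<beta> (c3 \<alpha> \<delta> \<gamma>) x"
proof -
  assume x: "x \<in> chart M"
  have "pd \<delta> (c3 \<alpha> \<beta> \<gamma>) x = pd \<delta> (c3 \<beta> \<alpha> \<gamma>) x"
    using c3_sym12 by (intro pd_cong[OF open_M x])
  also have "\<dots> = pd \<beta> (c3 \<delta> \<alpha> \<gamma>) x"
    unfolding c3_def using open_M pot x by (intro pd_commute[of "chart M"]) auto
  also have "\<dots> = pd \<beta> (c3 \<alpha> \<delta> \<gamma>) x"
    using c3_sym12 by (intro pd_cong[OF open_M x])
  finally show ?thesis .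
qed

lemma pd_C: "x \<in> chart M \<Longrightarrow> pd \<delta> (C \<alpha> \<beta> \<gamma>) x = pd \<beta> (C \<alpha> \<delta> \<gamma>) x"
  unfolding C_def by (simp add: pd_sum[of _ "chart M"] pd_cmult[of "chart M"] pd_c3[of x \<delta> _ \<beta>])

lemma eta_etainv: "eta M ** etainv M = mat 1" and etainv_eta: "etainv M ** eta M = mat 1"
  using someI_ex[OF inv_eta[unfolded invertible_def]] unfolding etainv_def matrix_inv_def by auto

text \<open>The symmetry is inherited from third derivatives of the potential, hence the point x:
  over an empty chart \<open>eta M\<close> may fail to be symmetric.\<close>

lemma eta_sym: "x \<in> chart M \<Longrightarrow> eta M $ \<alpha> $ \<beta> = eta M $ \<beta> $ \<alpha>"
  using unit_c3[of x \<alpha> \<beta>] unit_c3[of x \<beta> \<alpha>] c3_sym23[of x "unt M" \<alpha> \<beta>] by simp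

lemma etainv_sym: "x \<in> chart M \<Longrightarrow> et \<alpha> \<beta> = et \<beta> \<alpha>"
proof -
  assume "x \<in> chart M"
  then have "transpose (eta M) = eta M"
    by (simp add: transpose_def vec_eq_iff eta_sym[of x])
  then have 1: "transpose (etainv M) ** eta M = mat 1"
    by (metis eta_etainv matrix_transpose_mul transpose_mat)
  have "transpose (etainv M) = transpose (etainv M) ** (eta M ** etainv M)"
    by (simp add: eta_etainv)
  also have "\<dots> = etainv M"
    by (simp add: matrix_mul_assoc 1)
  finally show ?thesis
    by (metis transpose_def vec_lambda_beta)
qed

text \<open>As matrices, diag(\<mu>) anticommutes with \<eta>; multiplying by the inverse of \<eta>
  from both sides carries this over to the inverse.\<close>

lemma mu_etainv: "et \<alpha> \<beta> * mu M \<beta> = - (mu M \<alpha> * et \<alpha> \<beta>)"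
proof -
  define m :: "complex^'n^'n" where "m = (\<chi> i j. if i = j then mu M i else 0)"
  have ml: "(m ** A) $ i $ j = mu M i * A $ i $ j" for A :: "complex^'n^'n" and i j
    by (simp add: m_def matrix_matrix_mult_def if_distrib[of "\<lambda>c. c * _"] cong: if_cong)
  have mr: "(A ** m) $ i $ j = A $ i $ j * mu M j" for A :: "complex^'n^'n" and i j
    by (simp add: m_def matrix_matrix_mult_def if_distrib[of "\<lambda>c. _ * c"] cong: if_cong)
  have "mu M i * eta M $ i $ j = - (eta M $ i $ j * mu M j)" for i j
    using mu_eta[of i j] by algebra
  then have "m ** eta M = - (eta M ** m)"
    by (simp add: vec_eq_iff ml mr)
  then have "(etainv M ** (m ** eta M)) ** etainv M = (etainv M ** (- (eta M ** m))) ** etainv M"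
    by simp
  moreover have "(etainv M ** (m ** eta M)) ** etainv M = etainv M ** m"
    by (simp add: eta_etainv flip: matrix_mul_assoc)
  moreover have "- (eta M ** m) = eta M ** (- m)"
    by (simp add: matrix_matrix_mult_def vec_eq_iff sum_negf)
  moreover have "(etainv M ** (eta M ** (- m))) ** etainv M = - m ** etainv M"
    by (simp add: matrix_mul_assoc etainv_eta)
  moreover have "- m ** etainv M = - (m ** etainv M)"
    by (simp add: matrix_matrix_mult_def vec_eq_iff sum_negf)
  ultimately have "(etainv M ** m) $ \<alpha> $ \<beta> = - (m ** etainv M) $ \<alpha> $ \<beta>"
    by simp
  then show ?thesis
    by (simp add: ml mr)
qed

section \<open>Euler field, intersection form and Christoffel symbols\<close>

definition Um :: "'n \<Rightarrow> 'n \<Rightarrow> complex^'n \<Rightarrow> complex" where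
  "Um \<alpha> \<beta> x = (\<Sum>\<epsilon>\<in>UNIV. euler M \<epsilon> x * C \<alpha> \<epsilon> \<beta> x)"

lemma hol_euler [simp, intro]: "cholo (chart M) (euler M \<alpha>)"
  unfolding euler_def by auto

lemma hol_Um [simp, intro]: "cholo (chart M) (Um \<alpha> \<beta>)"
  unfolding Um_def by auto

lemma pd_euler: "x \<in> chart M \<Longrightarrow> pd \<beta> (euler M \<alpha>) x = (if \<beta> = \<alpha> then 1 - chg M / 2 - mu M \<alpha> else 0)"
  unfolding euler_def by (simp add: pd_add[of "chart M"] pd_cmult[of "chart M"])

text \<open>Since the fourth derivatives of the potential are symmetric, differentiating C in
  \<open>Um\<close> gives the derivative of C along the Euler field, which the Lie derivative
  condition evaluates. The charge and \<mu> at \<gamma> cancel against the derivative of the Euler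
  field itself.\<close>

lemma pd_Um: 
  assumes x: "x \<in> chart M"
  shows "pd \<gamma> (Um \<alpha> \<beta>) x = (1 + mu M \<beta> - mu M \<alpha>) * C \<alpha> \<gamma> \<beta> x"
proof -
  have "lie12 M (cmul M) \<gamma> \<beta> \<alpha> x = cmul M \<gamma> \<beta> \<alpha> x"
    using fm x by (simp add: frobenius_manifold_def)
  then have *: "along_euler M (C \<alpha> \<gamma> \<beta>) x = (chg M / 2 + mu M \<gamma> + mu M \<beta> - mu M \<alpha>) * C \<alpha> \<gamma> \<beta> x"
    by (simp add: lie12_def cmul_C pd_euler[OF x] if_distrib[of "\<lambda>c. _ * c"] algebra_simps cong: if_cong)
  have "pd \<gamma> (Um \<alpha> \<beta>) x = (1 - chg M / 2 - mu M \<gamma>) * C \<alpha> \<gamma> \<beta> x + along_euler M (C \<alpha> \<gamma> \<beta>) x"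
    using x unfolding Um_def along_euler_def
    by (simp add: pd_sum[of _ "chart M"] pd_mult[of "chart M"] pd_euler pd_C[OF x, of \<gamma> \<alpha> _ \<beta>]
        sum.distrib if_distrib[of "\<lambda>c. c * _"] cong: if_cong)
  then show ?thesis unfolding * by (simp add: algebra_simps)
qed

lemma cup_C:
  assumes "x \<in> chart M"
  shows "cup M \<alpha> \<beta> \<gamma> x = (\<Sum>\<kappa>\<in>UNIV. C \<alpha> \<gamma> \<kappa> x * et \<kappa> \<beta>)"
proof -
  have "c3 \<kappa> \<zeta> \<gamma> x = c3 \<zeta> \<gamma> \<kappa> x" for \<kappa> \<zeta>
    using c3_sym12[OF assms, of \<kappa> \<zeta> \<gamma>] c3_sym23[OF assms, of \<zeta> \<kappa> \<gamma>] by simp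
  then have "cup M \<alpha> \<beta> \<gamma> x = (\<Sum>\<zeta>\<in>UNIV. \<Sum>\<kappa>\<in>UNIV. et \<alpha> \<zeta> * (et \<kappa> \<beta> * c3 \<zeta> \<gamma> \<kappa> x))"
    unfolding cup_def cmul_C C_def by (simp add: sum_distrib_left etainv_sym[OF assms, of \<beta>])
  also have "\<dots> = (\<Sum>\<kappa>\<in>UNIV. C \<alpha> \<gamma> \<kappa> x * et \<kappa> \<beta>)"
    unfolding C_def by (subst sum.swap) (simp add: sum_distrib_left sum_distrib_right mult_ac)
  finally show ?thesis .
qed

lemma gmet_Um: "x \<in> chart M \<Longrightarrow> gmet M \<alpha> \<beta> x = (\<Sum>\<kappa>\<in>UNIV. et \<kappa> \<beta> * Um \<alpha> \<kappa> x)"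
proof -
  assume x: "x \<in> chart M"
  have "gmet M \<alpha> \<beta> x = (\<Sum>\<epsilon>\<in>UNIV. \<Sum>\<kappa>\<in>UNIV. euler M \<epsilon> x * (C \<alpha> \<epsilon> \<kappa> x * et \<kappa> \<beta>))"
    by (simp add: gmet_def cup_C[OF x] sum_distrib_left)
  also have "\<dots> = (\<Sum>\<kappa>\<in>UNIV. et \<kappa> \<beta> * Um \<alpha> \<kappa> x)"
    unfolding Um_def by (subst sum.swap) (simp add: sum_distrib_left mult_ac)
  finally show ?thesis .
qed

text \<open>Moving \<mu> through the inverse metric changes its sign. This is the origin of the
  factor 1/2 + \<mu> in \<open>A\<close>, although the Christoffel symbols carry 1/2 -
  \<mu>.\<close>

lemma Gam_C: "x \<in> chart M \<Longrightarrow> Gam M \<alpha> \<beta> \<gamma> x = (\<Sum>\<kappa>\<in>UNIV. (1/2 + mu M \<kappa>) * et \<kappa> \<beta> * C \<alpha> \<gamma> \<kappa> x)"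
proof -
  assume x: "x \<in> chart M"
  have "(1/2 - mu M \<beta>) * (C \<alpha> \<gamma> \<kappa> x * et \<kappa> \<beta>) = (1/2 + mu M \<kappa>) * et \<kappa> \<beta> * C \<alpha> \<gamma> \<kappa> x" for \<kappa>
  proof -
    have "(1/2 - mu M \<beta>) * (C \<alpha> \<gamma> \<kappa> x * et \<kappa> \<beta>) = C \<alpha> \<gamma> \<kappa> x * (et \<kappa> \<beta> / 2 - et \<kappa> \<beta> * mu M \<beta>)"
      by (simp add: algebra_simps)
    then show ?thesis
      unfolding mu_etainv by (simp add: algebra_simps)
  qed
  then show ?thesis
    unfolding Gam_def cup_C[OF x] sum_distrib_left by (intro sum.cong refl)
qed

end

section \<open>Vectors over the differential ring\<close>

locale frobenius_ring = quotient_ring M \<pi> + frobenius M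
  for M :: "('n::finite) frob" and \<pi> :: "'n alg \<Rightarrow> 'r::{ring,monoid_mult}"
begin

text \<open>
  Vectors carry an upper index. \<open>P\<close> is the Frobenius product, \<open>U\<close> the product with the Euler field,
  \<open>N a b c\<close> the derivative of \<open>P\<close> in the direction \<open>a\<close> applied to \<open>b\<close> and \<open>c\<close>, \<open>u\<close> is the \<open>x\<close>-derivative of \<open>v\<close>
  and \<open>raised\<close> raises an index, so that \<open>s k\<close> has the components \<open>\<eta>\<^bsup>\<alpha>\<beta>\<^esup>\<sigma>\<^bsub>\<beta>,k\<^esub>\<close>.
\<close>

definition L1 :: "('n \<Rightarrow> 'n \<Rightarrow> complex^'n \<Rightarrow> complex) \<Rightarrow> 'r^'n \<Rightarrow> 'r^'n" where
  "L1 T a = (\<chi> \<alpha>. \<Sum>\<beta>\<in>UNIV. F (T \<alpha> \<beta>) * a $ \<beta>)"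

text \<open>The components are multiplied in the order of the arguments, which matters when both are
  odd.\<close>

definition L2 :: "('n \<Rightarrow> 'n \<Rightarrow> 'n \<Rightarrow> complex^'n \<Rightarrow> complex) \<Rightarrow> 'r^'n \<Rightarrow> 'r^'n \<Rightarrow> 'r^'n" where
  "L2 T a b = (\<chi> \<alpha>. \<Sum>\<beta>\<in>UNIV. \<Sum>\<gamma>\<in>UNIV. F (T \<alpha> \<beta> \<gamma>) * (a $ \<beta> * b $ \<gamma>))"

definition L3 :: "('n \<Rightarrow> 'n \<Rightarrow> 'n \<Rightarrow> 'n \<Rightarrow> complex^'n \<Rightarrow> complex) \<Rightarrow> 'r^'n \<Rightarrow> 'r^'n \<Rightarrow> 'r^'n \<Rightarrow> 'r^'n" where
  "L3 T a b c = (\<chi> \<alpha>. \<Sum>\<beta>\<in>UNIV. \<Sum>\<gamma>\<in>UNIV. \<Sum>\<delta>\<in>UNIV. F (T \<alpha> \<beta> \<gamma> \<delta>) * (a $ \<beta> * b $ \<gamma> * c $ \<delta>))"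

abbreviation "P \<equiv> L2 C"
abbreviation "U \<equiv> L1 Um"
abbreviation "N \<equiv> L3 (\<lambda>\<alpha> \<beta> \<gamma> \<delta>. pd \<beta> (C \<alpha> \<gamma> \<delta>))"

definition A :: "'r^'n \<Rightarrow> 'r^'n" where "A a = (\<chi> \<alpha>. sc (1/2 + mu M \<alpha>) * a $ \<alpha>)"
text \<open>The adjoint of \<open>A\<close> for \<eta>, because \<mu> is skew.\<close>

definition A_dual :: "'r^'n \<Rightarrow> 'r^'n" where "A_dual a = (\<chi> \<alpha>. sc (1/2 - mu M \<alpha>) * a $ \<alpha>)"

definition vec_push :: "bool \<Rightarrow> ('n gen \<Rightarrow> 'n alg) \<Rightarrow> 'r^'n \<Rightarrow> 'r^'n" where
  "vec_push od d a = (\<chi> \<alpha>. push od d (a $ \<alpha>))"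

definition Dv :: "'r^'n \<Rightarrow> 'r^'n" where "Dv a = (\<chi> \<alpha>. D (a $ \<alpha>))"

definition u :: "'r^'n" where "u = (\<chi> \<alpha>. \<pi> (vv \<alpha> 1))"

definition raised :: "('n \<Rightarrow> 'r) \<Rightarrow> 'r^'n" where
  "raised z = (\<chi> \<kappa>. \<Sum>\<beta>\<in>UNIV. sc (et \<kappa> \<beta>) * z \<beta>)"

definition s :: "nat \<Rightarrow> 'r^'n" where "s k = raised (\<lambda>\<beta>. \<pi> (sg \<beta> k 0))"

section \<open>Multilinear maps with function coefficients\<close>

lemma additive_L1: "Modules.additive (L1 T)"
  by unfold_locales (simp add: L1_def vec_eq_iff distrib_left sum.distrib)

lemma additive_L2_left: "Modules.additive (\<lambda>a. L2 T a b)"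
  by unfold_locales (simp add: L2_def vec_eq_iff distrib_left distrib_right sum.distrib)

lemma additive_L2_right: "Modules.additive (L2 T a)"
  by unfold_locales (simp add: L2_def vec_eq_iff distrib_left distrib_right sum.distrib)

lemma additive_A: "Modules.additive A"
  by unfold_locales (simp add: A_def vec_eq_iff distrib_left)

lemma additive_A_dual: "Modules.additive A_dual"
  by unfold_locales (simp add: A_dual_def vec_eq_iff distrib_left)

lemma additive_Dv: "Modules.additive Dv"
  by unfold_locales (simp add: Dv_def vec_eq_iff D_add)

lemma additive_vec_push: "preserves od d \<Longrightarrow> Modules.additive (vec_push od d)"
  by unfold_locales (simp add: vec_push_def vec_eq_iff push_add)

lemmas vec_add = additive_L1[THEN additive.add] additive_L2_left[THEN additive.add]
  additive_L2_right[THEN additive.add] additive_A[THEN additive.add] additive_A_dual[THEN additive.add]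
  additive_Dv[THEN additive.add]
lemmas vec_zero = additive_L1[THEN additive.zero] additive_L2_left[THEN additive.zero]
  additive_L2_right[THEN additive.zero] additive_A[THEN additive.zero] additive_A_dual[THEN additive.zero]
  additive_Dv[THEN additive.zero]
lemmas vec_minus = additive_L1[THEN additive.minus] additive_L2_left[THEN additive.minus]
  additive_L2_right[THEN additive.minus] additive_A[THEN additive.minus] additive_A_dual[THEN additive.minus]
  additive_Dv[THEN additive.minus]
lemmas vec_sum = additive_L1[THEN additive.sum] additive_L2_left[THEN additive.sum]
  additive_L2_right[THEN additive.sum] additive_A[THEN additive.sum] additive_A_dual[THEN additive.sum]
  additive_Dv[THEN additive.sum]

lemma u_central: "z * u $ \<alpha> = u $ \<alpha> * z"
  by (simp add: u_def central_vv)

lemma L2_cong: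
  assumes "\<And>x \<alpha> \<beta> \<gamma>. x \<in> chart M \<Longrightarrow> T \<alpha> \<beta> \<gamma> x = T' \<alpha> \<beta> \<gamma> x"
  shows "L2 T a b = L2 T' a b"
proof -
  have "F (T \<alpha> \<beta> \<gamma>) = F (T' \<alpha> \<beta> \<gamma>)" for \<alpha> \<beta> \<gamma> using assms by (intro F_cong)
  then show ?thesis by (simp add: L2_def)
qed

lemma L2_swap:
  assumes "\<And>\<beta> \<gamma>. a $ \<beta> * b $ \<gamma> = b $ \<gamma> * a $ \<beta>"
  shows "L2 T a b = L2 (\<lambda>\<alpha> \<beta> \<gamma>. T \<alpha> \<gamma> \<beta>) b a"
  unfolding L2_def vec_eq_iff vec_lambda_beta assms by (intro allI sum.swap)

lemma L2_skew:
  assumes "\<And>\<beta> \<gamma>. a $ \<beta> * b $ \<gamma> = - (b $ \<gamma> * a $ \<beta>)"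
  shows "L2 T a b = - L2 (\<lambda>\<alpha> \<beta> \<gamma>. T \<alpha> \<gamma> \<beta>) b a"
proof -
  have "L2 T a b $ \<alpha> = - (\<Sum>\<beta>\<in>UNIV. \<Sum>\<gamma>\<in>UNIV. F (T \<alpha> \<beta> \<gamma>) * (b $ \<gamma> * a $ \<beta>))" for \<alpha>
    by (simp add: L2_def assms sum_negf)
  also have "\<dots> \<alpha> = - L2 (\<lambda>\<alpha> \<beta> \<gamma>. T \<alpha> \<gamma> \<beta>) b a $ \<alpha>" for \<alpha>
    unfolding L2_def vec_lambda_beta by (subst sum.swap) simp
  finally show ?thesis by (simp add: vec_eq_iff)
qed

lemma P_commute: "(\<And>\<beta> \<gamma>. a $ \<beta> * b $ \<gamma> = b $ \<gamma> * a $ \<beta>) \<Longrightarrow> P a b = P b a"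
  by (subst L2_swap) (auto intro: L2_cong C_sym)

lemma P_skew: "(\<And>\<beta> \<gamma>. a $ \<beta> * b $ \<gamma> = - (b $ \<gamma> * a $ \<beta>)) \<Longrightarrow> P a b = - P b a"
  by (subst L2_skew) (auto intro: L2_cong C_sym)

lemma N_commute: "(\<And>\<beta> \<gamma>. a $ \<beta> * b $ \<gamma> = b $ \<gamma> * a $ \<beta>) \<Longrightarrow> N a b c = N b a c"
proof -
  assume ab: "\<And>\<beta> \<gamma>. a $ \<beta> * b $ \<gamma> = b $ \<gamma> * a $ \<beta>"
  have "F (pd \<beta> (C \<alpha> \<gamma> \<delta>)) = F (pd \<gamma> (C \<alpha> \<beta> \<delta>))" for \<alpha> \<beta> \<gamma> \<delta>
    by (intro F_cong pd_C)
  then have "N a b c $ \<alpha> = (\<Sum>\<beta>\<in>UNIV. \<Sum>\<gamma>\<in>UNIV. \<Sum>\<delta>\<in>UNIV. F (pd \<gamma> (C \<alpha> \<beta> \<delta>)) * (b $ \<gamma> * a $ \<beta> * c $ \<delta>))" for \<alpha>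
    by (simp add: L3_def ab)
  also have "\<dots> \<alpha> = N b a c $ \<alpha>" for \<alpha>
    unfolding L3_def vec_lambda_beta by (rule sum.swap)
  finally show ?thesis by (simp add: vec_eq_iff)
qed

text \<open>Both bracketings are brought to a trilinear form in a, b, c in this order. Associativity
  is then an identity between functions on the chart and holds for odd vectors without
  signs.\<close>

lemma P_P_right: "P a (P b c) = L3 (\<lambda>\<alpha> \<beta> \<gamma> \<delta> x. \<Sum>\<kappa>\<in>UNIV. C \<alpha> \<beta> \<kappa> x * C \<kappa> \<gamma> \<delta> x) a b c"
proof -
  have "P a (P b c) $ \<alpha> = (\<Sum>\<beta>\<in>UNIV. \<Sum>\<kappa>\<in>UNIV. \<Sum>\<gamma>\<in>UNIV. \<Sum>\<delta>\<in>UNIV.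
      F (C \<alpha> \<beta> \<kappa>) * F (C \<kappa> \<gamma> \<delta>) * (a $ \<beta> * b $ \<gamma> * c $ \<delta>))" for \<alpha>
    by (simp add: L2_def sum_distrib_left F_left_commute[of "a $ _"] mult.assoc)
  also have "\<dots> \<alpha> = (\<Sum>\<beta>\<in>UNIV. \<Sum>\<gamma>\<in>UNIV. \<Sum>\<delta>\<in>UNIV. \<Sum>\<kappa>\<in>UNIV.
      F (C \<alpha> \<beta> \<kappa>) * F (C \<kappa> \<gamma> \<delta>) * (a $ \<beta> * b $ \<gamma> * c $ \<delta>))" for \<alpha>
    by (rule sum.cong[OF refl], subst sum.swap, rule sum.cong[OF refl], subst sum.swap, rule refl)
  also have "\<dots> \<alpha> = L3 (\<lambda>\<alpha> \<beta> \<gamma> \<delta> x. \<Sum>\<kappa>\<in>UNIV. C \<alpha> \<beta> \<kappa> x * C \<kappa> \<gamma> \<delta> x) a b c $ \<alpha>" for \<alpha>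
    by (simp add: L3_def F_sum F_mult sum_distrib_right)
  finally show ?thesis by (simp add: vec_eq_iff)
qed

lemma P_P_left: "P (P a b) c = L3 (\<lambda>\<alpha> \<beta> \<gamma> \<delta> x. \<Sum>\<kappa>\<in>UNIV. C \<alpha> \<kappa> \<delta> x * C \<kappa> \<beta> \<gamma> x) a b c"
proof -
  have "P (P a b) c $ \<alpha> = (\<Sum>\<kappa>\<in>UNIV. \<Sum>\<delta>\<in>UNIV. \<Sum>\<beta>\<in>UNIV. \<Sum>\<gamma>\<in>UNIV.
      F (C \<alpha> \<kappa> \<delta>) * F (C \<kappa> \<beta> \<gamma>) * (a $ \<beta> * b $ \<gamma> * c $ \<delta>))" for \<alpha>
    by (simp add: L2_def sum_distrib_left sum_distrib_right mult.assoc)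
  also have "\<dots> \<alpha> = (\<Sum>\<kappa>\<in>UNIV. \<Sum>\<beta>\<in>UNIV. \<Sum>\<gamma>\<in>UNIV. \<Sum>\<delta>\<in>UNIV.
      F (C \<alpha> \<kappa> \<delta>) * F (C \<kappa> \<beta> \<gamma>) * (a $ \<beta> * b $ \<gamma> * c $ \<delta>))" for \<alpha>
    by (rule sum.cong[OF refl], subst sum.swap, rule sum.cong[OF refl], subst sum.swap, rule refl)
  also have "\<dots> \<alpha> = (\<Sum>\<beta>\<in>UNIV. \<Sum>\<gamma>\<in>UNIV. \<Sum>\<delta>\<in>UNIV. \<Sum>\<kappa>\<in>UNIV.
      F (C \<alpha> \<kappa> \<delta>) * F (C \<kappa> \<beta> \<gamma>) * (a $ \<beta> * b $ \<gamma> * c $ \<delta>))" for \<alpha>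
    by (subst sum.swap, rule sum.cong[OF refl], subst sum.swap, rule sum.cong[OF refl], subst sum.swap, rule refl)
  also have "\<dots> \<alpha> = L3 (\<lambda>\<alpha> \<beta> \<gamma> \<delta> x. \<Sum>\<kappa>\<in>UNIV. C \<alpha> \<kappa> \<delta> x * C \<kappa> \<beta> \<gamma> x) a b c $ \<alpha>" for \<alpha>
    by (simp add: L3_def F_sum F_mult sum_distrib_right)
  finally show ?thesis by (simp add: vec_eq_iff)
qed

lemma P_assoc: "P (P a b) c = P a (P b c)"
proof -
  have "F (\<lambda>x. \<Sum>\<kappa>\<in>UNIV. C \<alpha> \<kappa> \<delta> x * C \<kappa> \<beta> \<gamma> x) = F (\<lambda>x. \<Sum>\<kappa>\<in>UNIV. C \<alpha> \<beta> \<kappa> x * C \<kappa> \<gamma> \<delta> x)" for \<alpha> \<beta> \<gamma> \<delta>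
    using C_assoc[of _ \<beta> \<gamma> \<alpha> \<delta>] by (intro F_cong) (simp add: mult.commute)
  then show ?thesis unfolding P_P_left P_P_right by (simp add: L3_def)
qed

definition Fv :: "('n \<Rightarrow> complex^'n \<Rightarrow> complex) \<Rightarrow> 'r^'n" where
  "Fv f = (\<chi> \<alpha>. F (f \<alpha>))"

text \<open>Recognises a matrix as the Frobenius product with a vector field. The components of the
  latter are central, so such matrices commute with one another and with \<open>P\<close> by
  associativity; this serves both for \<open>U\<close> and for the Hessians.\<close>

lemma L1_Fv:
  assumes "\<And>\<epsilon>. hol (f \<epsilon>)" "\<And>x \<alpha> \<beta>. x \<in> chart M \<Longrightarrow> T \<alpha> \<beta> x = (\<Sum>\<epsilon>\<in>UNIV. f \<epsilon> x * C \<alpha> \<epsilon> \<beta> x)"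
  shows "L1 T a = P (Fv f) a"
proof -
  have "F (T \<alpha> \<beta>) = F (\<lambda>x. \<Sum>\<epsilon>\<in>UNIV. C \<alpha> \<epsilon> \<beta> x * f \<epsilon> x)" for \<alpha> \<beta>
    using assms(2) by (intro F_cong) (simp add: mult.commute)
  then have "F (T \<alpha> \<beta>) = (\<Sum>\<epsilon>\<in>UNIV. F (C \<alpha> \<epsilon> \<beta>) * F (f \<epsilon>))" for \<alpha> \<beta>
    using assms(1) by (simp add: F_sum F_mult)
  then have "L1 T a $ \<alpha> = (\<Sum>\<beta>\<in>UNIV. \<Sum>\<epsilon>\<in>UNIV. F (C \<alpha> \<epsilon> \<beta>) * (F (f \<epsilon>) * a $ \<beta>))" for \<alpha>
    by (simp add: L1_def sum_distrib_right mult.assoc)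
  also have "\<dots> \<alpha> = P (Fv f) a $ \<alpha>" for \<alpha>
    unfolding L2_def Fv_def vec_lambda_beta by (rule sum.swap)
  finally show ?thesis by (simp add: vec_eq_iff)
qed

lemma Fv_central: "z * Fv f $ \<alpha> = Fv f $ \<alpha> * z"
  by (simp add: Fv_def F_commute)

lemma U_Fv: "U a = P (Fv (euler M)) a"
  by (rule L1_Fv) (auto simp: Um_def)

lemma Fv_P_right: "P a (P (Fv f) b) = P (Fv f) (P a b)"
  using P_commute[of a "Fv f"] Fv_central by (simp flip: P_assoc)

lemma U_P_right: "P a (U b) = U (P a b)"
  by (simp add: U_Fv Fv_P_right)

lemma L2_dUm: "L2 (\<lambda>\<alpha> \<beta> \<gamma>. pd \<beta> (Um \<alpha> \<gamma>)) a b = P a (A b) + A_dual (P a b)"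
proof -
  have "F (pd \<beta> (Um \<alpha> \<gamma>)) = (sc (1/2 + mu M \<gamma>) + sc (1/2 - mu M \<alpha>)) * F (C \<alpha> \<beta> \<gamma>)" for \<alpha> \<beta> \<gamma>
  proof -
    have "F (pd \<beta> (Um \<alpha> \<gamma>)) = F (\<lambda>x. (1 + mu M \<gamma> - mu M \<alpha>) * C \<alpha> \<beta> \<gamma> x)"
      by (intro F_cong) (simp add: pd_Um)
    moreover have "1 + mu M \<gamma> - mu M \<alpha> = (1/2 + mu M \<gamma>) + (1/2 - mu M \<alpha>)"
      by simp
    ultimately show ?thesis by (simp only: F_cmult[OF hol_C] sc_add)
  qed
  then show ?thesis
    by (simp add: vec_eq_iff L2_def A_def A_dual_def distrib_right sum.distrib sum_distrib_left mult.assoc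
        sc_left_commute[of "F _"] sc_left_commute[of "a $ _"])
qed

lemma vec_push_L1:
  assumes p: "preserves od d" and fn: "\<And>f. hol f \<Longrightarrow> \<pi> (d (Fn f)) = (\<Sum>\<alpha>\<in>UNIV. F (pd \<alpha> f) * w $ \<alpha>)"
    and T: "\<And>\<alpha> \<beta>. hol (T \<alpha> \<beta>)"
  shows "vec_push od d (L1 T a) = L2 (\<lambda>\<alpha> \<beta> \<gamma>. pd \<beta> (T \<alpha> \<gamma>)) w a + L1 T (vec_push od d a)"
proof -
  have "vec_push od d (L1 T a) $ \<alpha> = (\<Sum>\<gamma>\<in>UNIV. \<Sum>\<beta>\<in>UNIV. F (pd \<beta> (T \<alpha> \<gamma>)) * (w $ \<beta> * a $ \<gamma>)) + L1 T (vec_push od d a) $ \<alpha>" for \<alpha>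
    by (simp add: vec_push_def L1_def push_sum[OF p] push_F[OF p] fn[OF T] sum.distrib sum_distrib_right mult.assoc)
  also have "\<dots> \<alpha> = (L2 (\<lambda>\<alpha> \<beta> \<gamma>. pd \<beta> (T \<alpha> \<gamma>)) w a + L1 T (vec_push od d a)) $ \<alpha>" for \<alpha>
    unfolding L2_def vector_add_component vec_lambda_beta by (subst sum.swap) simp
  finally show ?thesis by (simp add: vec_eq_iff)
qed

lemma Dv_vec_push: "Dv = vec_push False (dx_gen M)"
  by (simp add: fun_eq_iff Dv_def vec_push_def D_def)

lemma dx_gen_fn: "hol f \<Longrightarrow> \<pi> (dx_gen M (Fn f)) = (\<Sum>\<alpha>\<in>UNIV. F (pd \<alpha> f) * u $ \<alpha>)"
  by (simp add: chain_def \<pi>_simps F_def u_def)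

lemma Dv_L1: "(\<And>\<alpha> \<beta>. hol (T \<alpha> \<beta>)) \<Longrightarrow> Dv (L1 T a) = L2 (\<lambda>\<alpha> \<beta> \<gamma>. pd \<beta> (T \<alpha> \<gamma>)) u a + L1 T (Dv a)"
  unfolding Dv_vec_push by (rule vec_push_L1[OF preserves_dx dx_gen_fn])

lemma Dv_P: "Dv (P a b) = N u a b + P (Dv a) b + P a (Dv b)"
proof -
  have "D (F (C \<alpha> \<beta> \<gamma>)) = (\<Sum>\<delta>\<in>UNIV. F (pd \<delta> (C \<alpha> \<beta> \<gamma>)) * u $ \<delta>)" for \<alpha> \<beta> \<gamma>
    by (simp add: D_F u_def)
  then have *: "Dv (P a b) $ \<alpha> = (\<Sum>\<beta>\<in>UNIV. \<Sum>\<gamma>\<in>UNIV. \<Sum>\<delta>\<in>UNIV. F (pd \<delta> (C \<alpha> \<beta> \<gamma>)) * (u $ \<delta> * a $ \<beta> * b $ \<gamma>))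
      + P (Dv a) b $ \<alpha> + P a (Dv b) $ \<alpha>" for \<alpha>
    by (simp add: Dv_def L2_def D_sum D_mult distrib_left sum.distrib sum_distrib_right mult.assoc add.assoc)
  have "(\<Sum>\<beta>\<in>UNIV. \<Sum>\<gamma>\<in>UNIV. \<Sum>\<delta>\<in>UNIV. F (pd \<delta> (C \<alpha> \<beta> \<gamma>)) * (u $ \<delta> * a $ \<beta> * b $ \<gamma>))
     = (\<Sum>\<beta>\<in>UNIV. \<Sum>\<delta>\<in>UNIV. \<Sum>\<gamma>\<in>UNIV. F (pd \<delta> (C \<alpha> \<beta> \<gamma>)) * (u $ \<delta> * a $ \<beta> * b $ \<gamma>))" for \<alpha>
    by (rule sum.cong[OF refl], rule sum.swap)
  also have "\<dots> \<alpha> = N u a b $ \<alpha>" for \<alpha>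
    unfolding L3_def vec_lambda_beta by (rule sum.swap)
  finally show ?thesis
    unfolding vec_eq_iff * by simp
qed

lemma Dv_A: "Dv (A a) = A (Dv a)"
  by (simp add: vec_eq_iff Dv_def A_def D_sc)

section \<open>Raised indices and the recursion relation\<close>

lemma raised_D: "raised (\<lambda>\<beta>. D (z \<beta>)) = Dv (raised z)"
  by (simp add: vec_eq_iff Dv_def raised_def D_sc D_sum)

lemma Dv_s: "Dv (s k) = raised (\<lambda>\<beta>. \<pi> (sg \<beta> k 1))"
  by (simp add: s_def D_\<pi> dx_def sg_def flip: raised_D)

lemma hol_gmet [simp, intro]: "hol (gmet M \<alpha> \<beta>)"
  and hol_cup [simp, intro]: "hol (cup M \<alpha> \<beta> \<gamma>)"
  and hol_Gam [simp, intro]: "hol (Gam M \<alpha> \<beta> \<gamma>)"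
  unfolding gmet_def Gam_def cup_def cmul_C by auto

lemma F_lincomb:
  assumes "\<And>\<kappa>. hol (g \<kappa>)" "\<And>x. x \<in> chart M \<Longrightarrow> f x = (\<Sum>\<kappa>\<in>UNIV. c \<kappa> * g \<kappa> x)"
  shows "F f = (\<Sum>\<kappa>\<in>UNIV. sc (c \<kappa>) * F (g \<kappa>))" and "F (pd \<epsilon> f) = (\<Sum>\<kappa>\<in>UNIV. sc (c \<kappa>) * F (pd \<epsilon> (g \<kappa>)))"
proof -
  have "F f = F (\<lambda>x. \<Sum>\<kappa>\<in>UNIV. c \<kappa> * g \<kappa> x)"
    by (rule F_cong) (rule assms)
  then show "F f = (\<Sum>\<kappa>\<in>UNIV. sc (c \<kappa>) * F (g \<kappa>))"
    using assms(1) by (simp add: F_sum F_cmult)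
  have "pd \<epsilon> f x = (\<Sum>\<kappa>\<in>UNIV. c \<kappa> * pd \<epsilon> (g \<kappa>) x)" if x: "x \<in> chart M" for x
  proof -
    have "pd \<epsilon> f x = pd \<epsilon> (\<lambda>x. \<Sum>\<kappa>\<in>UNIV. c \<kappa> * g \<kappa> x) x"
      using assms(2) by (intro pd_cong[OF open_chart x])
    then show ?thesis
      using assms(1) x by (simp add: pd_sum[of _ "chart M"] pd_cmult[of "chart M"])
  qed
  then have "F (pd \<epsilon> f) = F (\<lambda>x. \<Sum>\<kappa>\<in>UNIV. c \<kappa> * pd \<epsilon> (g \<kappa>) x)"
    by (rule F_cong)
  then show "F (pd \<epsilon> f) = (\<Sum>\<kappa>\<in>UNIV. sc (c \<kappa>) * F (pd \<epsilon> (g \<kappa>)))"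
    using assms(1) open_chart by (simp add: F_sum F_cmult)
qed

text \<open>Moves a constant matrix from the coefficient functions to the components of the vector.
  In this way contractions with \<sigma>, which has a lower index, turn into maps applied to raised
  vectors.\<close>

lemma raise_sum:
  assumes "\<And>\<beta>::'n. G \<beta> = (\<Sum>\<kappa>\<in>UNIV. sc (c \<kappa> \<beta>) * H \<kappa>)"
  shows "(\<Sum>\<beta>\<in>UNIV. G \<beta> * z \<beta>) = (\<Sum>\<kappa>\<in>UNIV. H \<kappa> * (\<Sum>\<beta>\<in>UNIV. sc (c \<kappa> \<beta>) * z \<beta>))"
proof -
  have "(\<Sum>\<beta>\<in>UNIV. G \<beta> * z \<beta>) = (\<Sum>\<beta>\<in>UNIV. \<Sum>\<kappa>\<in>UNIV. H \<kappa> * (sc (c \<kappa> \<beta>) * z \<beta>))"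
    by (simp add: assms sum_distrib_right mult.assoc sc_left_commute[of "H _"])
  then show ?thesis
    by (simp add: sum_distrib_left) (rule sum.swap)
qed

lemma sum_gmet: "(\<Sum>\<beta>\<in>UNIV. F (gmet M \<alpha> \<beta>) * z \<beta>) = U (raised z) $ \<alpha>"
  unfolding L1_def raised_def vec_lambda_beta
  by (rule raise_sum, rule F_lincomb(1)) (auto simp: gmet_Um)

lemma sum_pd_gmet:
  "(\<Sum>\<beta>\<in>UNIV. \<Sum>\<epsilon>\<in>UNIV. F (pd \<epsilon> (gmet M \<alpha> \<beta>)) * (w $ \<epsilon> * z \<beta>)) = L2 (\<lambda>\<alpha> \<beta> \<gamma>. pd \<beta> (Um \<alpha> \<gamma>)) w (raised z) $ \<alpha>"
proof -
  have "(\<Sum>\<beta>\<in>UNIV. F (pd \<epsilon> (gmet M \<alpha> \<beta>)) * (w $ \<epsilon> * z \<beta>)) =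
      (\<Sum>\<kappa>\<in>UNIV. F (pd \<epsilon> (Um \<alpha> \<kappa>)) * (\<Sum>\<beta>\<in>UNIV. sc (et \<kappa> \<beta>) * (w $ \<epsilon> * z \<beta>)))" for \<epsilon>
    by (rule raise_sum, rule F_lincomb(2)) (auto simp: gmet_Um)
  then show ?thesis
    by (subst sum.swap) (simp add: L2_def raised_def sum_distrib_left sc_left_commute[of "w $ _"])
qed

lemma A_raised: "A (raised z) $ \<kappa> = (\<Sum>\<beta>\<in>UNIV. sc ((1/2 + mu M \<kappa>) * et \<kappa> \<beta>) * z \<beta>)"
  by (simp add: A_def raised_def sum_distrib_left sc_mult mult.assoc)

lemma sum_Gam:
  "(\<Sum>\<beta>\<in>UNIV. \<Sum>\<gamma>\<in>UNIV. F (Gam M \<alpha> \<beta> \<gamma>) * (w $ \<gamma> * z \<beta>)) = P w (A (raised z)) $ \<alpha>"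
proof -
  have "(\<Sum>\<beta>\<in>UNIV. F (Gam M \<alpha> \<beta> \<gamma>) * (w $ \<gamma> * z \<beta>)) =
      (\<Sum>\<kappa>\<in>UNIV. F (C \<alpha> \<gamma> \<kappa>) * (\<Sum>\<beta>\<in>UNIV. sc ((1/2 + mu M \<kappa>) * et \<kappa> \<beta>) * (w $ \<gamma> * z \<beta>)))" for \<gamma>
    by (rule raise_sum, rule F_lincomb(1)) (auto simp: Gam_C)
  then show ?thesis
    by (subst sum.swap) (simp add: L2_def A_raised sum_distrib_left sc_left_commute[of "w $ _"])
qed

lemma sum_pd_Gam:
  "(\<Sum>\<beta>\<in>UNIV. \<Sum>\<gamma>\<in>UNIV. \<Sum>\<epsilon>\<in>UNIV. F (pd \<epsilon> (Gam M \<alpha> \<beta> \<gamma>)) * (w $ \<epsilon> * y $ \<gamma> * z \<beta>)) = N w y (A (raised z)) $ \<alpha>"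
proof -
  have *: "(\<Sum>\<beta>\<in>UNIV. F (pd \<epsilon> (Gam M \<alpha> \<beta> \<gamma>)) * (w $ \<epsilon> * y $ \<gamma> * z \<beta>)) =
      (\<Sum>\<kappa>\<in>UNIV. F (pd \<epsilon> (C \<alpha> \<gamma> \<kappa>)) * (\<Sum>\<beta>\<in>UNIV. sc ((1/2 + mu M \<kappa>) * et \<kappa> \<beta>) * (w $ \<epsilon> * y $ \<gamma> * z \<beta>)))" for \<gamma> \<epsilon>
    by (rule raise_sum, rule F_lincomb(2)) (auto simp: Gam_C)
  have "(\<Sum>\<beta>\<in>UNIV. \<Sum>\<gamma>\<in>UNIV. \<Sum>\<epsilon>\<in>UNIV. F (pd \<epsilon> (Gam M \<alpha> \<beta> \<gamma>)) * (w $ \<epsilon> * y $ \<gamma> * z \<beta>)) =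
     (\<Sum>\<gamma>\<in>UNIV. \<Sum>\<epsilon>\<in>UNIV. \<Sum>\<beta>\<in>UNIV. F (pd \<epsilon> (Gam M \<alpha> \<beta> \<gamma>)) * (w $ \<epsilon> * y $ \<gamma> * z \<beta>))"
    by (subst sum.swap, rule sum.cong[OF refl], rule sum.swap)
  also have "\<dots> = (\<Sum>\<epsilon>\<in>UNIV. \<Sum>\<gamma>\<in>UNIV. \<Sum>\<beta>\<in>UNIV. F (pd \<epsilon> (Gam M \<alpha> \<beta> \<gamma>)) * (w $ \<epsilon> * y $ \<gamma> * z \<beta>))"
    by (rule sum.swap)
  also have "\<dots> = N w y (A (raised z)) $ \<alpha>"
    unfolding * by (simp add: L3_def A_raised sum_distrib_left sc_left_commute[of "w $ _ * y $ _"])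
  finally show ?thesis .
qed

text \<open>Stated for an arbitrary value function d, as it is applied to the flows and, with
  \<open>w = 0\<close>, to their commutators. The coefficients of the odd variables in the relation
  are even, so an odd derivation produces no signs.\<close>

lemma derivation_recursion:
  assumes fn: "\<And>f. hol f \<Longrightarrow> \<pi> (d (Fn f)) = (\<Sum>\<alpha>\<in>UNIV. F (pd \<alpha> f) * w $ \<alpha>)"
    and V: "\<And>\<gamma>. \<pi> (d (V \<gamma> 0)) = D (w $ \<gamma>)"
    and S: "\<And>\<beta> k. \<pi> (d (S \<beta> k 1)) = D (\<pi> (d (S \<beta> k 0)))"
    and B: "\<And>k. B k = raised (\<lambda>\<beta>. \<pi> (d (S \<beta> k 0)))"
  shows "\<pi> (derivation od d (recursion_rel M \<alpha> k)) =
    (Dv (B (Suc k)) - (L2 (\<lambda>\<alpha> \<beta> \<gamma>. pd \<beta> (Um \<alpha> \<gamma>)) w (Dv (s k)) + U (Dv (B k)))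
      - (N w u (A (s k)) + P (Dv w) (A (s k)) + P u (A (B k)))) $ \<alpha>"
proof -
  let ?z = "\<lambda>k \<beta>. \<pi> (d (S \<beta> k 0))"
  have dv: "derivation od d (vv \<gamma> (Suc 0)) = d (V \<gamma> 0)" and ds: "derivation od d (sg \<beta> k r) = d (S \<beta> k r)"
    and df: "derivation od d (fn f) = d (Fn f)" for \<gamma> \<beta> k r f
    by (simp_all add: vv_def sg_def fn_def)
  have h: "homog 0 (fn f * vv \<gamma> r)" for f \<gamma> r by (auto intro: homog_mult0)
  have "\<pi> (derivation od d (recursion_rel M \<alpha> k)) =
    (\<Sum>\<beta>\<in>UNIV. sc (et \<alpha> \<beta>) * D (?z (Suc k) \<beta>))
    - ((\<Sum>\<beta>\<in>UNIV. \<Sum>\<epsilon>\<in>UNIV. F (pd \<epsilon> (gmet M \<alpha> \<beta>)) * (w $ \<epsilon> * \<pi> (sg \<beta> k 1)))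
       + (\<Sum>\<beta>\<in>UNIV. F (gmet M \<alpha> \<beta>) * D (?z k \<beta>))
       + ((\<Sum>\<beta>\<in>UNIV. \<Sum>\<gamma>\<in>UNIV. \<Sum>\<epsilon>\<in>UNIV. F (pd \<epsilon> (Gam M \<alpha> \<beta> \<gamma>)) * (w $ \<epsilon> * u $ \<gamma> * \<pi> (sg \<beta> k 0)))
       + (\<Sum>\<beta>\<in>UNIV. \<Sum>\<gamma>\<in>UNIV. F (Gam M \<alpha> \<beta> \<gamma>) * (Dv w $ \<gamma> * \<pi> (sg \<beta> k 0)))
       + (\<Sum>\<beta>\<in>UNIV. \<Sum>\<gamma>\<in>UNIV. F (Gam M \<alpha> \<beta> \<gamma>) * (u $ \<gamma> * ?z k \<beta>))))"
    using S by (simp add: recursion_rel_def derivation_diff derivation_add derivation_sum derivation_cst_mult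
        derivation_even_mult h dv ds df \<pi>_simps fn V sum.distrib sum_distrib_right distrib_right distrib_left
        mult.assoc u_def Dv_def flip: sc_def F_def)
  also have "\<dots> = (Dv (B (Suc k)) - (L2 (\<lambda>\<alpha> \<beta> \<gamma>. pd \<beta> (Um \<alpha> \<gamma>)) w (Dv (s k)) + U (Dv (B k)))
      - (N w u (A (s k)) + P (Dv w) (A (s k)) + P u (A (B k)))) $ \<alpha>"
    unfolding sum_gmet sum_pd_gmet sum_Gam sum_pd_Gam raised_D Dv_s[symmetric] s_def[symmetric] B[symmetric]
    by (simp add: Dv_def B raised_def D_sum D_sc)
  finally show ?thesis .
qed

lemma recursion: "Dv (s (Suc k)) = U (Dv (s k)) + P u (A (s k))"
proof -
  have "\<pi> (recursion_rel M \<alpha> k) = (Dv (s (Suc k)) - U (Dv (s k)) - P u (A (s k))) $ \<alpha>" for \<alpha>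
  proof -
    have "\<pi> (recursion_rel M \<alpha> k) = (\<Sum>\<beta>\<in>UNIV. sc (et \<alpha> \<beta>) * \<pi> (sg \<beta> (Suc k) 1))
      - ((\<Sum>\<beta>\<in>UNIV. F (gmet M \<alpha> \<beta>) * \<pi> (sg \<beta> k 1))
      + (\<Sum>\<beta>\<in>UNIV. \<Sum>\<gamma>\<in>UNIV. F (Gam M \<alpha> \<beta> \<gamma>) * (u $ \<gamma> * \<pi> (sg \<beta> k 0))))"
      by (simp add: recursion_rel_def \<pi>_simps sc_def F_def u_def mult.assoc)
    also have "\<dots> = (\<Sum>\<beta>\<in>UNIV. sc (et \<alpha> \<beta>) * \<pi> (sg \<beta> (Suc k) 1)) - (U (Dv (s k)) $ \<alpha> + P u (A (s k)) $ \<alpha>)"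
      unfolding sum_gmet sum_Gam Dv_s by (simp add: s_def)
    finally show ?thesis
      by (simp add: Dv_s[of "Suc k"] raised_def)
  qed
  moreover have "\<pi> (recursion_rel M \<alpha> k) = 0" for \<alpha>
    unfolding \<pi>_eq_0_iff by (rule relations.recursion)
  ultimately have "Dv (s (Suc k)) - U (Dv (s k)) - P u (A (s k)) = 0"
    by (simp add: vec_eq_iff)
  then show ?thesis by (simp add: algebra_simps)
qed

text \<open>Subtract the flow of the relation from the x-derivative of \<open>B_Suc\<close>. The
  terms in N, in U and in A cancel in pairs, and the rest is \<open>A_dual\<close> applied to both
  sides of \<open>uB\<close>.\<close>

lemma compatible_flow:
  assumes fn: "\<And>f. hol f \<Longrightarrow> \<pi> (d (Fn f)) = (\<Sum>\<alpha>\<in>UNIV. F (pd \<alpha> f) * w $ \<alpha>)"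
    and V: "\<And>\<gamma>. \<pi> (d (V \<gamma> 0)) = D (w $ \<gamma>)"
    and S: "\<And>\<beta> k. \<pi> (d (S \<beta> k 1)) = D (\<pi> (d (S \<beta> k 0)))"
    and B: "\<And>k. B k = raised (\<lambda>\<beta>. \<pi> (d (S \<beta> k 0)))"
    and B_Suc: "\<And>k. B (Suc k) = U (B k) + P w (A (s k))"
    and uB: "\<And>k. P u (B k) = P w (Dv (s k))"
  shows "\<pi> (derivation od d (recursion_rel M \<alpha> k)) = 0"
proof -
  \<comment> \<open>The components of \<open>u\<close> are central, so the exchange costs no sign
    even if \<open>w\<close> is odd.\<close>
  have "N u w (A (s k)) = N w u (A (s k))"
    using u_central by (intro N_commute) simp
  then have "Dv (B (Suc k)) = (P u (A (B k)) + A_dual (P u (B k)) + U (Dv (B k)))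
      + (N w u (A (s k)) + P (Dv w) (A (s k)) + P w (A (Dv (s k))))"
    unfolding B_Suc by (simp add: vec_add Dv_L1 L2_dUm Dv_P Dv_A)
  moreover have "\<pi> (derivation od d (recursion_rel M \<alpha> k)) =
    (Dv (B (Suc k)) - (L2 (\<lambda>\<alpha> \<beta> \<gamma>. pd \<beta> (Um \<alpha> \<gamma>)) w (Dv (s k)) + U (Dv (B k)))
      - (N w u (A (s k)) + P (Dv w) (A (s k)) + P u (A (B k)))) $ \<alpha>"
    by (rule derivation_recursion[OF fn V S B])
  ultimately show ?thesis
    by (simp add: L2_dUm uB)
qed

end

section \<open>Flows and their commutators\<close>

context frobenius_ring
begin

section \<open>Degrees and constants in the quotient\<close>

definition degree :: "nat \<Rightarrow> 'r \<Rightarrow> bool" where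
  "degree p z \<longleftrightarrow> (\<exists>x. homog p x \<and> z = \<pi> x)"

lemma degree_\<pi> [intro]: "homog p x \<Longrightarrow> degree p (\<pi> x)"
  by (auto simp: degree_def)

lemma degree_sum:
  assumes "\<And>i. i \<in> I \<Longrightarrow> degree p (f i)"
  shows "degree p (\<Sum>i\<in>I. f i)"
proof -
  from assms obtain x where "\<forall>i\<in>I. homog p (x i) \<and> f i = \<pi> (x i)"
    unfolding degree_def by metis
  then have "homog p (\<Sum>i\<in>I. x i)" "(\<Sum>i\<in>I. f i) = \<pi> (\<Sum>i\<in>I. x i)"
    by (auto simp: \<pi>_sum)
  then show ?thesis by (auto simp: degree_def)
qed

lemma degree_sc: "degree p z \<Longrightarrow> degree p (sc c * z)"
  unfolding degree_def sc_def using homog_mult0[OF homog_cst] \<pi>_mult by metis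

lemma degree_D: "degree p z \<Longrightarrow> degree p (D z)"
  unfolding degree_def using homog_dx D_\<pi> by metis

lemma degree_raised: "(\<And>\<beta>. degree p (z \<beta>)) \<Longrightarrow> degree p (raised z $ \<alpha>)"
  by (simp add: raised_def degree_sum degree_sc)

lemma degree_s: "degree 1 (s k $ \<alpha>)"
  unfolding s_def by (intro degree_raised degree_\<pi> homog_sg)

lemma degree_Dv: "(\<And>\<alpha>. degree p (a $ \<alpha>)) \<Longrightarrow> degree p (Dv a $ \<alpha>)"
  by (simp add: Dv_def degree_D)

lemma degree_A: "(\<And>\<alpha>. degree p (a $ \<alpha>)) \<Longrightarrow> degree p (A a $ \<alpha>)"
  by (simp add: A_def degree_sc)

lemma degree_skew: "degree 1 z \<Longrightarrow> degree 1 w \<Longrightarrow> z * w = - (w * z)"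
  by (auto simp: degree_def dest: supercommute)

lemma degree_const: "0 < p \<Longrightarrow> degree p z \<Longrightarrow> D z = 0 \<Longrightarrow> z = 0"
  by (auto simp: degree_def dest: no_odd_constants_\<pi>)

lemma P_skew1: "(\<And>\<alpha>. degree 1 (a $ \<alpha>)) \<Longrightarrow> (\<And>\<alpha>. degree 1 (b $ \<alpha>)) \<Longrightarrow> P a b = - P b a"
  by (intro P_skew degree_skew)

lemma vec_double_eq_0: "a + a = 0 \<Longrightarrow> a = (0 :: 'r^'n)"
proof -
  assume a: "a + a = 0"
  have "a $ \<alpha> = 0" for \<alpha>
    by (rule double_eq_0) (metis a vector_add_component zero_index)
  then show ?thesis by (simp add: vec_eq_iff)
qed

lemma vec_triple_eq_0: "a + a + a = 0 \<Longrightarrow> a = (0 :: 'r^'n)"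
proof -
  assume a: "a + a + a = 0"
  have "a $ \<alpha> = 0" for \<alpha>
    by (rule triple_eq_0) (metis a vector_add_component zero_index)
  then show ?thesis by (simp add: vec_eq_iff)
qed

text \<open>Lowering the index with \<eta> undoes \<open>raised\<close>.\<close>

lemma raised_eq_0D:
  assumes "raised z = 0"
  shows "z \<beta> = 0"
proof -
  have "0 = (\<Sum>\<kappa>\<in>UNIV. sc (eta M $ \<beta> $ \<kappa>) * raised z $ \<kappa>)" using assms by simp
  also have "\<dots> = (\<Sum>\<kappa>\<in>UNIV. \<Sum>\<gamma>\<in>UNIV. sc (eta M $ \<beta> $ \<kappa> * et \<kappa> \<gamma>) * z \<gamma>)"
    by (simp add: raised_def sum_distrib_left sc_mult mult.assoc)
  also have "\<dots> = (\<Sum>\<gamma>\<in>UNIV. (\<Sum>\<kappa>\<in>UNIV. sc (eta M $ \<beta> $ \<kappa> * et \<kappa> \<gamma>)) * z \<gamma>)"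
    by (subst sum.swap) (simp add: sum_distrib_right)
  also have "\<dots> = (\<Sum>\<gamma>\<in>UNIV. sc ((eta M ** etainv M) $ \<beta> $ \<gamma>) * z \<gamma>)"
  proof -
    have "sc (\<Sum>i\<in>I. f i) = (\<Sum>i\<in>I. sc (f i))" for f :: "'n \<Rightarrow> complex" and I
      by (induction I rule: infinite_finite_induct) (auto simp: sc_add)
    then show ?thesis by (simp add: matrix_matrix_mult_def)
  qed
  also have "\<dots> = z \<beta>"
    by (simp add: eta_etainv mat_def if_distrib[of sc] if_distrib[of "\<lambda>c. c * _"] cong: if_cong)
  finally show ?thesis by simp
qed

text \<open>Constants are also function symbols, which are compared on the chart only. An identity
  whose proof uses a point of the chart thus holds for the scalars in every case; over an empty
  chart all of them coincide.\<close>

lemma sc_cong: "(\<And>x. x \<in> chart M \<Longrightarrow> c = c') \<Longrightarrow> sc c = sc c'"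
  using F_cong[of "\<lambda>_. c" "\<lambda>_. c'"] by (simp add: F_const)

lemma sc_etainv_sym: "sc (et \<alpha> \<beta>) = sc (et \<beta> \<alpha>)"
  using etainv_sym by (intro sc_cong) auto

text \<open>\<open>e\<close> is the degree by which the flow raises, and its parity decides which
  Leibniz rule applies.\<close>

definition is_flow :: "nat \<Rightarrow> ('n \<Rightarrow> 'n alg) \<Rightarrow> ('n \<Rightarrow> nat \<Rightarrow> 'n alg) \<Rightarrow> bool" where
  "is_flow e a b \<longleftrightarrow> (\<forall>\<alpha>. homog e (a \<alpha>)) \<and> (\<forall>\<alpha> k. homog (1 + e) (b \<alpha> k)) \<and> preserves (odd e) (flow_gen M a b)"

lemma is_flowI:
  assumes h: "\<And>\<alpha>. homog e (a \<alpha>)" "\<And>\<alpha> k. homog (1 + e) (b \<alpha> k)"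
    and w: "w = (\<chi> \<alpha>. \<pi> (a \<alpha>))" and B: "\<And>k. B k = raised (\<lambda>\<beta>. \<pi> (b \<beta> k))"
    and B_Suc: "\<And>k. B (Suc k) = U (B k) + P w (A (s k))"
    and uB: "\<And>k. P u (B k) = P w (Dv (s k))"
  shows "is_flow e a b"
proof -
  have fn: "\<pi> (flow_gen M a b (Fn f)) = (\<Sum>\<alpha>\<in>UNIV. F (pd \<alpha> f) * w $ \<alpha>)" if "hol f" for f
    unfolding flow_gen_fn w using that by simp
  have "preserves (odd e) (flow_gen M a b)"
  proof (rule preservesI[where w = "\<lambda>\<alpha>. w $ \<alpha>"])
    show "homog (gdeg g + e) (flow_gen M a b g)" for g
      by (rule flow_gen_homog[OF h])
    show "\<pi> (derivation (odd e) (flow_gen M a b) (dx M x)) = \<pi> (dx M (derivation (odd e) (flow_gen M a b) x))" for x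
      by (rule flow_commutes_dx[OF flow_gen_homog[OF h] refl])
    show "\<pi> (derivation (odd e) (flow_gen M a b) (recursion_rel M \<alpha> k)) = 0" for \<alpha> k
      by (rule compatible_flow[where w = w and B = B, OF fn _ _ _ B_Suc uB])
        (simp_all add: w B D_\<pi>)
    show "\<pi> (flow_gen M a b (Fn f)) = 0" if "\<not> hol f" for f
      unfolding flow_gen_fn using that by simp
  qed (fact fn refl)+
  with h show ?thesis by (simp add: is_flow_def)
qed

context
  fixes e a b
  assumes fl: "is_flow e a b"
begin

abbreviation (input) "dd \<equiv> flow_gen M a b"

lemma flow_preserves: "preserves (odd e) dd"
  and flow_homog: "homog (gdeg g + e) (dd g)"
  using fl by (auto simp: is_flow_def intro: flow_gen_homog)

lemma flow_graded: "graded (odd e) dd"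
  by (rule gradedI[OF flow_homog refl])

lemma push_flow_D: "push (odd e) dd (D z) = D (push (odd e) dd z)"
proof -
  obtain x where "z = \<pi> x" using \<pi>_surj by metis
  then show ?thesis
    using flow_commutes_dx[OF flow_homog refl] by (simp add: D_\<pi> push_\<pi>[OF flow_preserves])
qed

lemma vec_push_flow_Dv: "vec_push (odd e) dd (Dv z) = Dv (vec_push (odd e) dd z)"
  by (simp add: vec_eq_iff vec_push_def Dv_def push_flow_D)

lemma vec_push_flow_raised: "vec_push (odd e) dd (raised z) = raised (\<lambda>\<beta>. push (odd e) dd (z \<beta>))"
  by (simp add: vec_eq_iff vec_push_def raised_def push_sum[OF flow_preserves] push_sc[OF flow_preserves])

lemma vec_push_flow_s: "vec_push (odd e) dd (s k) = raised (\<lambda>\<beta>. \<pi> (b \<beta> k))"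
  unfolding s_def vec_push_flow_raised by (simp add: push_\<pi>[OF flow_preserves] sg_def)

lemma vec_push_flow_L1:
  "(\<And>\<alpha> \<beta>. hol (T \<alpha> \<beta>)) \<Longrightarrow> vec_push (odd e) dd (L1 T z) =
    L2 (\<lambda>\<alpha> \<beta> \<gamma>. pd \<beta> (T \<alpha> \<gamma>)) (\<chi> \<alpha>. \<pi> (a \<alpha>)) z + L1 T (vec_push (odd e) dd z)"
  by (rule vec_push_L1[OF flow_preserves]) (simp_all add: flow_gen_fn del: flow_gen.simps)

lemma push_flow_F: "hol f \<Longrightarrow> push (odd e) dd (F f) = (\<Sum>\<alpha>\<in>UNIV. F (pd \<alpha> f) * \<pi> (a \<alpha>))"
  unfolding F_def push_\<pi>[OF flow_preserves]
  by (simp add: fn_def flow_gen_fn F_def del: flow_gen.simps)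

end

lemma D_diff: "D (z - w) = D z - D w"
  using D_add[of z "- w"] by (simp add: D_minus)

text \<open>Only in the quotient is the first jet variable the x-derivative of a function symbol.
  Through it \<open>comm_V\<close> reduces the jets of v to functions.\<close>

lemma D_coord: "D (F (\<lambda>x. x $ \<gamma>)) = \<pi> (gn (V \<gamma> 0))"
proof -
  have "pd \<alpha> (\<lambda>x::complex^'n. x $ \<gamma>) = (\<lambda>_. if \<alpha> = \<gamma> then 1 else 0)" for \<alpha>
    by (rule ext) simp
  then have "D (F (\<lambda>x. x $ \<gamma>)) = \<pi> (vv \<gamma> 1)"
    by (simp add: D_F F_const if_distrib[of sc] if_distrib[of "\<lambda>c. c * _"] cong: if_cong)
  then show ?thesis by (simp add: vv_def)
qed

context
  fixes e1 a1 b1 e2 a2 b2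
  assumes fl1: "is_flow e1 a1 b1" and fl2: "is_flow e2 a2 b2"
    and values_commute: "\<And>\<alpha>. push (odd e1) (flow_gen M a1 b1) (\<pi> (a2 \<alpha>)) =
      (if odd e1 \<and> odd e2 then - push (odd e2) (flow_gen M a2 b2) (\<pi> (a1 \<alpha>))
       else push (odd e2) (flow_gen M a2 b2) (\<pi> (a1 \<alpha>)))"
begin

abbreviation (input) "p1 \<equiv> push (odd e1) (flow_gen M a1 b1)"
abbreviation (input) "p2 \<equiv> push (odd e2) (flow_gen M a2 b2)"
abbreviation (input) "comm \<equiv> scomm (odd e1) (flow_gen M a1 b1) (odd e2) (flow_gen M a2 b2)"

section \<open>The graded commutator of two flows\<close>

lemma \<pi>_comm: "\<pi> (comm x) = p1 (p2 (\<pi> x)) - (if odd e1 \<and> odd e2 then - p2 (p1 (\<pi> x)) else p2 (p1 (\<pi> x)))"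
  unfolding scomm_def push_\<pi>[OF flow_preserves[OF fl1]] push_\<pi>[OF flow_preserves[OF fl2]] \<pi>_diff
    if_distrib[of \<pi>] \<pi>_minus ..

lemma comm_vanishes:
  assumes "\<pi> x = 0"
  shows "\<pi> (comm x) = 0"
  unfolding \<pi>_comm assms push_0[OF flow_preserves[OF fl1]] push_0[OF flow_preserves[OF fl2]] by simp

lemma comm_dx: "\<pi> (comm (dx M x)) = D (\<pi> (comm x))"
  unfolding \<pi>_comm D_\<pi>[symmetric] push_flow_D[OF fl1] push_flow_D[OF fl2] D_diff if_distrib[of D] D_minus ..

lemma comm_derivation: "derivation (odd e1 \<noteq> odd e2) (\<lambda>g. comm (gn g)) x = comm x"
  by (rule scomm_derivation[OF flow_graded[OF fl1] flow_graded[OF fl2], symmetric])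

lemma comm_homog: "homog (gdeg g + (e1 + e2)) (comm (gn g))"
proof -
  have "homog (gdeg g + e1 + e2) (derivation (odd e2) (flow_gen M a2 b2) (derivation (odd e1) (flow_gen M a1 b1) (gn g)))"
    by (intro homog_derivation flow_homog[OF fl1] flow_homog[OF fl2] homog_gn)
  moreover have "homog (gdeg g + e2 + e1) (derivation (odd e1) (flow_gen M a1 b1) (derivation (odd e2) (flow_gen M a2 b2) (gn g)))"
    by (intro homog_derivation flow_homog[OF fl1] flow_homog[OF fl2] homog_gn)
  ultimately show ?thesis
    unfolding scomm_def by (auto simp: algebra_simps)
qed

text \<open>Each order of the flows yields a term with second derivatives of f and a term in which
  one flow acts on the values of the other. The former agree up to the sign because partial
  derivatives commute and the values supercommute, the latter by
  \<open>values_commute\<close>.\<close>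

lemma comm_fn: "\<pi> (comm (fn f)) = 0"
proof (cases "hol f")
  case False
  then show ?thesis
    using F_not_hol by (intro comm_vanishes) (simp add: F_def)
next
  case True
  then have h: "hol (pd \<alpha> f)" for \<alpha> using open_chart by simp
  let ?w1 = "\<lambda>\<alpha>. \<pi> (a1 \<alpha>)" and ?w2 = "\<lambda>\<alpha>. \<pi> (a2 \<alpha>)"
  have 1: "p1 (F (pd \<alpha> f) * z) = (\<Sum>\<beta>\<in>UNIV. F (pd \<beta> (pd \<alpha> f)) * ?w1 \<beta>) * z + F (pd \<alpha> f) * p1 z" for \<alpha> z
    unfolding push_F[OF flow_preserves[OF fl1]] flow_gen_fn using h by simp
  have 2: "p2 (F (pd \<alpha> f) * z) = (\<Sum>\<beta>\<in>UNIV. F (pd \<beta> (pd \<alpha> f)) * ?w2 \<beta>) * z + F (pd \<alpha> f) * p2 z" for \<alpha> z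
    unfolding push_F[OF flow_preserves[OF fl2]] flow_gen_fn using h by simp
  have sw: "?w1 \<beta> * ?w2 \<alpha> = (if odd e1 \<and> odd e2 then - (?w2 \<alpha> * ?w1 \<beta>) else ?w2 \<alpha> * ?w1 \<beta>)" for \<alpha> \<beta>
    using fl1 fl2 by (intro supercommute) (auto simp: is_flow_def)
  let ?X = "\<Sum>\<alpha>\<in>UNIV. \<Sum>\<beta>\<in>UNIV. F (pd \<beta> (pd \<alpha> f)) * (?w1 \<beta> * ?w2 \<alpha>)"
  let ?Y = "\<Sum>\<alpha>\<in>UNIV. \<Sum>\<beta>\<in>UNIV. F (pd \<beta> (pd \<alpha> f)) * (?w2 \<beta> * ?w1 \<alpha>)"
  have XY: "?X = (if odd e1 \<and> odd e2 then - ?Y else ?Y)"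
  proof -
    have "?X = (\<Sum>\<alpha>\<in>UNIV. \<Sum>\<beta>\<in>UNIV. F (pd \<alpha> (pd \<beta> f)) * (?w1 \<beta> * ?w2 \<alpha>))"
      by (simp add: F_pd_commute[OF True])
    also have "\<dots> = (\<Sum>\<beta>\<in>UNIV. \<Sum>\<alpha>\<in>UNIV. F (pd \<alpha> (pd \<beta> f)) * (?w1 \<beta> * ?w2 \<alpha>))"
      by (rule sum.swap)
    also have "\<dots> = (if odd e1 \<and> odd e2 then - ?Y else ?Y)"
      by (auto simp: sw sum_negf)
    finally show ?thesis .
  qed
  have "p1 (p2 (\<pi> (fn f))) = ?X + (\<Sum>\<alpha>\<in>UNIV. F (pd \<alpha> f) * p1 (?w2 \<alpha>))"
    using push_flow_F[OF fl2 True]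
    by (simp add: F_def[of f, symmetric] push_sum[OF flow_preserves[OF fl1]] 1 sum.distrib sum_distrib_right mult.assoc)
  moreover have "p2 (p1 (\<pi> (fn f))) = ?Y + (\<Sum>\<alpha>\<in>UNIV. F (pd \<alpha> f) * p2 (?w1 \<alpha>))"
    using push_flow_F[OF fl1 True]
    by (simp add: F_def[of f, symmetric] push_sum[OF flow_preserves[OF fl2]] 2 sum.distrib sum_distrib_right mult.assoc)
  ultimately show ?thesis
    unfolding \<pi>_comm XY values_commute by (auto simp: sum_negf)
qed

lemma comm_V: "\<pi> (comm (gn (V \<gamma> r))) = 0"
proof (induction r)
  case 0
  have "\<pi> (comm (gn (V \<gamma> 0))) = \<pi> (comm (dx M (fn (\<lambda>x. x $ \<gamma>))))"
    unfolding \<pi>_comm D_\<pi>[symmetric] F_def[symmetric] D_coord ..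
  then show ?case by (simp add: comm_dx comm_fn)
next
  case (Suc r)
  have "gn (V \<gamma> (Suc r)) = dx M (gn (V \<gamma> r))" by (simp add: dx_def)
  then show ?case using Suc by (simp add: comm_dx)
qed

definition sigma_comm :: "nat \<Rightarrow> 'r^'n" where "sigma_comm k = raised (\<lambda>\<beta>. \<pi> (comm (sg \<beta> k 0)))"

lemma sigma_comm_eq: "sigma_comm k = vec_push (odd e1) (flow_gen M a1 b1) (raised (\<lambda>\<beta>. \<pi> (b2 \<beta> k)))
    - (if odd e1 \<and> odd e2 then - vec_push (odd e2) (flow_gen M a2 b2) (raised (\<lambda>\<beta>. \<pi> (b1 \<beta> k)))
       else vec_push (odd e2) (flow_gen M a2 b2) (raised (\<lambda>\<beta>. \<pi> (b1 \<beta> k))))"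
proof -
  have "p1 (\<pi> (sg \<beta> k 0)) = \<pi> (b1 \<beta> k)" "p2 (\<pi> (sg \<beta> k 0)) = \<pi> (b2 \<beta> k)" for \<beta>
    unfolding push_\<pi>[OF flow_preserves[OF fl1]] push_\<pi>[OF flow_preserves[OF fl2]] by (simp_all add: sg_def)
  then show ?thesis
    unfolding sigma_comm_def \<pi>_comm vec_push_flow_raised[OF fl1] vec_push_flow_raised[OF fl2]
    by (auto simp: vec_eq_iff raised_def distrib_left right_diff_distrib sum.distrib sum_subtractf sum_negf)
qed

lemma sigma_comm_recursion: "Dv (sigma_comm (Suc k)) = U (Dv (sigma_comm k)) + P u (A (sigma_comm k))"
proof -
  have S: "\<pi> (comm (gn (S \<beta> k 1))) = D (\<pi> (comm (gn (S \<beta> k 0))))" for \<beta> k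
    using comm_dx[of "gn (S \<beta> k 0)"] by (simp add: dx_def)
  have "\<pi> (derivation (odd e1 \<noteq> odd e2) (\<lambda>g. comm (gn g)) (recursion_rel M \<alpha> k)) =
    (Dv (sigma_comm (Suc k)) - (L2 (\<lambda>\<alpha> \<beta> \<gamma>. pd \<beta> (Um \<alpha> \<gamma>)) 0 (Dv (s k)) + U (Dv (sigma_comm k)))
      - (N 0 u (A (s k)) + P (Dv 0) (A (s k)) + P u (A (sigma_comm k)))) $ \<alpha>" for \<alpha>
  proof (rule derivation_recursion)
    show "sigma_comm k = raised (\<lambda>\<beta>. \<pi> (comm (gn (S \<beta> k 0))))" for k
      by (simp add: sigma_comm_def sg_def)
    show "\<pi> (comm (gn (Fn f))) = (\<Sum>\<alpha>\<in>UNIV. F (pd \<alpha> f) * 0 $ \<alpha>)" for f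
      using comm_fn[of f] by (simp add: fn_def)
  qed (use S comm_V in simp_all)
  moreover have "\<pi> (comm (recursion_rel M \<alpha> k)) = 0" for \<alpha>
    by (intro comm_vanishes) (simp add: \<pi>_eq_0_iff relations.recursion)
  moreover have "N 0 u (A (s k)) = 0" by (simp add: L3_def vec_eq_iff)
  ultimately have "Dv (sigma_comm (Suc k)) - U (Dv (sigma_comm k)) - P u (A (sigma_comm k)) = 0"
    unfolding comm_derivation by (simp add: vec_zero vec_eq_iff[of _ 0] diff_diff_eq)
  then show ?thesis by (simp add: algebra_simps)
qed

lemma sigma_comm_vanishes_upwards: "sigma_comm k = 0 \<Longrightarrow> k \<le> l \<Longrightarrow> sigma_comm l = 0"
proof (induction l)
  case (Suc l)
  show ?case
  proof (cases "k = Suc l")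
    case False
    then have "Dv (sigma_comm (Suc l)) = 0" using Suc by (simp add: sigma_comm_recursion vec_zero)
    moreover have "degree (Suc (e1 + e2)) (sigma_comm (Suc l) $ \<alpha>)" for \<alpha>
    proof -
      have "homog (Suc (e1 + e2)) (comm (sg \<beta> (Suc l) 0))" for \<beta>
        using comm_homog[of "S \<beta> (Suc l) 0"] by (simp add: gdeg_def sg_def)
      then show ?thesis unfolding sigma_comm_def by (intro degree_raised) auto
    qed
    ultimately show ?thesis
      using degree_const[of "Suc (e1 + e2)"] by (simp add: vec_eq_iff Dv_def)
  qed (use Suc in simp)
qed simp

lemma comm_eq_0:
  assumes "\<And>k. sigma_comm k = 0"
  shows "\<pi> (comm x) = 0"
proof -
  have S: "\<pi> (comm (gn (S \<beta> k r))) = 0" for \<beta> k r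
  proof (induction r)
    case 0
    show ?case using raised_eq_0D[OF assms[of k, unfolded sigma_comm_def]] by (simp add: sg_def)
  next
    case (Suc r)
    have "gn (S \<beta> k (Suc r)) = dx M (gn (S \<beta> k r))" by (simp add: dx_def)
    then show ?case using Suc by (simp add: comm_dx)
  qed
  have "\<pi> (comm (gn g)) = 0" for g
    using S comm_V comm_fn by (cases g) (simp_all add: fn_def)
  then show ?thesis
    using \<pi>_derivation_eq_0[of "\<lambda>g. comm (gn g)" "odd e1 \<noteq> odd e2" x] unfolding comm_derivation by blast
qed

end

end

section \<open>The even and the odd flows\<close>

locale calibrated_ring = frobenius_ring M \<pi>
  for M :: "('n::finite) frob" and \<pi> :: "'n alg \<Rightarrow> 'r::{ring,monoid_mult}" +
  assumes calib: "calibration M"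
begin

section \<open>The even flows\<close>

lemma hol_ham [simp, intro]: "hol (ham M \<alpha> p)"
  using calib by (simp add: calibration_def)

lemma pd_pd_ham: "x \<in> chart M \<Longrightarrow>
    pd \<alpha> (pd \<beta> (ham M \<gamma> (Suc p))) x = (\<Sum>\<kappa>\<in>UNIV. C \<kappa> \<alpha> \<beta> x * pd \<kappa> (ham M \<gamma> p) x)"
  using calib by (simp add: calibration_def cmul_C)

lemma hol_pd [simp, intro]: "hol f \<Longrightarrow> hol (pd \<alpha> f)"
  using open_chart by simp

definition grad :: "'n \<Rightarrow> nat \<Rightarrow> 'n \<Rightarrow> complex^'n \<Rightarrow> complex" where
  "grad \<beta> p \<alpha> x = (\<Sum>\<gamma>\<in>UNIV. et \<alpha> \<gamma> * pd \<gamma> (ham M \<beta> p) x)"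

text \<open>The index is shifted: this is the Hessian of the function with index p + 1, with one
  index raised, so that it is the product with the gradient of index p.\<close>

definition Hess :: "'n \<Rightarrow> nat \<Rightarrow> 'n \<Rightarrow> 'n \<Rightarrow> complex^'n \<Rightarrow> complex" where
  "Hess \<beta> p \<alpha> \<kappa> x = (\<Sum>\<gamma>\<in>UNIV. et \<alpha> \<gamma> * pd \<kappa> (pd \<gamma> (ham M \<beta> (Suc p))) x)"

lemma hol_grad [simp, intro]: "hol (grad \<beta> p \<alpha>)"
  unfolding grad_def by auto

lemma hol_Hess [simp, intro]: "hol (Hess \<beta> p \<alpha> \<kappa>)"
  unfolding Hess_def by auto

lemma pd_grad: "x \<in> chart M \<Longrightarrow> pd \<kappa> (grad \<beta> (Suc p) \<alpha>) x = Hess \<beta> p \<alpha> \<kappa> x"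
  unfolding grad_def Hess_def by (simp add: pd_sum[of _ "chart M"] pd_cmult[of "chart M"])

lemma pd_Hess: "x \<in> chart M \<Longrightarrow> pd \<delta> (Hess \<beta> p \<alpha> \<kappa>) x = pd \<kappa> (Hess \<beta> p \<alpha> \<delta>) x"
proof -
  assume x: "x \<in> chart M"
  have "pd \<delta> (Hess \<beta> p \<alpha> \<kappa>) x = pd \<delta> (pd \<kappa> (grad \<beta> (Suc p) \<alpha>)) x"
    using pd_grad by (intro pd_cong[OF open_chart x]) simp
  also have "\<dots> = pd \<kappa> (pd \<delta> (grad \<beta> (Suc p) \<alpha>)) x"
    by (rule pd_commute[OF open_chart hol_grad x])
  also have "\<dots> = pd \<kappa> (Hess \<beta> p \<alpha> \<delta>) x"
    using pd_grad by (intro pd_cong[OF open_chart x]) simp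
  finally show ?thesis .
qed

lemma Hess_C:
  assumes x: "x \<in> chart M"
  shows "Hess \<beta> p \<alpha> \<kappa> x = (\<Sum>\<epsilon>\<in>UNIV. grad \<beta> p \<epsilon> x * C \<alpha> \<epsilon> \<kappa> x)"
proof -
  have c: "c3 \<nu> \<kappa> \<gamma> x = c3 \<gamma> \<nu> \<kappa> x" for \<nu> \<gamma>
    using c3_sym23[OF x, of \<nu> \<kappa> \<gamma>] c3_sym12[OF x, of \<nu> \<gamma> \<kappa>] by simp
  have "Hess \<beta> p \<alpha> \<kappa> x = (\<Sum>\<gamma>\<in>UNIV. \<Sum>\<rho>\<in>UNIV. \<Sum>\<nu>\<in>UNIV.
      et \<nu> \<rho> * pd \<rho> (ham M \<beta> p) x * (et \<alpha> \<gamma> * c3 \<gamma> \<nu> \<kappa> x))"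
    unfolding Hess_def pd_pd_ham[OF x] C_def c
    by (simp add: sum_distrib_left sum_distrib_right etainv_sym[OF x, of _ "_ :: 'n"] mult_ac)
  also have "\<dots> = (\<Sum>\<gamma>\<in>UNIV. \<Sum>\<nu>\<in>UNIV. \<Sum>\<rho>\<in>UNIV.
      et \<nu> \<rho> * pd \<rho> (ham M \<beta> p) x * (et \<alpha> \<gamma> * c3 \<gamma> \<nu> \<kappa> x))"
    by (rule sum.cong[OF refl], rule sum.swap)
  also have "\<dots> = (\<Sum>\<nu>\<in>UNIV. \<Sum>\<gamma>\<in>UNIV. \<Sum>\<rho>\<in>UNIV.
      et \<nu> \<rho> * pd \<rho> (ham M \<beta> p) x * (et \<alpha> \<gamma> * c3 \<gamma> \<nu> \<kappa> x))"
    by (rule sum.swap)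
  also have "\<dots> = (\<Sum>\<epsilon>\<in>UNIV. grad \<beta> p \<epsilon> x * C \<alpha> \<epsilon> \<kappa> x)"
    unfolding grad_def C_def sum_product by (rule sum.cong[OF refl], rule sum.swap)
  finally show ?thesis .
qed

abbreviation "H \<beta> p \<equiv> L1 (Hess \<beta> p)"

lemma H_Fv: "H \<beta> p a = P (Fv (grad \<beta> p)) a"
  by (rule L1_Fv) (auto simp: Hess_C)

lemma F_Hess: "F (Hess \<beta> p \<alpha> \<kappa>) = (\<Sum>\<gamma>\<in>UNIV. sc (et \<alpha> \<gamma>) * F (pd \<kappa> (pd \<gamma> (ham M \<beta> (Suc p)))))"
  by (rule F_lincomb(1)) (auto simp: Hess_def)

definition a_t :: "'n \<Rightarrow> nat \<Rightarrow> 'n \<Rightarrow> 'n alg" where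
  "a_t \<beta> p \<alpha> = (\<Sum>\<gamma>\<in>UNIV. \<Sum>\<kappa>\<in>UNIV.
        cst (et \<alpha> \<gamma>) * fn (pd \<kappa> (pd \<gamma> (ham M \<beta> (Suc p)))) * vv \<kappa> 1)"

definition b_t :: "'n \<Rightarrow> nat \<Rightarrow> 'n \<Rightarrow> nat \<Rightarrow> 'n alg" where
  "b_t \<beta> p \<alpha> k = (\<Sum>\<gamma>\<in>UNIV. \<Sum>\<epsilon>\<in>UNIV.
        cst (et \<gamma> \<epsilon>) * fn (pd \<alpha> (pd \<epsilon> (ham M \<beta> (Suc p)))) * sg \<gamma> k 1)"

lemma flow_t_eq: "flow_t M \<beta> p = derivation False (flow_gen M (a_t \<beta> p) (b_t \<beta> p))"
  by (simp add: flow_t_def flow_def a_t_def[abs_def] b_t_def[abs_def])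

lemma \<pi>_a_t: "(\<chi> \<alpha>. \<pi> (a_t \<beta> p \<alpha>)) = H \<beta> p u"
proof -
  have "\<pi> (a_t \<beta> p \<alpha>) = (\<Sum>\<kappa>\<in>UNIV. \<Sum>\<gamma>\<in>UNIV. sc (et \<alpha> \<gamma>) * F (pd \<kappa> (pd \<gamma> (ham M \<beta> (Suc p)))) * u $ \<kappa>)" for \<alpha>
    unfolding a_t_def by (subst sum.swap) (simp add: \<pi>_simps sc_def F_def u_def)
  then show ?thesis
    by (simp add: vec_eq_iff L1_def F_Hess sum_distrib_right)
qed

lemma raised_b_t: "raised (\<lambda>\<alpha>. \<pi> (b_t \<beta> p \<alpha> k)) = H \<beta> p (Dv (s k))"
proof -
  let ?h = "\<lambda>\<alpha> \<epsilon>. F (pd \<epsilon> (pd \<alpha> (ham M \<beta> (Suc p))))"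
  let ?f = "\<lambda>\<delta> \<alpha> \<gamma> \<epsilon>. sc (et \<delta> \<alpha>) * (?h \<alpha> \<epsilon> * (sc (et \<epsilon> \<gamma>) * \<pi> (sg \<gamma> k 1)))"
  have "raised (\<lambda>\<alpha>. \<pi> (b_t \<beta> p \<alpha> k)) $ \<delta> = (\<Sum>\<alpha>\<in>UNIV. \<Sum>\<gamma>\<in>UNIV. \<Sum>\<epsilon>\<in>UNIV. ?f \<delta> \<alpha> \<gamma> \<epsilon>)" for \<delta>
  proof -
    have "\<pi> (b_t \<beta> p \<alpha> k) = (\<Sum>\<gamma>\<in>UNIV. \<Sum>\<epsilon>\<in>UNIV. ?h \<alpha> \<epsilon> * (sc (et \<epsilon> \<gamma>) * \<pi> (sg \<gamma> k 1)))" for \<alpha>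
    proof -
      have "\<pi> (b_t \<beta> p \<alpha> k) = (\<Sum>\<gamma>\<in>UNIV. \<Sum>\<epsilon>\<in>UNIV.
          sc (et \<gamma> \<epsilon>) * F (pd \<alpha> (pd \<epsilon> (ham M \<beta> (Suc p)))) * \<pi> (sg \<gamma> k 1))"
        by (simp add: b_t_def \<pi>_simps sc_def F_def)
      also have "\<dots> = (\<Sum>\<gamma>\<in>UNIV. \<Sum>\<epsilon>\<in>UNIV. ?h \<alpha> \<epsilon> * (sc (et \<epsilon> \<gamma>) * \<pi> (sg \<gamma> k 1)))"
        by (intro sum.cong refl)
          (simp add: F_pd_commute[OF hol_ham] sc_left_commute[of "F _"] sc_etainv_sym mult.assoc)
      finally show ?thesis .
    qed
    then show ?thesis by (simp add: raised_def sum_distrib_left)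
  qed
  also have "(\<Sum>\<alpha>\<in>UNIV. \<Sum>\<gamma>\<in>UNIV. \<Sum>\<epsilon>\<in>UNIV. ?f \<delta> \<alpha> \<gamma> \<epsilon>) = (\<Sum>\<epsilon>\<in>UNIV. \<Sum>\<alpha>\<in>UNIV. \<Sum>\<gamma>\<in>UNIV. ?f \<delta> \<alpha> \<gamma> \<epsilon>)" for \<delta>
    by (rule trans[OF sum.cong[OF refl sum.swap] sum.swap])
  also have "\<dots> \<delta> = H \<beta> p (Dv (s k)) $ \<delta>" for \<delta>
    by (simp add: Dv_s L1_def raised_def F_Hess sum_product mult.assoc)
  finally show ?thesis by (simp add: vec_eq_iff)
qed

lemma H_U: "H \<beta> p (U a) = U (H \<beta> p a)"
  by (simp add: H_Fv U_P_right)

lemma H_P_left: "P (H \<beta> p a) b = H \<beta> p (P a b)"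
  by (simp add: H_Fv P_assoc)

lemma H_P_right: "P a (H \<beta> p b) = H \<beta> p (P a b)"
  by (simp add: H_Fv Fv_P_right)

lemma flow_t: "is_flow 0 (a_t \<beta> p) (b_t \<beta> p)"
proof (rule is_flowI[OF _ _ \<pi>_a_t[symmetric] raised_b_t[symmetric]])
  show "homog 0 (a_t \<beta> p \<alpha>)" "homog (1 + 0) (b_t \<beta> p \<alpha> k)" for \<alpha> k
    by (auto simp: a_t_def b_t_def intro!: homog_sum homog_mult0[OF homog_mult0])
  show "H \<beta> p (Dv (s (Suc k))) = U (H \<beta> p (Dv (s k))) + P (H \<beta> p u) (A (s k))" for k
    by (simp add: recursion vec_add H_U H_P_left)
  show "P u (H \<beta> p (Dv (s k))) = P (H \<beta> p u) (Dv (s k))" for k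
    by (simp add: H_P_left H_P_right)
qed

section \<open>The odd flows\<close>

definition a_tau :: "nat \<Rightarrow> 'n \<Rightarrow> 'n alg" where
  "a_tau m \<alpha> = (\<Sum>\<beta>\<in>UNIV. cst (et \<alpha> \<beta>) * sg \<beta> m 1)"

definition b_tau :: "nat \<Rightarrow> 'n \<Rightarrow> nat \<Rightarrow> 'n alg" where
  "b_tau m \<alpha> k = (if k \<le> m then tau_sum M \<alpha> k m else - tau_sum M \<alpha> m k)"

lemma flow_tau_eq: "flow_tau M m = derivation True (flow_gen M (a_tau m) (b_tau m))"
  by (simp add: flow_tau_def flow_def a_tau_def[abs_def] b_tau_def[abs_def])

lemma \<pi>_a_tau: "(\<chi> \<alpha>. \<pi> (a_tau m \<alpha>)) = Dv (s m)"
  by (simp add: Dv_s raised_def a_tau_def \<pi>_simps sc_def vec_eq_iff)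

lemma sum_etainv_Gam:
  assumes x: "x \<in> chart M"
  shows "(\<Sum>\<alpha>\<in>UNIV. et \<delta> \<alpha> * Gam M \<gamma> \<beta> \<alpha> x) =
    (\<Sum>\<kappa>\<in>UNIV. \<Sum>\<zeta>\<in>UNIV. (1/2 + mu M \<kappa>) * et \<kappa> \<beta> * et \<zeta> \<gamma> * C \<delta> \<kappa> \<zeta> x)"
proof -
  have c: "c3 \<zeta> \<alpha> \<kappa> x = c3 \<alpha> \<kappa> \<zeta> x" for \<alpha> \<kappa> \<zeta>
    using c3_sym12[OF x, of \<zeta> \<alpha> \<kappa>] c3_sym23[OF x, of \<alpha> \<zeta> \<kappa>] by simp
  have *: "(\<Sum>\<alpha>\<in>UNIV. et \<delta> \<alpha> * C \<gamma> \<alpha> \<kappa> x) = (\<Sum>\<zeta>\<in>UNIV. et \<zeta> \<gamma> * C \<delta> \<kappa> \<zeta> x)" for \<kappa>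
  proof -
    have "(\<Sum>\<alpha>\<in>UNIV. et \<delta> \<alpha> * C \<gamma> \<alpha> \<kappa> x) = (\<Sum>\<alpha>\<in>UNIV. \<Sum>\<zeta>\<in>UNIV. et \<zeta> \<gamma> * (et \<delta> \<alpha> * c3 \<alpha> \<kappa> \<zeta> x))"
      unfolding C_def c by (simp add: sum_distrib_left etainv_sym[OF x, of \<gamma>] mult_ac)
    also have "\<dots> = (\<Sum>\<zeta>\<in>UNIV. et \<zeta> \<gamma> * C \<delta> \<kappa> \<zeta> x)"
      unfolding C_def by (subst sum.swap) (simp add: sum_distrib_left)
    finally show ?thesis .
  qed
  have "(\<Sum>\<alpha>\<in>UNIV. et \<delta> \<alpha> * Gam M \<gamma> \<beta> \<alpha> x) =
      (\<Sum>\<kappa>\<in>UNIV. (1/2 + mu M \<kappa>) * et \<kappa> \<beta> * (\<Sum>\<alpha>\<in>UNIV. et \<delta> \<alpha> * C \<gamma> \<alpha> \<kappa> x))"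
    unfolding Gam_C[OF x] sum_distrib_left by (subst sum.swap) (simp add: mult_ac)
  then show ?thesis
    unfolding * by (simp add: sum_distrib_left mult.assoc)
qed

text \<open>Turns the quadratic expression of the odd flows into a Frobenius product. The factor y
  stays to the left of z throughout, since both will be odd.\<close>

lemma raised_Gam:
  "raised (\<lambda>\<alpha>. \<Sum>\<gamma>\<in>UNIV. \<Sum>\<beta>\<in>UNIV. F (Gam M \<gamma> \<beta> \<alpha>) * (y \<beta> * z \<gamma>)) = P (A (raised y)) (raised z)"
proof -
  let ?c = "\<lambda>\<kappa> \<beta>. (1/2 + mu M \<kappa>) * et \<kappa> \<beta>"
  let ?f = "\<lambda>\<delta> \<gamma> \<beta> \<kappa> \<zeta>. F (C \<delta> \<kappa> \<zeta>) * ((sc (?c \<kappa> \<beta>) * y \<beta>) * (sc (et \<zeta> \<gamma>) * z \<gamma>))"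
  have G: "(\<Sum>\<alpha>\<in>UNIV. sc (et \<delta> \<alpha>) * F (Gam M \<gamma> \<beta> \<alpha>)) =
      (\<Sum>\<kappa>\<in>UNIV. \<Sum>\<zeta>\<in>UNIV. sc (?c \<kappa> \<beta> * et \<zeta> \<gamma>) * F (C \<delta> \<kappa> \<zeta>))" for \<delta> \<gamma> \<beta>
  proof -
    have "(\<Sum>\<alpha>\<in>UNIV. sc (et \<delta> \<alpha>) * F (Gam M \<gamma> \<beta> \<alpha>)) = F (\<lambda>x. \<Sum>\<alpha>\<in>UNIV. et \<delta> \<alpha> * Gam M \<gamma> \<beta> \<alpha> x)"
      by (simp add: F_sum F_cmult)
    also have "\<dots> = F (\<lambda>x. \<Sum>\<kappa>\<in>UNIV. \<Sum>\<zeta>\<in>UNIV. ?c \<kappa> \<beta> * et \<zeta> \<gamma> * C \<delta> \<kappa> \<zeta> x)"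
      by (rule F_cong) (rule sum_etainv_Gam)
    also have "\<dots> = (\<Sum>\<kappa>\<in>UNIV. \<Sum>\<zeta>\<in>UNIV. sc (?c \<kappa> \<beta> * et \<zeta> \<gamma>) * F (C \<delta> \<kappa> \<zeta>))"
      by (simp add: F_sum F_cmult[OF hol_C])
    finally show ?thesis .
  qed
  have "raised (\<lambda>\<alpha>. \<Sum>\<gamma>\<in>UNIV. \<Sum>\<beta>\<in>UNIV. F (Gam M \<gamma> \<beta> \<alpha>) * (y \<beta> * z \<gamma>)) $ \<delta> =
      (\<Sum>\<gamma>\<in>UNIV. \<Sum>\<beta>\<in>UNIV. \<Sum>\<kappa>\<in>UNIV. \<Sum>\<zeta>\<in>UNIV. ?f \<delta> \<gamma> \<beta> \<kappa> \<zeta>)" for \<delta>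
  proof -
    have "raised (\<lambda>\<alpha>. \<Sum>\<gamma>\<in>UNIV. \<Sum>\<beta>\<in>UNIV. F (Gam M \<gamma> \<beta> \<alpha>) * (y \<beta> * z \<gamma>)) $ \<delta> =
        (\<Sum>\<alpha>\<in>UNIV. \<Sum>\<gamma>\<in>UNIV. \<Sum>\<beta>\<in>UNIV. sc (et \<delta> \<alpha>) * F (Gam M \<gamma> \<beta> \<alpha>) * (y \<beta> * z \<gamma>))"
      by (simp add: raised_def sum_distrib_left mult.assoc)
    also have "\<dots> = (\<Sum>\<gamma>\<in>UNIV. \<Sum>\<alpha>\<in>UNIV. \<Sum>\<beta>\<in>UNIV. sc (et \<delta> \<alpha>) * F (Gam M \<gamma> \<beta> \<alpha>) * (y \<beta> * z \<gamma>))"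
      by (rule sum.swap)
    also have "\<dots> = (\<Sum>\<gamma>\<in>UNIV. \<Sum>\<beta>\<in>UNIV. \<Sum>\<alpha>\<in>UNIV. sc (et \<delta> \<alpha>) * F (Gam M \<gamma> \<beta> \<alpha>) * (y \<beta> * z \<gamma>))"
      by (rule sum.cong[OF refl], rule sum.swap)
    also have "\<dots> = (\<Sum>\<gamma>\<in>UNIV. \<Sum>\<beta>\<in>UNIV. \<Sum>\<kappa>\<in>UNIV. \<Sum>\<zeta>\<in>UNIV. ?f \<delta> \<gamma> \<beta> \<kappa> \<zeta>)"
      unfolding sum_distrib_right[symmetric] G sc_mult_sc
      by (simp add: sum_distrib_right sc_left_commute[of "F _"] mult.assoc)
    finally show ?thesis .
  qed
  also have "\<dots> \<delta> = (\<Sum>\<gamma>\<in>UNIV. \<Sum>\<kappa>\<in>UNIV. \<Sum>\<beta>\<in>UNIV. \<Sum>\<zeta>\<in>UNIV. ?f \<delta> \<gamma> \<beta> \<kappa> \<zeta>)" for \<delta>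
    by (rule sum.cong[OF refl], rule sum.swap)
  also have "\<dots> \<delta> = (\<Sum>\<kappa>\<in>UNIV. \<Sum>\<gamma>\<in>UNIV. \<Sum>\<beta>\<in>UNIV. \<Sum>\<zeta>\<in>UNIV. ?f \<delta> \<gamma> \<beta> \<kappa> \<zeta>)" for \<delta>
    by (rule sum.swap)
  also have "\<dots> \<delta> = (\<Sum>\<kappa>\<in>UNIV. \<Sum>\<gamma>\<in>UNIV. \<Sum>\<zeta>\<in>UNIV. \<Sum>\<beta>\<in>UNIV. ?f \<delta> \<gamma> \<beta> \<kappa> \<zeta>)" for \<delta>
    by (rule sum.cong[OF refl], rule sum.cong[OF refl], rule sum.swap)
  also have "\<dots> \<delta> = (\<Sum>\<kappa>\<in>UNIV. \<Sum>\<zeta>\<in>UNIV. \<Sum>\<gamma>\<in>UNIV. \<Sum>\<beta>\<in>UNIV. ?f \<delta> \<gamma> \<beta> \<kappa> \<zeta>)" for \<delta>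
    by (rule sum.cong[OF refl], rule sum.swap)
  also have "\<dots> \<delta> = (\<Sum>\<kappa>\<in>UNIV. \<Sum>\<zeta>\<in>UNIV. \<Sum>\<beta>\<in>UNIV. \<Sum>\<gamma>\<in>UNIV. ?f \<delta> \<gamma> \<beta> \<kappa> \<zeta>)" for \<delta>
    by (rule sum.cong[OF refl], rule sum.cong[OF refl], rule sum.swap)
  also have "\<dots> \<delta> = P (A (raised y)) (raised z) $ \<delta>" for \<delta>
    unfolding L2_def vec_lambda_beta A_raised
    unfolding raised_def vec_lambda_beta sum_product by (simp add: sum_distrib_left)
  finally show ?thesis by (simp add: vec_eq_iff)
qed

definition Q :: "nat \<Rightarrow> nat \<Rightarrow> 'r^'n" where "Q i j = P (A (s i)) (Dv (s j))"

text \<open>The sum of \<open>Q\<close> along an antidiagonal: the indices add up to k + m - 1 and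
  both range over k, ..., m - 1. With j = k + i it is the sum in \<open>tau_sum\<close>.\<close>

definition T :: "nat \<Rightarrow> nat \<Rightarrow> 'r^'n" where
  "T k m = (\<Sum>j=k..<m. Q j (m - 1 + k - j))"

definition B :: "nat \<Rightarrow> nat \<Rightarrow> 'r^'n" where
  "B m k = (if k \<le> m then T k m else - T m k)"

lemma raised_tau_sum: "raised (\<lambda>\<alpha>. \<pi> (tau_sum M \<alpha> k m)) = T k m"
proof -
  have "\<pi> (tau_sum M \<alpha> k m) = (\<Sum>i<m - k. \<Sum>\<gamma>\<in>UNIV. \<Sum>\<beta>\<in>UNIV.
      F (Gam M \<gamma> \<beta> \<alpha>) * (\<pi> (sg \<beta> (k + i) 0) * \<pi> (sg \<gamma> (m - i - 1) 1)))" for \<alpha>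
  proof -
    have "\<pi> (tau_sum M \<alpha> k m) = (\<Sum>\<gamma>\<in>UNIV. \<Sum>\<beta>\<in>UNIV. \<Sum>i<m - k.
        F (Gam M \<gamma> \<beta> \<alpha>) * (\<pi> (sg \<beta> (k + i) 0) * \<pi> (sg \<gamma> (m - i - 1) 1)))"
      by (simp add: tau_sum_def \<pi>_simps F_def sum_distrib_left)
    also have "\<dots> = (\<Sum>\<gamma>\<in>UNIV. \<Sum>i<m - k. \<Sum>\<beta>\<in>UNIV.
        F (Gam M \<gamma> \<beta> \<alpha>) * (\<pi> (sg \<beta> (k + i) 0) * \<pi> (sg \<gamma> (m - i - 1) 1)))"
      by (rule sum.cong[OF refl], rule sum.swap)
    also have "\<dots> = (\<Sum>i<m - k. \<Sum>\<gamma>\<in>UNIV. \<Sum>\<beta>\<in>UNIV.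
        F (Gam M \<gamma> \<beta> \<alpha>) * (\<pi> (sg \<beta> (k + i) 0) * \<pi> (sg \<gamma> (m - i - 1) 1)))"
      by (rule sum.swap)
    finally show ?thesis .
  qed
  moreover have "raised (\<lambda>\<alpha>. \<Sum>i\<in>I. g i \<alpha>) = (\<Sum>i\<in>I. raised (g i))" for g and I :: "nat set"
    unfolding raised_def vec_eq_iff sum_component sum_distrib_left vec_lambda_beta
    by (intro allI sum.swap)
  ultimately have "raised (\<lambda>\<alpha>. \<pi> (tau_sum M \<alpha> k m)) = (\<Sum>i<m - k. Q (k + i) (m - i - 1))"
    by (simp only: raised_Gam Q_def s_def[symmetric] Dv_s[symmetric])
  also have "\<dots> = T k m"
    unfolding T_def sum.atLeastLessThan_shift_0[of _ k m] by (intro sum.cong) auto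
  finally show ?thesis .
qed

lemma raised_b_tau: "raised (\<lambda>\<alpha>. \<pi> (b_tau m \<alpha> k)) = B m k"
proof -
  have "raised (\<lambda>\<alpha>. - f \<alpha>) = - raised f" for f
    by (simp add: raised_def vec_eq_iff sum_negf)
  then show ?thesis
    by (simp add: b_tau_def B_def \<pi>_minus raised_tau_sum)
qed

lemma B_skew: "B k m = - B m k"
  by (cases k m rule: linorder_cases) (auto simp: B_def T_def)

text \<open>Reversing the order of summation exchanges the two indices, so the sum is its own
  negative.\<close>

lemma antidiagonal_sum_skew:
  fixes R :: "nat \<Rightarrow> nat \<Rightarrow> 'r^'n"
  assumes "\<And>i j. R i j = - R j i"
  shows "(\<Sum>j=k..<m. R j (m - 1 + k - j)) = 0"
proof (rule vec_double_eq_0)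
  have "(\<Sum>j=k..<m. R j (m - 1 + k - j)) = (\<Sum>j=k..<m. R (m + k - Suc j) (m - 1 + k - (m + k - Suc j)))"
    by (rule sum.atLeastLessThan_rev)
  also have "\<dots> = (\<Sum>j=k..<m. - R j (m - 1 + k - j))"
  proof (intro sum.cong refl)
    fix j assume "j \<in> {k..<m}"
    then have "m + k - Suc j = m - 1 + k - j" "m - 1 + k - (m + k - Suc j) = j" by auto
    then show "R (m + k - Suc j) (m - 1 + k - (m + k - Suc j)) = - R j (m - 1 + k - j)"
      using assms by metis
  qed
  finally show "(\<Sum>j=k..<m. R j (m - 1 + k - j)) + (\<Sum>j=k..<m. R j (m - 1 + k - j)) = 0"
    by (simp add: sum_negf eq_neg_iff_add_eq_0)
qed

lemma Q_Suc: "Q i (Suc j) = U (Q i j) + P (A (s i)) (P u (A (s j)))"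
  by (simp add: Q_def recursion vec_add U_P_right)

lemma P_u_left: "P a (P u b) = P u (P a b)"
  using P_commute[of a u] u_central by (simp flip: P_assoc)

lemma Q_remainder_skew: "P (A (s i)) (P u (A (s j))) = - P (A (s j)) (P u (A (s i)))"
proof -
  have "P (A (s i)) (A (s j)) = - P (A (s j)) (A (s i))"
    by (intro P_skew1 degree_A degree_s)
  then show ?thesis by (simp add: P_u_left vec_minus)
qed

text \<open>Multiplication by the Euler field raises the second index of each \<open>Q\<close> by
  one. The remainders in \<open>Q_Suc\<close> are skew and cancel along the antidiagonal.\<close>

lemma U_T: "U (T k m) = (\<Sum>j=k..<m. Q j (m + k - j))"
proof -
  have "(\<Sum>j=k..<m. Q j (m + k - j)) = (\<Sum>j=k..<m. U (Q j (m - 1 + k - j)) + P (A (s j)) (P u (A (s (m - 1 + k - j)))))"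
  proof (intro sum.cong refl)
    fix j assume "j \<in> {k..<m}"
    then have "m + k - j = Suc (m - 1 + k - j)" by auto
    then show "Q j (m + k - j) = U (Q j (m - 1 + k - j)) + P (A (s j)) (P u (A (s (m - 1 + k - j))))"
      by (simp add: Q_Suc)
  qed
  then show ?thesis
    using antidiagonal_sum_skew[of "\<lambda>i j. P (A (s i)) (P u (A (s j)))" m k, OF Q_remainder_skew]
    by (simp add: sum.distrib T_def vec_sum)
qed

lemma B_Suc: "B m (Suc k) = U (B m k) + P (Dv (s m)) (A (s k))"
proof -
  have Q: "P (Dv (s m)) (A (s k)) = - Q k m"
    unfolding Q_def by (intro P_skew1 degree_A degree_s degree_Dv)
  show ?thesis
  proof (cases "k < m")
    case True
    \<comment> \<open>The antidiagonal for Suc k is shorter by its first term j = k, which the term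
      with \<open>A\<close> cancels.\<close>
    then have "U (T k m) = Q k m + (\<Sum>j=Suc k..<m. Q j (m + k - j))"
      unfolding U_T by (simp add: sum.atLeast_Suc_lessThan)
    moreover have "T (Suc k) m = (\<Sum>j=Suc k..<m. Q j (m + k - j))"
      unfolding T_def using True by (intro sum.cong) auto
    ultimately show ?thesis
      using True unfolding Q by (simp add: B_def)
  next
    case False
    \<comment> \<open>On the other side of the diagonal the sum becomes longer instead, by its last
      term j = k.\<close>
    have "T m (Suc k) = U (T m k) + Q k m"
      unfolding U_T using False by (simp add: T_def add.commute)
    moreover have "B m (Suc k) = - T m (Suc k)" "B m k = - T m k"
      using False by (auto simp: B_def T_def)
    ultimately show ?thesis
      unfolding Q by (simp add: vec_minus)
  qed
qed

text \<open>For k at least m both sides obey the same recursion in k and vanish at k = m, where an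
  odd vector is multiplied by itself. Both sides are skew in k and m, which gives the other
  case.\<close>

lemma P_u_B: "P u (B m k) = P (Dv (s m)) (Dv (s k))"
proof -
  have skew: "P (Dv (s m)) (Dv (s k)) = - P (Dv (s k)) (Dv (s m))" for k m
    by (intro P_skew1 degree_s degree_Dv)
  have up: "P u (B m k) = P (Dv (s m)) (Dv (s k))" if "m \<le> k" for k m
    using that
  proof (induction k rule: dec_induct)
    case base
    have "P (Dv (s m)) (Dv (s m)) = 0"
      by (rule vec_double_eq_0, rule iffD1[OF eq_neg_iff_add_eq_0], rule skew)
    then show ?case by (simp add: B_def T_def vec_zero)
  next
    case (step k)
    then show ?case
      by (simp add: B_Suc recursion vec_add U_P_right P_u_left)
  qed
  show ?thesis
  proof (cases "m \<le> k")
    case False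
    then have "P u (B k m) = P (Dv (s k)) (Dv (s m))" by (intro up) simp
    then show ?thesis
      unfolding B_skew[of m k] skew[of m k] by (simp add: vec_minus)
  qed (rule up)
qed

lemma homog_tau_sum: "homog 2 (tau_sum M \<alpha> k m)"
proof -
  have *: "homog 2 (sg \<beta> i r * sg \<gamma> j q :: 'n alg)" for \<beta> \<gamma> i j r q
    using homog_mult[OF homog_sg(1) homog_sg(1)] by (simp add: numeral_2_eq_2)
  show ?thesis
    unfolding tau_sum_def by (intro homog_sum homog_mult0[OF homog_fn] *)
qed

lemma flow_tau: "is_flow 1 (a_tau m) (b_tau m)"
proof (rule is_flowI[OF _ _ \<pi>_a_tau[symmetric] raised_b_tau[symmetric] B_Suc P_u_B])
  show "homog 1 (a_tau m \<alpha>)" for \<alpha>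
    unfolding a_tau_def by (intro homog_sum homog_mult0 homog_cst homog_sg)
  show "homog (1 + 1) (b_tau m \<alpha> k)" for \<alpha> k
    using homog_tau_sum unfolding b_tau_def one_add_one by auto
qed

end

section \<open>Commutativity\<close>

context frobenius_ring
begin

section \<open>Contractions of bilinear maps with matrices\<close>

lemma L2_L1_left:
  assumes "\<And>\<alpha> \<beta> \<gamma>. hol (T \<alpha> \<beta> \<gamma>)" "\<And>\<alpha> \<beta>. hol (R \<alpha> \<beta>)"
  shows "L2 T (L1 R a) b = L2 (\<lambda>\<alpha> \<delta> \<gamma> x. \<Sum>\<kappa>\<in>UNIV. T \<alpha> \<kappa> \<gamma> x * R \<kappa> \<delta> x) a b"
proof -
  have "L2 T (L1 R a) b $ \<alpha> = (\<Sum>\<kappa>\<in>UNIV. \<Sum>\<gamma>\<in>UNIV. \<Sum>\<delta>\<in>UNIV. F (T \<alpha> \<kappa> \<gamma>) * F (R \<kappa> \<delta>) * (a $ \<delta> * b $ \<gamma>))" for \<alpha>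
    by (simp add: L2_def L1_def sum_distrib_left sum_distrib_right mult.assoc)
  also have "\<dots> \<alpha> = (\<Sum>\<kappa>\<in>UNIV. \<Sum>\<delta>\<in>UNIV. \<Sum>\<gamma>\<in>UNIV. F (T \<alpha> \<kappa> \<gamma>) * F (R \<kappa> \<delta>) * (a $ \<delta> * b $ \<gamma>))" for \<alpha>
    by (rule sum.cong[OF refl], rule sum.swap)
  also have "\<dots> \<alpha> = (\<Sum>\<delta>\<in>UNIV. \<Sum>\<kappa>\<in>UNIV. \<Sum>\<gamma>\<in>UNIV. F (T \<alpha> \<kappa> \<gamma>) * F (R \<kappa> \<delta>) * (a $ \<delta> * b $ \<gamma>))" for \<alpha>
    by (rule sum.swap)
  also have "\<dots> \<alpha> = (\<Sum>\<delta>\<in>UNIV. \<Sum>\<gamma>\<in>UNIV. \<Sum>\<kappa>\<in>UNIV. F (T \<alpha> \<kappa> \<gamma>) * F (R \<kappa> \<delta>) * (a $ \<delta> * b $ \<gamma>))" for \<alpha>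
    by (rule sum.cong[OF refl], rule sum.swap)
  also have "\<dots> \<alpha> = L2 (\<lambda>\<alpha> \<delta> \<gamma> x. \<Sum>\<kappa>\<in>UNIV. T \<alpha> \<kappa> \<gamma> x * R \<kappa> \<delta> x) a b $ \<alpha>" for \<alpha>
    using assms by (simp add: L2_def F_sum F_mult sum_distrib_right)
  finally show ?thesis by (simp add: vec_eq_iff)
qed

lemma L1_L2:
  assumes "\<And>\<alpha> \<beta> \<gamma>. hol (T \<alpha> \<beta> \<gamma>)" "\<And>\<alpha> \<beta>. hol (R \<alpha> \<beta>)"
  shows "L1 R (L2 T a b) = L2 (\<lambda>\<alpha> \<delta> \<gamma> x. \<Sum>\<kappa>\<in>UNIV. R \<alpha> \<kappa> x * T \<kappa> \<delta> \<gamma> x) a b"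
proof -
  have "L1 R (L2 T a b) $ \<alpha> = (\<Sum>\<kappa>\<in>UNIV. \<Sum>\<delta>\<in>UNIV. \<Sum>\<gamma>\<in>UNIV. F (R \<alpha> \<kappa>) * F (T \<kappa> \<delta> \<gamma>) * (a $ \<delta> * b $ \<gamma>))" for \<alpha>
    by (simp add: L2_def L1_def sum_distrib_left mult.assoc)
  also have "\<dots> \<alpha> = (\<Sum>\<delta>\<in>UNIV. \<Sum>\<kappa>\<in>UNIV. \<Sum>\<gamma>\<in>UNIV. F (R \<alpha> \<kappa>) * F (T \<kappa> \<delta> \<gamma>) * (a $ \<delta> * b $ \<gamma>))" for \<alpha>
    by (rule sum.swap)
  also have "\<dots> \<alpha> = (\<Sum>\<delta>\<in>UNIV. \<Sum>\<gamma>\<in>UNIV. \<Sum>\<kappa>\<in>UNIV. F (R \<alpha> \<kappa>) * F (T \<kappa> \<delta> \<gamma>) * (a $ \<delta> * b $ \<gamma>))" for \<alpha>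
    by (rule sum.cong[OF refl], rule sum.swap)
  also have "\<dots> \<alpha> = L2 (\<lambda>\<alpha> \<delta> \<gamma> x. \<Sum>\<kappa>\<in>UNIV. R \<alpha> \<kappa> x * T \<kappa> \<delta> \<gamma> x) a b $ \<alpha>" for \<alpha>
    using assms by (simp add: L2_def F_sum F_mult sum_distrib_right)
  finally show ?thesis by (simp add: vec_eq_iff)
qed

lemma L2_add:
  assumes "\<And>\<alpha> \<beta> \<gamma>. hol (T \<alpha> \<beta> \<gamma>)" "\<And>\<alpha> \<beta> \<gamma>. hol (T' \<alpha> \<beta> \<gamma>)"
  shows "L2 T a b + L2 T' a b = L2 (\<lambda>\<alpha> \<beta> \<gamma> x. T \<alpha> \<beta> \<gamma> x + T' \<alpha> \<beta> \<gamma> x) a b"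
  using assms by (simp add: L2_def vec_eq_iff F_add distrib_right sum.distrib)

end

context calibrated_ring
begin

lemma H_H: "H \<alpha> p (H \<beta> q a) = H \<beta> q (H \<alpha> p a)"
  unfolding H_Fv by (rule Fv_P_right)

text \<open>The identity of functions behind \<open>H_H\<close>; as such it can be
  differentiated.\<close>

lemma Hess_Hess:
  assumes x: "x \<in> chart M"
  shows "(\<Sum>\<kappa>\<in>UNIV. Hess \<beta> p \<alpha> \<kappa> x * Hess \<beta>' q \<kappa> \<delta> x) = (\<Sum>\<kappa>\<in>UNIV. Hess \<beta>' q \<alpha> \<kappa> x * Hess \<beta> p \<kappa> \<delta> x)"
proof -
  have *: "(\<Sum>\<kappa>\<in>UNIV. (\<Sum>\<epsilon>\<in>UNIV. f \<epsilon> * C \<alpha> \<epsilon> \<kappa> x) * (\<Sum>\<nu>\<in>UNIV. g \<nu> * C \<kappa> \<nu> \<delta> x)) =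
      (\<Sum>\<epsilon>\<in>UNIV. \<Sum>\<nu>\<in>UNIV. f \<epsilon> * g \<nu> * (\<Sum>\<kappa>\<in>UNIV. C \<alpha> \<epsilon> \<kappa> x * C \<kappa> \<nu> \<delta> x))" for f g :: "'n \<Rightarrow> complex"
  proof -
    have "(\<Sum>\<kappa>\<in>UNIV. (\<Sum>\<epsilon>\<in>UNIV. f \<epsilon> * C \<alpha> \<epsilon> \<kappa> x) * (\<Sum>\<nu>\<in>UNIV. g \<nu> * C \<kappa> \<nu> \<delta> x)) =
      (\<Sum>\<kappa>\<in>UNIV. \<Sum>\<epsilon>\<in>UNIV. \<Sum>\<nu>\<in>UNIV. f \<epsilon> * g \<nu> * (C \<alpha> \<epsilon> \<kappa> x * C \<kappa> \<nu> \<delta> x))"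
      by (simp add: sum_product mult_ac)
    also have "\<dots> = (\<Sum>\<epsilon>\<in>UNIV. \<Sum>\<kappa>\<in>UNIV. \<Sum>\<nu>\<in>UNIV. f \<epsilon> * g \<nu> * (C \<alpha> \<epsilon> \<kappa> x * C \<kappa> \<nu> \<delta> x))"
      by (rule sum.swap)
    also have "\<dots> = (\<Sum>\<epsilon>\<in>UNIV. \<Sum>\<nu>\<in>UNIV. \<Sum>\<kappa>\<in>UNIV. f \<epsilon> * g \<nu> * (C \<alpha> \<epsilon> \<kappa> x * C \<kappa> \<nu> \<delta> x))"
      by (rule sum.cong[OF refl], rule sum.swap)
    finally show ?thesis by (simp add: sum_distrib_left)
  qed
  have s: "(\<Sum>\<kappa>\<in>UNIV. C \<alpha> \<epsilon> \<kappa> x * C \<kappa> \<nu> \<delta> x) = (\<Sum>\<kappa>\<in>UNIV. C \<alpha> \<nu> \<kappa> x * C \<kappa> \<epsilon> \<delta> x)" for \<epsilon> \<nu>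
    using C_assoc[OF x, of \<epsilon> \<nu> \<alpha> \<delta>] C_assoc[OF x, of \<nu> \<epsilon> \<alpha> \<delta>] by (simp add: C_sym[OF x, of _ \<epsilon> \<nu>] mult.commute)
  show ?thesis
    unfolding Hess_C[OF x] *
    by (subst sum.swap, rule sum.cong[OF refl], rule sum.cong[OF refl], subst s, simp add: mult_ac)
qed

text \<open>The derivative of \<open>Hess_Hess\<close> in direction \<gamma>, with differentiation
  indices exchanged by \<open>pd_Hess\<close>. The two sides are the coefficients of the products of
  u and s'_k in the two orders of a pair of even flows.\<close>

lemma pd_Hess_Hess:
  assumes x: "x \<in> chart M"
  shows "(\<Sum>\<kappa>\<in>UNIV. pd \<kappa> (Hess \<beta> p \<alpha> \<gamma>) x * Hess \<beta>' q \<kappa> \<delta> x) + (\<Sum>\<kappa>\<in>UNIV. Hess \<beta> p \<alpha> \<kappa> x * pd \<delta> (Hess \<beta>' q \<kappa> \<gamma>) x) =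
    (\<Sum>\<kappa>\<in>UNIV. pd \<kappa> (Hess \<beta>' q \<alpha> \<gamma>) x * Hess \<beta> p \<kappa> \<delta> x) + (\<Sum>\<kappa>\<in>UNIV. Hess \<beta>' q \<alpha> \<kappa> x * pd \<delta> (Hess \<beta> p \<kappa> \<gamma>) x)"
proof -
  have *: "pd \<gamma> (\<lambda>x. \<Sum>\<kappa>\<in>UNIV. Hess \<beta> p \<alpha> \<kappa> x * Hess \<beta>' q \<kappa> \<delta> x) x =
      (\<Sum>\<kappa>\<in>UNIV. pd \<kappa> (Hess \<beta> p \<alpha> \<gamma>) x * Hess \<beta>' q \<kappa> \<delta> x) + (\<Sum>\<kappa>\<in>UNIV. Hess \<beta> p \<alpha> \<kappa> x * pd \<delta> (Hess \<beta>' q \<kappa> \<gamma>) x)"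
    for \<beta> \<beta>' p q
    using x by (simp add: pd_sum[of _ "chart M"] pd_mult[of "chart M"] sum.distrib pd_Hess[OF x, of \<gamma>])
  show ?thesis
    unfolding *[symmetric] by (rule pd_cong[OF open_chart x]) (rule Hess_Hess)
qed

text \<open>The even flow is a conservation law: its value on v is the x-derivative of the gradient
  with index p + 1. Any flow commutes with the x-derivative, so only that gradient has to be
  differentiated.\<close>

lemma push_a_t:
  assumes fl: "is_flow e a b"
  shows "push (odd e) (flow_gen M a b) (\<pi> (a_t \<beta> p \<alpha>)) = Dv (H \<beta> p (\<chi> \<alpha>. \<pi> (a \<alpha>))) $ \<alpha>"
proof -
  have g: "F (pd \<kappa> (grad \<beta> (Suc p) \<alpha>)) = F (Hess \<beta> p \<alpha> \<kappa>)" for \<kappa>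
    by (rule F_cong) (rule pd_grad)
  have "\<pi> (a_t \<beta> p \<alpha>) = H \<beta> p u $ \<alpha>"
    by (simp flip: \<pi>_a_t)
  also have "\<dots> = D (F (grad \<beta> (Suc p) \<alpha>))"
    by (simp add: D_F g L1_def u_def)
  finally have "push (odd e) (flow_gen M a b) (\<pi> (a_t \<beta> p \<alpha>)) = D (\<Sum>\<kappa>\<in>UNIV. F (Hess \<beta> p \<alpha> \<kappa>) * \<pi> (a \<kappa>))"
    by (simp only: push_flow_D[OF fl] push_flow_F[OF fl hol_grad] g)
  then show ?thesis by (simp add: Dv_def L1_def)
qed

lemma push_a_tau:
  assumes fl: "is_flow e a b"
  shows "push (odd e) (flow_gen M a b) (\<pi> (a_tau m \<alpha>)) = Dv (raised (\<lambda>\<beta>. \<pi> (b \<beta> m))) $ \<alpha>"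
proof -
  have "\<pi> (a_tau m \<alpha>) = Dv (s m) $ \<alpha>"
    by (simp flip: \<pi>_a_tau)
  then have "push (odd e) (flow_gen M a b) (\<pi> (a_tau m \<alpha>)) = vec_push (odd e) (flow_gen M a b) (Dv (s m)) $ \<alpha>"
    by (simp add: vec_push_def)
  then show ?thesis
    unfolding vec_push_flow_Dv[OF fl] vec_push_flow_s[OF fl] .
qed

section \<open>Action of the flows on vectors and the three commutators\<close>

abbreviation "vt \<beta> p \<equiv> vec_push False (flow_gen M (a_t \<beta> p) (b_t \<beta> p))"
abbreviation "vtau m \<equiv> vec_push True (flow_gen M (a_tau m) (b_tau m))"

lemma vt_Dv: "vt \<beta> p (Dv z) = Dv (vt \<beta> p z)"
  and vtau_Dv: "vtau m (Dv z) = Dv (vtau m z)"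
  using vec_push_flow_Dv[OF flow_t] vec_push_flow_Dv[OF flow_tau] by simp_all

lemma vt_s: "vt \<beta> p (s k) = H \<beta> p (Dv (s k))"
  and vtau_s: "vtau m (s k) = B m k"
  using vec_push_flow_s[OF flow_t] vec_push_flow_s[OF flow_tau] by (simp_all add: raised_b_t raised_b_tau)

lemma vt_H: "vt \<beta> p (H \<beta>' q z) = L2 (\<lambda>\<alpha> \<kappa> \<gamma>. pd \<kappa> (Hess \<beta>' q \<alpha> \<gamma>)) (H \<beta> p u) z + H \<beta>' q (vt \<beta> p z)"
  and vtau_H: "vtau m (H \<beta>' q z) = L2 (\<lambda>\<alpha> \<kappa> \<gamma>. pd \<kappa> (Hess \<beta>' q \<alpha> \<gamma>)) (Dv (s m)) z + H \<beta>' q (vtau m z)"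
  using vec_push_flow_L1[OF flow_t, of "Hess \<beta>' q"] vec_push_flow_L1[OF flow_tau, of "Hess \<beta>' q"]
  by (simp_all add: \<pi>_a_t \<pi>_a_tau)

lemma preserves_t: "preserves False (flow_gen M (a_t \<beta> p) (b_t \<beta> p))"
  and preserves_tau: "preserves True (flow_gen M (a_tau m) (b_tau m))"
  using flow_preserves[OF flow_t] flow_preserves[OF flow_tau] by simp_all

lemma vt_minus: "vt \<beta> p (- z) = - vt \<beta> p z"
  and vtau_minus: "vtau m (- z) = - vtau m z"
  by (rule additive.minus[OF additive_vec_push] preserves_t preserves_tau)+

text \<open>Third derivatives of the Hamiltonian are symmetric while the two odd vectors
  anticommute.\<close>

lemma dH_skew:
  "L2 (\<lambda>\<alpha> \<kappa> \<gamma>. pd \<kappa> (Hess \<beta> p \<alpha> \<gamma>)) (Dv (s m)) (Dv (s k)) = - L2 (\<lambda>\<alpha> \<kappa> \<gamma>. pd \<kappa> (Hess \<beta> p \<alpha> \<gamma>)) (Dv (s k)) (Dv (s m))"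
proof -
  have "L2 (\<lambda>\<alpha> \<kappa> \<gamma>. pd \<gamma> (Hess \<beta> p \<alpha> \<kappa>)) a b = L2 (\<lambda>\<alpha> \<kappa> \<gamma>. pd \<kappa> (Hess \<beta> p \<alpha> \<gamma>)) a b" for a b
    by (rule L2_cong) (rule pd_Hess)
  then show ?thesis
    by (subst L2_skew) (auto intro!: degree_skew degree_Dv degree_s)
qed

lemma t_t_commute:
  "\<pi> (scomm (odd (0::nat)) (flow_gen M (a_t \<alpha> p) (b_t \<alpha> p)) (odd (0::nat)) (flow_gen M (a_t \<beta> q) (b_t \<beta> q)) x) = 0"
proof (rule comm_eq_0[OF flow_t flow_t])
  show vals: "push (odd (0::nat)) (flow_gen M (a_t \<alpha> p) (b_t \<alpha> p)) (\<pi> (a_t \<beta> q \<kappa>)) =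
      (if odd (0::nat) \<and> odd (0::nat) then - push (odd (0::nat)) (flow_gen M (a_t \<beta> q) (b_t \<beta> q)) (\<pi> (a_t \<alpha> p \<kappa>))
       else push (odd (0::nat)) (flow_gen M (a_t \<beta> q) (b_t \<beta> q)) (\<pi> (a_t \<alpha> p \<kappa>)))" for \<kappa>
    unfolding push_a_t[OF flow_t] \<pi>_a_t by (simp add: H_H)
  fix k
  \<comment> \<open>All terms in u and s'_k are collected in a single bilinear form, to which
    \<open>pd_Hess_Hess\<close> applies. The rest, in the second x-derivative of s_k, is symmetric
    by \<open>H_H\<close>.\<close>
  have E: "vt \<alpha> p (H \<beta> q (Dv (s k))) =
      L2 (\<lambda>\<alpha>' \<delta> \<gamma> x. (\<Sum>\<kappa>\<in>UNIV. pd \<kappa> (Hess \<beta> q \<alpha>' \<gamma>) x * Hess \<alpha> p \<kappa> \<delta> x)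
        + (\<Sum>\<kappa>\<in>UNIV. Hess \<beta> q \<alpha>' \<kappa> x * pd \<delta> (Hess \<alpha> p \<kappa> \<gamma>) x)) u (Dv (s k))
      + H \<beta> q (H \<alpha> p (Dv (Dv (s k))))" for \<alpha> p \<beta> q
  proof -
    have "vt \<alpha> p (H \<beta> q (Dv (s k))) =
        (L2 (\<lambda>\<alpha> \<kappa> \<gamma>. pd \<kappa> (Hess \<beta> q \<alpha> \<gamma>)) (H \<alpha> p u) (Dv (s k))
        + H \<beta> q (L2 (\<lambda>\<alpha>' \<kappa> \<gamma>. pd \<kappa> (Hess \<alpha> p \<alpha>' \<gamma>)) u (Dv (s k)))) + H \<beta> q (H \<alpha> p (Dv (Dv (s k))))"
      by (simp add: vt_H vt_Dv vt_s Dv_L1 vec_add add.assoc)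
    then show ?thesis
      by (subst (asm) L2_L1_left, simp, simp, subst (asm) L1_L2, simp, simp, subst (asm) L2_add) auto
  qed
  have "vt \<alpha> p (H \<beta> q (Dv (s k))) = vt \<beta> q (H \<alpha> p (Dv (s k)))"
    unfolding E H_H[of \<alpha> p] by (intro arg_cong2[of _ _ _ _ "(+)"] L2_cong pd_Hess_Hess refl)
  then show "sigma_comm 0 (a_t \<alpha> p) (b_t \<alpha> p) 0 (a_t \<beta> q) (b_t \<beta> q) k = 0"
    unfolding sigma_comm_eq[OF flow_t flow_t vals] raised_b_t by simp
qed

lemma t_tau_commute:
  "\<pi> (scomm (odd (0::nat)) (flow_gen M (a_t \<beta> p) (b_t \<beta> p)) (odd (1::nat)) (flow_gen M (a_tau m) (b_tau m)) x) = 0"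
proof (rule comm_eq_0[OF flow_t flow_tau])
  show vals: "push (odd (0::nat)) (flow_gen M (a_t \<beta> p) (b_t \<beta> p)) (\<pi> (a_tau m \<kappa>)) =
      (if odd (0::nat) \<and> odd (1::nat) then - push (odd (1::nat)) (flow_gen M (a_tau m) (b_tau m)) (\<pi> (a_t \<beta> p \<kappa>))
       else push (odd (1::nat)) (flow_gen M (a_tau m) (b_tau m)) (\<pi> (a_t \<beta> p \<kappa>)))" for \<kappa> m
    unfolding push_a_t[OF flow_tau] push_a_tau[OF flow_t] raised_b_t \<pi>_a_tau by simp
  \<comment> \<open>The flow index m is kept free, because the skew symmetry exchanges it with
    k.\<close>
  define z where "z m k = sigma_comm 0 (a_t \<beta> p) (b_t \<beta> p) 1 (a_tau m) (b_tau m) k" for m k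
  have z: "z m k = vt \<beta> p (B m k) - vtau m (H \<beta> p (Dv (s k)))" for m k
    unfolding z_def sigma_comm_eq[OF flow_t flow_tau vals] raised_b_t raised_b_tau by simp
  have skew: "z m k = - z k m" for m k
    unfolding z vtau_H vtau_Dv vtau_s B_skew[of m k] dH_skew[of \<beta> p k m]
    by (simp add: vt_minus vec_minus)
  have "z m m = 0" for m
    by (rule vec_double_eq_0, rule iffD1[OF eq_neg_iff_add_eq_0], rule skew)
  then have up: "z m k = 0" if "m \<le> k" for m k
    using sigma_comm_vanishes_upwards[OF flow_t flow_tau vals _ that] unfolding z_def by blast
  have "z m k = 0" for k
    using up[of m k] up[of k m] skew[of m k] by (cases "m \<le> k") auto
  then show "sigma_comm 0 (a_t \<beta> p) (b_t \<beta> p) 1 (a_tau m) (b_tau m) k = 0" for k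
    unfolding z_def .
qed

lemma tau_tau_commute:
  "\<pi> (scomm (odd (1::nat)) (flow_gen M (a_tau m) (b_tau m)) (odd (1::nat)) (flow_gen M (a_tau l) (b_tau l)) x) = 0"
proof (rule comm_eq_0[OF flow_tau flow_tau])
  show vals: "push (odd (1::nat)) (flow_gen M (a_tau m) (b_tau m)) (\<pi> (a_tau l \<kappa>)) =
      (if odd (1::nat) \<and> odd (1::nat) then - push (odd (1::nat)) (flow_gen M (a_tau l) (b_tau l)) (\<pi> (a_tau m \<kappa>))
       else push (odd (1::nat)) (flow_gen M (a_tau l) (b_tau l)) (\<pi> (a_tau m \<kappa>)))" for \<kappa> m l
    unfolding push_a_tau[OF flow_tau] raised_b_tau B_skew[of m l] by (simp add: vec_minus)
  define z where "z m l k = sigma_comm 1 (a_tau m) (b_tau m) 1 (a_tau l) (b_tau l) k" for m l k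
  have z: "z m l k = vtau m (B l k) + vtau l (B m k)" for m l k
    unfolding z_def sigma_comm_eq[OF flow_tau flow_tau vals] raised_b_tau by simp
  have sym: "z m l k = z l m k" for m l k
    by (simp add: z add.commute)
  \<comment> \<open>The three commutators expand into six terms, which cancel in pairs because each
    flow meets \<open>B\<close> with both orders of the other two indices.\<close>
  have cyclic: "z m l k + z l k m + z k m l = 0" for m l k
    unfolding z B_skew[of l k] B_skew[of m l] B_skew[of k m] vtau_minus by simp
  have up: "z m l k = 0" if "z m l j = 0" "j \<le> k" for m l j k
    using sigma_comm_vanishes_upwards[OF flow_tau flow_tau vals _ that(2)] that(1) unfolding z_def by blast
  have "z m m m = 0" for m
    by (rule vec_triple_eq_0) (rule cyclic)
  then have diag: "z k k m = 0" if "k \<le> m" for k m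
    using up that by blast
  \<comment> \<open>In the cyclic sum for k, k, m one term vanishes by \<open>diag\<close> and the
    remaining two are equal by \<open>sym\<close>.\<close>
  have "z k m k = 0" if "k \<le> m" for k m
  proof (rule vec_double_eq_0)
    show "z k m k + z k m k = 0"
      using cyclic[of k k m] diag[OF that] sym[of m k k] by simp
  qed
  then have le: "z k m j = 0" if "k \<le> m" "k \<le> j" for k m j
    using up that by blast
  have "z m l k = 0" for k
  proof -
    \<comment> \<open>Split by the smallest index. If it belongs to one of the flows,
      \<open>le\<close> applies up to \<open>sym\<close>; if it belongs to the odd variable, the
      other two terms of the cyclic sum have it on a flow.\<close>
    consider "m \<le> l" "m \<le> k" | "l \<le> m" "l \<le> k" | "k \<le> m" "k \<le> l" by linarith
    then show ?thesis
    proof cases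
      case 3
      then have "z l k m = 0" "z k m l = 0"
        using le[of k l m] le[of k m l] sym[of l k m] by auto
      then show ?thesis using cyclic[of m l k] by simp
    qed (use le sym in metis)+
  qed
  then show "sigma_comm 1 (a_tau m) (b_tau m) 1 (a_tau l) (b_tau l) k = 0" for k
    unfolding z_def .
qed

end

definition flows_commute :: "('n::finite) frob \<Rightarrow> bool" where
  "flows_commute M \<longleftrightarrow> (\<forall>\<beta> p. descends M (flow_t M \<beta> p)) \<and>
         (\<forall>m. descends M (flow_tau M m)) \<and>
         (\<forall>\<beta> p x. ring_eq M (flow_t M \<beta> p (dx M x)) (dx M (flow_t M \<beta> p x))) \<and>
         (\<forall>m x. ring_eq M (flow_tau M m (dx M x)) (dx M (flow_tau M m x))) \<and>
         (\<forall>\<alpha> p \<beta> q x. ring_eq M (flow_t M \<alpha> p (flow_t M \<beta> q x)) (flow_t M \<beta> q (flow_t M \<alpha> p x))) \<and>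
         (\<forall>\<alpha> p m x. ring_eq M (flow_t M \<alpha> p (flow_tau M m x)) (flow_tau M m (flow_t M \<alpha> p x))) \<and>
         (\<forall>m k x. ring_eq M (flow_tau M m (flow_tau M k x) + flow_tau M k (flow_tau M m x)) 0)"

lemma (in calibrated_ring) flows_commute: "flows_commute M"
  unfolding flows_commute_def
proof (intro conjI allI)
  show "descends M (flow_t M \<beta> p)" for \<beta> p
    unfolding flow_t_eq by (rule preserves_descends[OF preserves_t])
  show "descends M (flow_tau M m)" for m
    unfolding flow_tau_eq by (rule preserves_descends[OF preserves_tau])
  show "ring_eq M (flow_t M \<beta> p (dx M x)) (dx M (flow_t M \<beta> p x))" for \<beta> p x
    using flow_commutes_dx[OF flow_homog[OF flow_t] refl, of \<beta> p x] by (simp add: flow_t_eq \<pi>_eq_iff)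
  show "ring_eq M (flow_tau M m (dx M x)) (dx M (flow_tau M m x))" for m x
    using flow_commutes_dx[OF flow_homog[OF flow_tau] refl, of m x] by (simp add: flow_tau_eq \<pi>_eq_iff)
  show "ring_eq M (flow_t M \<alpha> p (flow_t M \<beta> q x)) (flow_t M \<beta> q (flow_t M \<alpha> p x))" for \<alpha> p \<beta> q x
    using t_t_commute[of \<alpha> p \<beta> q x] by (simp add: scomm_def flow_t_eq \<pi>_diff flip: \<pi>_eq_iff)
  show "ring_eq M (flow_t M \<alpha> p (flow_tau M m x)) (flow_tau M m (flow_t M \<alpha> p x))" for \<alpha> p m x
    using t_tau_commute[of \<alpha> p m x] by (simp add: scomm_def flow_t_eq flow_tau_eq \<pi>_diff flip: \<pi>_eq_iff)
  show "ring_eq M (flow_tau M m (flow_tau M k x) + flow_tau M k (flow_tau M m x)) 0" for m k x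
    using tau_tau_commute[of m k x] by (simp add: scomm_def flow_tau_eq \<pi>_simps flip: \<pi>_eq_iff)
qed

section \<open>The differential ring as a type\<close>

text \<open>
  A type cannot depend on the manifold, so the differential ring is formed as a type for one manifold only,
  a counterexample to the theorem if there is any.
\<close>

definition chosen :: "('n::finite) frob" where
  "chosen = (SOME M. frobenius_manifold M \<and> calibration M \<and> \<not> flows_commute M)"

lemma relations_uminus: "x \<in> relations M \<Longrightarrow> - x \<in> relations M"
  using relations.mult[of x M "-1" 1] by simp

lemma relations_mult_left: "x \<in> relations M \<Longrightarrow> a * x \<in> relations M"
  and relations_mult_right: "x \<in> relations M \<Longrightarrow> x * b \<in> relations M"
  using relations.mult[of x M a 1] relations.mult[of x M 1 b] by simp_all

lemma equivp_ring_eq: "equivp (ring_eq M)"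
proof (rule equivpI)
  show "reflp (ring_eq M)"
    by (simp add: reflp_def ring_eq_def relations.zero)
  show "symp (ring_eq M)"
    using relations_uminus[of _ M] by (auto simp: symp_def ring_eq_def) (metis minus_diff_eq)
  show "transp (ring_eq M)"
  proof (rule transpI)
    fix x y z
    assume "ring_eq M x y" "ring_eq M y z"
    then have "(x - y) + (y - z) \<in> relations M"
      unfolding ring_eq_def by (rule relations.add)
    then show "ring_eq M x z" by (simp add: ring_eq_def)
  qed
qed

quotient_type 'n diff_ring = "('n::finite) alg" / "ring_eq (chosen :: 'n frob)"
  by (rule equivp_ring_eq)

instantiation diff_ring :: (finite) "{ring,monoid_mult}"
begin

lift_definition zero_diff_ring :: "'a diff_ring" is 0 .
lift_definition one_diff_ring :: "'a diff_ring" is 1 .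
lift_definition plus_diff_ring :: "'a diff_ring \<Rightarrow> 'a diff_ring \<Rightarrow> 'a diff_ring" is "(+)"
  unfolding ring_eq_def by (metis add_diff_add relations.add)
lift_definition minus_diff_ring :: "'a diff_ring \<Rightarrow> 'a diff_ring \<Rightarrow> 'a diff_ring" is "(-)"
proof -
  fix x x' y y' :: "'a alg"
  assume "ring_eq chosen x x'" "ring_eq chosen y y'"
  then have "(x - x') + - (y - y') \<in> relations chosen"
    unfolding ring_eq_def by (intro relations.add relations_uminus)
  then show "ring_eq chosen (x - y) (x' - y')"
    by (simp add: ring_eq_def algebra_simps)
qed
lift_definition uminus_diff_ring :: "'a diff_ring \<Rightarrow> 'a diff_ring" is uminus
  unfolding ring_eq_def by (metis minus_diff_minus relations_uminus)
lift_definition times_diff_ring :: "'a diff_ring \<Rightarrow> 'a diff_ring \<Rightarrow> 'a diff_ring" is "(*)"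
proof -
  fix x x' y y' :: "'a alg"
  assume "ring_eq chosen x x'" "ring_eq chosen y y'"
  then have "(x - x') * y + x' * (y - y') \<in> relations chosen"
    unfolding ring_eq_def by (intro relations.add relations_mult_left relations_mult_right)
  then show "ring_eq chosen (x * y) (x' * y')"
    by (simp add: ring_eq_def algebra_simps)
qed

instance
  by standard (transfer; simp add: ring_eq_def relations.zero algebra_simps)+

end

lemma quotient_ring_diff_ring:
  assumes "open (chart (chosen :: ('n::finite) frob))"
  shows "quotient_ring (chosen :: 'n frob) abs_diff_ring"
proof
  show "\<exists>x. abs_diff_ring x = z" for z :: "'n diff_ring"
    by (metis Quotient_abs_rep[OF Quotient_diff_ring])
  show "abs_diff_ring x = 0 \<longleftrightarrow> x \<in> relations (chosen :: 'n frob)" for x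
    by (simp add: zero_diff_ring_def diff_ring.abs_eq_iff ring_eq_def)
qed (simp_all add: assms plus_diff_ring.abs_eq times_diff_ring.abs_eq one_diff_ring_def)

theorem theorem3p5:
  fixes M :: "('n::finite) frob"
  assumes "frobenius_manifold M" and "calibration M"
  shows "(\<forall>\<beta> p. descends M (flow_t M \<beta> p)) \<and>
         (\<forall>m. descends M (flow_tau M m)) \<and>
         (\<forall>\<beta> p x. ring_eq M (flow_t M \<beta> p (dx M x)) (dx M (flow_t M \<beta> p x))) \<and>
         (\<forall>m x. ring_eq M (flow_tau M m (dx M x)) (dx M (flow_tau M m x))) \<and>
         (\<forall>\<alpha> p \<beta> q x. ring_eq M (flow_t M \<alpha> p (flow_t M \<beta> q x)) (flow_t M \<beta> q (flow_t M \<alpha> p x))) \<and>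
         (\<forall>\<alpha> p m x. ring_eq M (flow_t M \<alpha> p (flow_tau M m x)) (flow_tau M m (flow_t M \<alpha> p x))) \<and>
         (\<forall>m k x. ring_eq M (flow_tau M m (flow_tau M k x) + flow_tau M k (flow_tau M m x)) 0)"
  unfolding flows_commute_def[symmetric]
proof (rule ccontr)
  assume "\<not> flows_commute M"
  with assms have "\<exists>M::'n frob. frobenius_manifold M \<and> calibration M \<and> \<not> flows_commute M" by blast
  \<comment> \<open>Only the assumed counterexample guarantees that the choice has its defining
    property. With it the abstract development applies to \<open>chosen\<close> and refutes the last
    part of that property.\<close>
  then have c: "frobenius_manifold (chosen :: 'n frob)" "calibration (chosen :: 'n frob)"
      "\<not> flows_commute (chosen :: 'n frob)"
    unfolding chosen_def by (metis (mono_tags, lifting) someI_ex)+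
  interpret quotient_ring "chosen :: 'n frob" abs_diff_ring
    using c(1) by (intro quotient_ring_diff_ring) (simp add: frobenius_manifold_def)
  interpret calibrated_ring "chosen :: 'n frob" abs_diff_ring
    by unfold_locales (rule c)+
  show False
    using flows_commute c(3) by blast
qed

end
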